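(* For every $\epsilon>0$ there exists $\gamma>0$ such that for arbitrarily large $n$ there exist a connected unweighted undirected graph $H$ on an $n$-element node set $V$ and distinct nodes $s,t\in V$ such that, letting $K_n=(V,E)$ be the complete undirected graph on $V$, $d=(d_e)_{e\in E}$ the shortest-path distances in $H$ (so $d_{\{u,v\}}$ is the number of edges on a shortest $u$–$v$ path in $H$), and $r=\lfloor\gamma n\rfloor$, \[\frac{\min_{x\in SP^{\mathrm{int}}(K_n,s,t)} d\cdot x}{\min_{x\in N_+^{r}(SP(K_n,s,t))} d\cdot x}\;\ge\;\frac32-\epsilon .\] That is, the integrality gap of $o(n)$ rounds of the Lovász–Schrijver $N_+$ procedure applied to the standard relaxation of the symmetric TSP path problem is at least $3/2-o(1)$, even for instances that are shortest-path metrics of unweighted undirected graphs.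
   Context: For an undirected graph $G=(V,E)$ and $S\subseteq V$, $\delta(S)$ is the set of edges with exactly one endpoint in $S$, $\delta(v)=\delta(\{v\})$; for $x\in\mathbb{R}^E$ and $F\subseteq E$, $x(F)=\sum_{e\in F}x_e$, and $d\cdot x=\sum_e d_ex_e$. For distinct $s,t\in V$, the symmetric path polytope $SP(G,s,t)$ is the set of $x\in[0,1]^E$ with: $x(\delta(S))\ge2$ for all $\emptyset\subsetneq S\subsetneq V$ with $|S\cap\{s,t\}|\ne1$; $x(\delta(S))\ge1$ for all $\emptyset\subsetneq S\subsetneq V$ with $|S\cap\{s,t\}|=1$; $x(\delta(v))=2$ for $v\in V\setminus\{s,t\}$; $x(\delta(v))=1$ for $v\in\{s,t\}$. $SP^{\mathrm{int}}(G,s,t)$ is the same with $x\in\{0,1\}^E$ (the Hamiltonian $s$–$t$ paths). Lovász–Schrijver $N_+$ operator: for a convex set $R\subseteq[0,1]^m$, $\mathrm{cone}(R)=\{(\lambda,\lambda x_1,\dots,\lambda x_m):\lambda\ge0,(x_1,\dots,x_m)\in R\}$ (first coordinate indexed $0$). A point $x\in[0,1]^m$ is in $N_+(R)$ iff there is an $(m+1)\times(m+1)$ matrix $X$ (indices $0,\dots,m$, rows $X_i$) that is symmetric and positive semidefinite, with $X_0=\mathrm{diag}(X)=(1,x)$, and with $X_i\in\mathrm{cone}(R)$ and $X_0-X_i\in\mathrm{cone}(R)$ for all $i\in\{1,\dots,m\}$. $N_+^0(R)=R$ and $N_+^{r}(R)=N_+(N_+^{r-1}(R))$. *)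

theory Defs
  imports Complex_Main "HOL-Library.FuncSet"
begin

section \<open>Undirected graphs\<close>

text \<open>A simple undirected graph is a vertex set \<open>V\<close> together with a set of two-element
  subsets of \<open>V\<close>.\<close>

definition complete_edges :: "'a set \<Rightarrow> 'a set set" where
  "complete_edges V = {e. e \<subseteq> V \<and> card e = 2}"

definition is_path :: "'a set \<Rightarrow> 'a set set \<Rightarrow> 'a list \<Rightarrow> bool" where
  "is_path V F p \<longleftrightarrow> p \<noteq> [] \<and> set p \<subseteq> V \<and> distinct p \<and> successively (\<lambda>u v. {u, v} \<in> F) p"

definition graph_connected :: "'a set \<Rightarrow> 'a set set \<Rightarrow> bool" where
  "graph_connected V F \<longleftrightarrow>
     (\<forall>u\<in>V. \<forall>v\<in>V. \<exists>p. is_path V F p \<and> hd p = u \<and> last p = v)"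

text \<open>The distance vector is indexed by unordered pairs: its entry at \<open>{u, v}\<close> is the number
  of edges (one less than the number of vertices) of a shortest path with end points \<open>u\<close>, \<open>v\<close>.\<close>

definition path_metric :: "'a set \<Rightarrow> 'a set set \<Rightarrow> 'a set \<Rightarrow> real" where
  "path_metric V F e =
     real (LEAST k. \<exists>p. is_path V F p \<and> {hd p, last p} = e \<and> length p = Suc k)"

definition edge_cut :: "'a set set \<Rightarrow> 'a set \<Rightarrow> 'a set set" where
  "edge_cut E S = {e \<in> E. card (e \<inter> S) = 1}"


section \<open>The symmetric path polytope\<close>

text \<open>Vectors in \<open>\<real>\<^sup>I\<close> for a finite set \<open>I\<close> are functions that are \<open>undefined\<close> outside \<open>I\<close>.\<close>

definition dot :: "'i set \<Rightarrow> ('i \<Rightarrow> real) \<Rightarrow> ('i \<Rightarrow> real) \<Rightarrow> real" where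
  "dot I d x = (\<Sum>i\<in>I. d i * x i)"

definition SP :: "'a set \<Rightarrow> 'a set set \<Rightarrow> 'a \<Rightarrow> 'a \<Rightarrow> ('a set \<Rightarrow> real) set" where
  "SP V E s t = {x \<in> E \<rightarrow>\<^sub>E {0..1}.
     (\<forall>S. S \<noteq> {} \<and> S \<subset> V \<and> card (S \<inter> {s, t}) \<noteq> 1 \<longrightarrow> sum x (edge_cut E S) \<ge> 2) \<and>
     (\<forall>S. S \<noteq> {} \<and> S \<subset> V \<and> card (S \<inter> {s, t}) = 1 \<longrightarrow> sum x (edge_cut E S) \<ge> 1) \<and>
     (\<forall>v\<in>V - {s, t}. sum x (edge_cut E {v}) = 2) \<and>
     (\<forall>v\<in>{s, t}. sum x (edge_cut E {v}) = 1)}"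

definition SP_int :: "'a set \<Rightarrow> 'a set set \<Rightarrow> 'a \<Rightarrow> 'a \<Rightarrow> ('a set \<Rightarrow> real) set" where
  "SP_int V E s t = SP V E s t \<inter> (E \<rightarrow>\<^sub>E {0, 1})"


section \<open>The Lovasz--Schrijver operator\<close>

text \<open>The homogenizing coordinate \<open>0\<close> is \<open>None\<close>; a coordinate \<open>i \<in> I\<close> becomes \<open>Some i\<close>.
  The entries of matrices and of elements of the cone outside this index set are irrelevant.\<close>

definition hom_index :: "'i set \<Rightarrow> 'i option set" where
  "hom_index I = insert None (Some ` I)"

definition cone_over :: "'i set \<Rightarrow> ('i \<Rightarrow> real) set \<Rightarrow> ('i option \<Rightarrow> real) set" where
  "cone_over I R =
     {y. \<exists>l\<ge>0. \<exists>x\<in>R. y None = l \<and> (\<forall>i\<in>I. y (Some i) = l * x i)}"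

definition symmetric_on :: "'j set \<Rightarrow> ('j \<Rightarrow> 'j \<Rightarrow> real) \<Rightarrow> bool" where
  "symmetric_on J X \<longleftrightarrow> (\<forall>i\<in>J. \<forall>j\<in>J. X i j = X j i)"

definition psd_on :: "'j set \<Rightarrow> ('j \<Rightarrow> 'j \<Rightarrow> real) \<Rightarrow> bool" where
  "psd_on J X \<longleftrightarrow> (\<forall>a. (\<Sum>i\<in>J. \<Sum>j\<in>J. a i * X i j * a j) \<ge> 0)"

definition N_plus :: "'i set \<Rightarrow> ('i \<Rightarrow> real) set \<Rightarrow> ('i \<Rightarrow> real) set" where
  "N_plus I R = {x \<in> I \<rightarrow>\<^sub>E {0..1}. \<exists>X.
     symmetric_on (hom_index I) X \<and> psd_on (hom_index I) X \<and>
     X None None = 1 \<and>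
     (\<forall>i\<in>I. X None (Some i) = x i \<and> X (Some i) (Some i) = x i) \<and>
     (\<forall>i\<in>I. X (Some i) \<in> cone_over I R \<and> (\<lambda>j. X None j - X (Some i) j) \<in> cone_over I R)}"

end

theory Submission
  imports Defs "HOL-Computational_Algebra.Polynomial"
begin

text \<open>The graph consists of two cliques of odd size, one at \<open>s\<close> and one at \<open>t\<close>, joined by two
  long chains. The fractional solution puts the value 1 on the chains and on a matching of all
  but three vertices of each clique, and spreads the remaining degree of the clique vertices
  over the edges between different matched pairs, as if these were joined by a random perfect
  matching. No such perfect matching exists, since each clique has odd size, but there is a
  consistent system of pseudo-expectations. Conditioning on an edge merges two paths of value 1
  into one and yields a solution of the same shape with one matched pair fewer; the moments
  survive as long as the number of pairs exceeds a constant multiple of the number of rounds,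
  because the moment matrix is then close to that of independent edges. All cut and degree
  constraints hold, and the solution costs \<open>n - 1\<close>, as it is supported on edges of the graph.

  A Hamiltonian path, on the other hand, has odd intersection with every cut separating \<open>s\<close> from
  \<open>t\<close> and nonzero even intersection with the others. Applied to cuts through one column and to
  segments of one chain, this makes its routing in the graph use one of the chains at least once
  and the other at least twice per step, up to one exception, which gives the ratio 3/2.\<close>

section \<open>Moments of the pseudo-matching\<close>

text \<open>Two obstacles shape the construction. With \<open>M\<close> paths inside the clique, a
  vertex whose path leaves the clique has \<open>2 * M\<close> admissible edges, but an end of an
  inside path has \<open>2 * M + 1\<close>: its own partner is excluded, yet it may also be joined
  to the three leaving paths. So equal values on all admissible edges cannot give every vertex
  degree 1. Edges between two inside paths must be slightly smaller, and this correction compounds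
  as paths are merged; the weights and the polynomials in them keep account of it. The other
  obstacle is positive semidefiniteness. Two edges with a common vertex have second moment 0 instead
  of the product of their values. About \<open>4 * M\<close> edges meet a given one, so this
  deviation from independence has row sums about \<open>1 / M\<close>, more than the diagonal, about
  \<open>1 / (2 * M)\<close>, and is no small perturbation. But the degree equations put the
  indicator of the star of every vertex into the kernel of the covariance matrix, and on vectors
  orthogonal to all stars the common-vertex part has the favourable sign. Only the remaining
  deviations have to be small.\<close>

text \<open>\<open>moment M\<close> is chosen so that the functional \<open>moment_eval\<close> on polynomials satisfies the
  identities \<open>moment_eval_exterior\<close> and \<open>moment_eval_interior\<close>, which express that an
  unpaired, respectively a paired, vertex of a clique has total fractional degree 1. The quotient
  is only meaningful for \<open>a \<le> M\<close>.\<close>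

definition moment :: "nat \<Rightarrow> nat \<Rightarrow> real" where
  "moment M a = (\<Prod>i<a. (real i + 1/2) / (real M - real i))"

definition moment_eval :: "nat \<Rightarrow> real poly \<Rightarrow> real" where
  "moment_eval M p = (\<Sum>a\<le>M. coeff p a * moment M a)"

lemma moment_eval_add: "moment_eval M (p + q) = moment_eval M p + moment_eval M q"
  by (simp add: moment_eval_def sum.distrib ring_distribs)

lemma moment_eval_diff: "moment_eval M (p - q) = moment_eval M p - moment_eval M q"
  by (simp add: moment_eval_def sum_subtractf ring_distribs)

lemma moment_eval_smult: "moment_eval M (smult c p) = c * moment_eval M p"
  by (simp add: moment_eval_def sum_distrib_left mult.assoc)

lemma moment_eval_0: "moment_eval M 0 = 0"
  by (simp add: moment_eval_def)

lemma moment_eval_sum: "moment_eval M (\<Sum>i\<in>I. f i) = (\<Sum>i\<in>I. moment_eval M (f i))"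
  by (induction I rule: infinite_finite_induct) (auto simp: moment_eval_add moment_eval_0)

lemma moment_Suc: "moment M (Suc a) = moment M a * ((real a + 1/2) / (real M - real a))"
  by (simp add: moment_def)

lemma moment_0 [simp]: "moment M 0 = 1"
  by (simp add: moment_def)

text \<open>The numerators do not depend on \<open>M\<close>, and the two products of denominators
  differ only in their outermost factors, \<open>M + 1\<close> against
  \<open>M + 1 - a\<close>.\<close>

lemma moment_shift:
  assumes "a \<le> M"
  shows "real (Suc M) * moment (Suc M) a = (real (Suc M) - real a) * moment M a"
  using assms
proof (induction a)
  case (Suc a)
  have "real (Suc M) * moment (Suc M) (Suc a)
      = ((real (Suc M) - real a) * moment M a) * ((real a + 1/2) / (real (Suc M) - real a))"
    using Suc by (simp add: moment_Suc mult.assoc[symmetric])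
  also have "\<dots> = moment M a * (real a + 1/2)"
    using Suc.prems by (simp add: field_simps)
  also have "\<dots> = (real (Suc M) - real (Suc a)) * moment M (Suc a)"
    using Suc.prems by (simp add: moment_Suc field_simps)
  finally show ?case .
qed simp

lemma moment_step:
  assumes "a < M"
  shows "(real M - real a) * moment M (Suc a) = (real a + 1/2) * moment M a"
  using assms by (simp add: moment_Suc field_simps)

lemma moment_eval_cong_degree:
  assumes "degree p \<le> N" "N \<le> M"
  shows "moment_eval M p = (\<Sum>a\<le>N. coeff p a * moment M a)"
  unfolding moment_eval_def
proof (rule sum.mono_neutral_right)
  show "\<forall>i\<in>{..M} - {..N}. coeff p i * moment M i = 0"
    using assms by (auto simp: coeff_eq_0)
qed (use assms in auto)

lemma coeff_X_pderiv: "coeff ([:0, 1:] * pderiv p) a = real a * coeff p a"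
  by (cases a) (simp_all add: coeff_pderiv)

text \<open>On the monomial of degree \<open>a\<close> the operator on the right is multiplication
  by \<open>M + 1 - a\<close>, so this is \<open>moment_shift\<close>. If \<open>p\<close> is the
  weight polynomial of \<open>Suc M\<close> paths, the argument on the right is the sum of the
  polynomials with one path left out (\<open>weight_poly_sum_remove\<close>), as a leaving path
  absorbs the inside path it is joined to.\<close>

lemma moment_eval_exterior:
  assumes "degree p \<le> M"
  shows "real (Suc M) * moment_eval (Suc M) p = moment_eval M (smult (real (Suc M)) p - [:0, 1:] * pderiv p)"
proof -
  have "real (Suc M) * moment_eval (Suc M) p = (\<Sum>a\<le>M. coeff p a * (real (Suc M) * moment (Suc M) a))"
    using assms by (simp add: moment_eval_cong_degree[of p M "Suc M"] sum_distrib_left mult_ac)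
  also have "\<dots> = (\<Sum>a\<le>M. coeff (smult (real (Suc M)) p - [:0, 1:] * pderiv p) a * moment M a)"
  proof (rule sum.cong[OF refl])
    fix a assume "a \<in> {..M}"
    then have "a \<le> M" by simp
    show "coeff p a * (real (Suc M) * moment (Suc M) a)
       = coeff (smult (real (Suc M)) p - [:0, 1:] * pderiv p) a * moment M a"
      unfolding moment_shift[OF \<open>a \<le> M\<close>] coeff_diff coeff_smult coeff_X_pderiv
      by (simp add: algebra_simps)
  qed
  finally show ?thesis by (simp add: moment_eval_def)
qed

lemma moment_eval_X:
  assumes "degree p < M"
  shows "moment_eval M ([:0, 1:] * p) = (\<Sum>a<M. coeff p a * moment M (Suc a))"
proof -
  obtain N where N: "M = Suc N" using assms by (cases M) auto
  show ?thesis
    by (simp add: moment_eval_def N sum.atMost_Suc_shift lessThan_Suc_atMost del: sum.atMost_Suc sum.lessThan_Suc)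
qed

text \<open>This identity determines the moments. Here \<open>q\<close> belongs to the other
  \<open>M\<close> inside paths and \<open>y\<close> is the weight of the path ending at the vertex
  considered; in \<open>2 * M + 3\<close> the 3 stands for the edges to the three leaving paths, the
  \<open>2 * M\<close> for those to the other inside paths. With \<open>k\<close> leaving paths,
  comparing coefficients would force the ratio of consecutive moments to be
  \<open>(a + k / 2 - 1) / (M - a)\<close>; the \<open>1 / 2\<close> in \<open>moment\<close> is the
  case \<open>k = 3\<close>.\<close>

lemma moment_eval_interior:
  assumes "degree q < M"
  shows "2 * real (Suc M) * moment_eval (Suc M) ([:1, - y:] * q)
    = moment_eval M (smult (2 * real M + 3) q
        - smult (2 * (y + 1)) ([:0, 1:] * (smult (real M) q - [:0, 1:] * pderiv q)))"
proof -
  let ?r = "smult (real M) q - [:0, 1:] * pderiv q"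
  have cr: "coeff ?r a = (real M - real a) * coeff q a" for a
    unfolding coeff_diff coeff_smult coeff_X_pderiv by (simp add: algebra_simps)
  have dr: "degree ?r < M"
  proof -
    have "degree ?r \<le> degree q"
      by (rule degree_le) (simp only: cr, simp add: coeff_eq_0)
    then show ?thesis using assms by simp
  qed
  have split: "[:1, - y:] * q = q - smult y ([:0, 1:] * q)" by simp
  have q1: "moment_eval (Suc M) q = (\<Sum>a<M. coeff q a * moment (Suc M) a)"
    using assms by (cases M) (simp_all add: moment_eval_cong_degree[of q "M - 1"] lessThan_Suc_atMost)
  have q2: "moment_eval M q = (\<Sum>a<M. coeff q a * moment M a)"
    using assms by (cases M) (simp_all add: moment_eval_cong_degree[of q "M - 1"] lessThan_Suc_atMost)
  have q3: "moment_eval (Suc M) ([:0, 1:] * q) = (\<Sum>a<M. coeff q a * moment (Suc M) (Suc a))"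
    using assms by (subst moment_eval_X) (simp_all add: coeff_eq_0)
  have "2 * real (Suc M) * moment_eval (Suc M) ([:1, - y:] * q)
     = (\<Sum>a<M. coeff q a * (2 * (real (Suc M) * moment (Suc M) a) - 2 * y * (real (Suc M) * moment (Suc M) (Suc a))))"
    unfolding split moment_eval_diff moment_eval_smult q1 q3
    by (simp add: sum_subtractf sum_distrib_left algebra_simps sum.distrib)
  also have "\<dots> = (\<Sum>a<M. coeff q a * ((2 * real M + 3) * moment M a
       - 2 * (y + 1) * ((real M - real a) * moment M (Suc a))))"
  proof (rule sum.cong[OF refl])
    fix a assume "a \<in> {..<M}"
    then have a: "a < M" by simp
    have "real (Suc M) * moment (Suc M) a = (real (Suc M) - real a) * moment M a"
      using a by (intro moment_shift) simp
    moreover have "real (Suc M) * moment (Suc M) (Suc a) = (real a + 1/2) * moment M a"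
      using moment_shift[of "Suc a" M] moment_step[OF a] a by simp
    moreover note moment_step[OF a]
    ultimately show "coeff q a * (2 * (real (Suc M) * moment (Suc M) a) - 2 * y * (real (Suc M) * moment (Suc M) (Suc a)))
      = coeff q a * ((2 * real M + 3) * moment M a - 2 * (y + 1) * ((real M - real a) * moment M (Suc a)))"
      by (simp only:) (simp add: algebra_simps)
  qed
  also have "\<dots> = (2 * real M + 3) * moment_eval M q - 2 * (y + 1) * (\<Sum>a<M. coeff ?r a * moment M (Suc a))"
    unfolding q2 cr by (simp add: sum_subtractf sum_distrib_left algebra_simps sum.distrib)
  also have "\<dots> = (2 * real M + 3) * moment_eval M q - 2 * (y + 1) * moment_eval M ([:0, 1:] * ?r)"
    using moment_eval_X[OF dr] by simp
  finally show ?thesis by (simp only: moment_eval_diff moment_eval_smult)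
qed

section \<open>Weight polynomials\<close>

definition weight_poly :: "('a \<Rightarrow> nat) \<Rightarrow> 'a set \<Rightarrow> real poly" where
  "weight_poly w J = (\<Prod>j\<in>J. [:1, - real (w j):])"

text \<open>Leaving out the factor of \<open>j\<close> adds \<open>w j\<close> times
  \<open>X\<close> times the product of the other factors. Summed over \<open>j\<close>, these
  additions form \<open>- X\<close> times the derivative, by the product rule.\<close>

lemma weight_poly_sum_remove:
  assumes "finite J"
  shows "(\<Sum>j\<in>J. weight_poly w (J - {j})) = smult (real (card J)) (weight_poly w J) - [:0, 1:] * pderiv (weight_poly w J)"
proof -
  have *: "weight_poly w (J - {j}) = weight_poly w J - [:0, 1:] * (weight_poly w (J - {j}) * pderiv [:1, - real (w j):])"
    if "j \<in> J" for j
  proof -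
    have "weight_poly w J = [:1, - real (w j):] * weight_poly w (J - {j})"
      using that assms by (simp add: weight_poly_def prod.remove)
    then show ?thesis by (simp add: pderiv_pCons)
  qed
  have "(\<Sum>j\<in>J. weight_poly w (J - {j}))
     = (\<Sum>j\<in>J. weight_poly w J - [:0, 1:] * (weight_poly w (J - {j}) * pderiv [:1, - real (w j):]))"
    by (rule sum.cong[OF refl]) (rule *)
  also have "\<dots> = smult (real (card J)) (weight_poly w J)
      - [:0, 1:] * (\<Sum>j\<in>J. weight_poly w (J - {j}) * pderiv [:1, - real (w j):])"
    by (simp only: sum_subtractf sum_distrib_left sum_constant of_nat_poly) simp
  also have "(\<Sum>j\<in>J. weight_poly w (J - {j}) * pderiv [:1, - real (w j):]) = pderiv (weight_poly w J)"
    unfolding weight_poly_def by (simp add: pderiv_prod)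
  finally show ?thesis .
qed

lemma weight_poly_degree: "finite J \<Longrightarrow> degree (weight_poly w J) \<le> (\<Sum>j\<in>J. w j)"
proof (induction J rule: finite_induct)
  case (insert x J)
  have "weight_poly w (insert x J) = [:1, - real (w x):] * weight_poly w J"
    using insert by (simp add: weight_poly_def)
  moreover have "degree ([:1, - real (w x):] * weight_poly w J) \<le> degree [:1, - real (w x):] + degree (weight_poly w J)"
    by (rule degree_mult_le)
  moreover have "degree [:1, - real (w x):] \<le> w x" by (cases "w x") auto
  ultimately have "degree (weight_poly w (insert x J)) \<le> w x + (\<Sum>j\<in>J. w j)"
    using insert.IH by simp
  then show ?case using insert by simp
qed (simp add: weight_poly_def)

section \<open>Size of coefficients and moments\<close>

lemma power_add_ge:
  fixes x y :: real assumes "0 \<le> x" "0 \<le> y"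
  shows "x ^ Suc a + real (Suc a) * y * x ^ a \<le> (x + y) ^ Suc a"
proof (induction a)
  case (Suc a)
  have "x ^ Suc (Suc a) + real (Suc (Suc a)) * y * x ^ Suc a
      \<le> (x + y) * (x ^ Suc a + real (Suc a) * y * x ^ a)"
  proof -
    have "(x + y) * (x ^ Suc a + real (Suc a) * y * x ^ a)
       = x ^ Suc (Suc a) + real (Suc (Suc a)) * y * x ^ Suc a + real (Suc a) * (y * y) * x ^ a"
      by (simp add: algebra_simps)
    then show ?thesis using assms by simp
  qed
  also have "\<dots> \<le> (x + y) * (x + y) ^ Suc a"
    using Suc assms by (intro mult_left_mono) auto
  finally show ?case by simp
qed simp

text \<open>Up to sign the coefficients are the elementary symmetric polynomials of the weights, and
  the expansion of the power of the sum contains each squarefree product \<open>a!\<close>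
  times.\<close>

lemma weight_poly_coeff_le:
  "finite J \<Longrightarrow> \<bar>coeff (weight_poly w J) a\<bar> \<le> (\<Sum>j\<in>J. real (w j)) ^ a / fact a"
proof (induction J arbitrary: a rule: finite_induct)
  case empty
  show ?case by (cases a) (auto simp: weight_poly_def)
next
  case (insert x J)
  let ?s = "\<Sum>j\<in>J. real (w j)"
  have s0: "0 \<le> ?s" by (simp add: sum_nonneg)
  have eq: "weight_poly w (insert x J) = weight_poly w J - smult (real (w x)) (pCons 0 (weight_poly w J))"
    using insert by (simp add: weight_poly_def)
  show ?case
  proof (cases a)
    case 0
    then show ?thesis using insert.IH[of 0] eq by simp
  next
    case (Suc b)
    have "\<bar>coeff (weight_poly w (insert x J)) a\<bar>
        \<le> \<bar>coeff (weight_poly w J) (Suc b)\<bar> + real (w x) * \<bar>coeff (weight_poly w J) b\<bar>"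
      unfolding eq Suc using abs_triangle_ineq4[of "coeff (weight_poly w J) (Suc b)" "real (w x) * coeff (weight_poly w J) b"]
      by (simp add: abs_mult)
    also have "\<dots> \<le> ?s ^ Suc b / fact (Suc b) + real (w x) * (?s ^ b / fact b)"
      using insert.IH[of "Suc b"] insert.IH[of b] by (intro add_mono mult_left_mono) auto
    also have "real (w x) * (?s ^ b / fact b) = real (Suc b) * real (w x) * ?s ^ b / fact (Suc b)"
      by (simp del: of_nat_Suc)
    also have "?s ^ Suc b / fact (Suc b) + real (Suc b) * real (w x) * ?s ^ b / fact (Suc b)
        = (?s ^ Suc b + real (Suc b) * real (w x) * ?s ^ b) / fact (Suc b)"
      by (simp only: add_divide_distrib)
    also have "\<dots> \<le> (?s + real (w x)) ^ Suc b / fact (Suc b)"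
      using power_add_ge[OF s0, of "real (w x)" b] by (intro divide_right_mono) auto
    finally show ?thesis using insert Suc by (simp add: add.commute)
  qed
qed

lemma moment_nonneg: "a \<le> M \<Longrightarrow> 0 \<le> moment M a"
  unfolding moment_def by (intro prod_nonneg) auto

lemma moment_le:
  assumes "0 < K" "K \<le> real M + 1 - real a"
  shows "moment M a \<le> fact a / K ^ a"
  using assms
proof (induction a)
  case (Suc a)
  have "moment M (Suc a) = moment M a * ((real a + 1/2) / (real M - real a))" by (rule moment_Suc)
  also have "\<dots> \<le> (fact a / K ^ a) * (real (Suc a) / K)"
    using Suc by (intro mult_mono frac_le Suc.IH divide_nonneg_nonneg) auto
  finally show ?case by (simp add: algebra_simps)
qed simp

lemma geom_le:
  fixes x :: real assumes "0 \<le> x" "x \<le> 1/2"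
  shows "(\<Sum>a\<le>N. x ^ a) \<le> 2"
proof -
  have "(\<Sum>a\<le>N. x ^ a) = (1 - x ^ Suc N) / (1 - x)"
    using assms by (subst sum_gp0) auto
  also have "\<dots> \<le> 1 / (1 - x)" using assms by (intro divide_right_mono) auto
  also have "\<dots> \<le> 2" using assms by (simp add: field_simps)
  finally show ?thesis .
qed

lemma coeff_monom_mult_shift: "coeff (monom 1 b * p) (a + b) = coeff (p::real poly) a"
  by (simp add: coeff_monom_mult)

text \<open>The factorials in the bounds for coefficient and moment combine to \<open>b!\<close>
  times a binomial coefficient, which is at most \<open>2 ^ (a + b)\<close>. What remains is a
  geometric series with ratio \<open>2 * R / K \<le> 1 / 2\<close>.\<close>

lemma moment_eval_monom_weight_poly_le:
  assumes J: "finite J" and R: "(\<Sum>j\<in>J. w j) \<le> R" and K: "real K \<le> real M - real R - real b" "4 * R \<le> K" "0 < K"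
  shows "\<bar>moment_eval M (monom 1 b * weight_poly w J)\<bar> \<le> 2 * fact b * (2 / real K) ^ b"
proof -
  let ?p = "weight_poly w J"
  have RM: "R + b \<le> M" using K by linarith
  have deg: "degree ?p \<le> R" using weight_poly_degree[OF J, of w] R by linarith
  have dm: "degree (monom 1 b * ?p) \<le> R + b"
    using degree_mult_le[of "monom (1::real) b" ?p] degree_monom_le[of "1::real" b] deg by linarith
  have "moment_eval M (monom 1 b * ?p) = (\<Sum>a\<le>R + b. coeff (monom 1 b * ?p) a * moment M a)"
    by (rule moment_eval_cong_degree[OF dm RM])
  also have "\<dots> = (\<Sum>a\<in>{0 + b..R + b}. coeff (monom 1 b * ?p) a * moment M a)"
    by (rule sum.mono_neutral_right) (auto simp: coeff_monom_mult)
  also have "\<dots> = (\<Sum>a=0..R. coeff ?p a * moment M (a + b))"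
    by (subst sum.shift_bounds_cl_nat_ivl) (simp add: coeff_monom_mult_shift)
  finally have eq: "moment_eval M (monom 1 b * ?p) = (\<Sum>a\<le>R. coeff ?p a * moment M (a + b))"
    by (simp add: atMost_atLeast0)
  have term_le: "\<bar>coeff ?p a * moment M (a + b)\<bar> \<le> fact b * (2 / real K) ^ b * (2 * real R / real K) ^ a"
    if a: "a \<le> R" for a
  proof -
    have c: "\<bar>coeff ?p a\<bar> \<le> real R ^ a / fact a"
    proof -
      have "\<bar>coeff ?p a\<bar> \<le> (\<Sum>j\<in>J. real (w j)) ^ a / fact a" by (rule weight_poly_coeff_le[OF J])
      also have "\<dots> \<le> real R ^ a / fact a"
        using R by (intro divide_right_mono power_mono sum_nonneg) (auto simp: of_nat_sum[symmetric] simp del: of_nat_sum)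
      finally show ?thesis .
    qed
    have l: "moment M (a + b) \<le> fact (a + b) / real K ^ (a + b)"
      using K a by (intro moment_le) auto
    have "\<bar>coeff ?p a * moment M (a + b)\<bar> \<le> (real R ^ a / fact a) * (fact (a + b) / real K ^ (a + b))"
      unfolding abs_mult using c l moment_nonneg[of "a + b" M] a RM by (intro mult_mono) auto
    also have "\<dots> = (fact b * real ((a + b) choose b)) * (real R ^ a / real K ^ (a + b))"
    proof -
      have "(fact (a + b) :: real) = fact b * fact a * real ((a + b) choose b)"
        using arg_cong[OF binomial_fact_lemma[of b "a + b"], of real] by simp
      then show ?thesis by simp
    qed
    also have "\<dots> \<le> (fact b * 2 ^ (a + b)) * (real R ^ a / real K ^ (a + b))"
    proof (intro mult_right_mono mult_left_mono)
      have "((a + b) choose b) \<le> 2 ^ (a + b)" by (rule binomial_le_pow2)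
      then have "real ((a + b) choose b) \<le> real (2 ^ (a + b))" by (rule of_nat_mono)
      then show "real ((a + b) choose b) \<le> 2 ^ (a + b)" by simp
    qed auto
    also have "\<dots> = fact b * (2 / real K) ^ b * (2 * real R / real K) ^ a"
      by (simp add: power_add power_divide power_mult_distrib mult_ac)
    finally show ?thesis .
  qed
  have "\<bar>moment_eval M (monom 1 b * ?p)\<bar> \<le> (\<Sum>a\<le>R. fact b * (2 / real K) ^ b * (2 * real R / real K) ^ a)"
    unfolding eq by (rule order_trans[OF sum_abs]) (intro sum_mono term_le, simp)
  also have "\<dots> = fact b * (2 / real K) ^ b * (\<Sum>a\<le>R. (2 * real R / real K) ^ a)"
    by (simp add: sum_distrib_left)
  also have "\<dots> \<le> fact b * (2 / real K) ^ b * 2"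
    using K by (intro mult_left_mono geom_le) (auto simp: field_simps)
  finally show ?thesis by (simp add: mult_ac)
qed

text \<open>The constant coefficient contributes exactly 1, the others a geometric series with ratio
  \<open>R / (M - R) \<le> 1 / 399\<close>. The factor 400 in all later size assumptions comes from
  here.\<close>

lemma moment_eval_weight_poly_near_1:
  assumes J: "finite J" and R: "(\<Sum>j\<in>J. w j) \<le> R" and RM: "400 * R \<le> M"
  shows "\<bar>moment_eval M (weight_poly w J) - 1\<bar> \<le> 1 / 100"
\<comment> \<open>If \<open>R = 0\<close>, then \<open>M\<close> may be 0 as well and the
  denominator \<open>M - R\<close> of the estimate would vanish.\<close>
proof (cases "R = 0")
  case True
  then have "\<forall>j\<in>J. w j = 0" using R J by simp
  then have "weight_poly w J = 1" by (simp add: weight_poly_def one_pCons[symmetric])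
  then show ?thesis by (simp add: moment_eval_def sum.atMost_shift)
next
  case False
  let ?p = "weight_poly w J" and ?K = "real M - real R"
  have K: "399 * real R \<le> ?K" "0 < ?K" using RM False by auto
  have deg: "degree ?p \<le> R" using weight_poly_degree[OF J, of w] R by linarith
  have c0: "coeff ?p 0 = 1"
    using J by (simp add: weight_poly_def poly_0_coeff_0[symmetric] poly_prod)
  have "moment_eval M ?p = (\<Sum>a\<le>R. coeff ?p a * moment M a)"
    by (rule moment_eval_cong_degree[OF deg]) (use RM in simp)
  also have "\<dots> = 1 + (\<Sum>a<R. coeff ?p (Suc a) * moment M (Suc a))"
    by (simp add: sum.atMost_shift c0)
  finally have eq: "moment_eval M ?p - 1 = (\<Sum>a<R. coeff ?p (Suc a) * moment M (Suc a))" by simp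
  have term_le: "\<bar>coeff ?p (Suc a) * moment M (Suc a)\<bar> \<le> (real R / ?K) * (real R / ?K) ^ a" if a: "a < R" for a
  proof -
    have c: "\<bar>coeff ?p (Suc a)\<bar> \<le> real R ^ Suc a / fact (Suc a)"
    proof -
      have "\<bar>coeff ?p (Suc a)\<bar> \<le> (\<Sum>j\<in>J. real (w j)) ^ Suc a / fact (Suc a)" by (rule weight_poly_coeff_le[OF J])
      also have "\<dots> \<le> real R ^ Suc a / fact (Suc a)"
        using R by (intro divide_right_mono power_mono sum_nonneg) (auto simp: of_nat_sum[symmetric] simp del: of_nat_sum)
      finally show ?thesis .
    qed
    have l: "moment M (Suc a) \<le> fact (Suc a) / ?K ^ Suc a"
      using K a by (intro moment_le) auto
    have "\<bar>coeff ?p (Suc a) * moment M (Suc a)\<bar> \<le> (real R ^ Suc a / fact (Suc a)) * (fact (Suc a) / ?K ^ Suc a)"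
      unfolding abs_mult using c l moment_nonneg[of "Suc a" M] a RM by (intro mult_mono) (auto simp del: fact_Suc)
    also have "\<dots> = (real R / ?K) * (real R / ?K) ^ a"
      by (simp add: power_divide del: fact_Suc)
    finally show ?thesis .
  qed
  have q: "real R / ?K \<le> 1 / 399" using K by (simp add: field_simps)
  have "\<bar>moment_eval M ?p - 1\<bar> \<le> (\<Sum>a<R. (real R / ?K) * (real R / ?K) ^ a)"
    unfolding eq by (rule order_trans[OF sum_abs]) (intro sum_mono term_le, simp)
  also have "\<dots> = (real R / ?K) * (\<Sum>a<R. (real R / ?K) ^ a)"
    by (simp add: sum_distrib_left)
  also have "\<dots> \<le> (real R / ?K) * (\<Sum>a\<le>R. (real R / ?K) ^ a)"
    using K by (intro mult_left_mono sum_mono2) auto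
  also have "\<dots> \<le> (real R / ?K) * 2"
    using K q by (intro mult_left_mono geom_le) auto
  also have "\<dots> \<le> 1 / 100" using q by linarith
  finally show ?thesis .
qed

section \<open>Odd gadgets\<close>

text \<open>\<open>A\<close> is the set of the clique vertices still lacking one unit of degree. Each of them is
  an end of a path of value 1 whose other end is \<open>\<rho> a\<close>; it lies outside \<open>A\<close> for the three paths
  that leave the clique. The weight \<open>w a\<close> counts the merges that produced the path at \<open>a\<close>. Each
  path inside the clique is represented in \<open>reps\<close> by its smaller end.\<close>

definition internal_ends :: "nat set \<Rightarrow> (nat \<Rightarrow> nat) \<Rightarrow> nat set" where
  "internal_ends A \<rho> = {a\<in>A. \<rho> a \<in> A}"

definition exterior_ends :: "nat set \<Rightarrow> (nat \<Rightarrow> nat) \<Rightarrow> nat set" where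
  "exterior_ends A \<rho> = {a\<in>A. \<rho> a \<notin> A}"

definition reps :: "nat set \<Rightarrow> (nat \<Rightarrow> nat) \<Rightarrow> nat set" where
  "reps A \<rho> = {a\<in>A. \<rho> a \<in> A \<and> a < \<rho> a}"

text \<open>Plays the role of a partition function: up to the factor
  \<open>2 * card (reps A \<rho>)\<close>, the value of an edge is the quotient of the state values
  after and before the merge along it.\<close>

definition state_value :: "nat set \<Rightarrow> (nat \<Rightarrow> nat) \<Rightarrow> (nat \<Rightarrow> nat) \<Rightarrow> real" where
  "state_value A \<rho> w = moment_eval (card (reps A \<rho>)) (weight_poly w (reps A \<rho>))"

text \<open>The partner is excluded because the edge would close a cycle. An edge between two
  exterior ends is excluded because merging along it would leave a single exterior end instead of
  three.\<close>

definition allowed :: "nat set \<Rightarrow> (nat \<Rightarrow> nat) \<Rightarrow> nat set set" where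
  "allowed A \<rho> = {{a, b} |a b. a \<in> A \<and> b \<in> A \<and> a \<noteq> b \<and> b \<noteq> \<rho> a \<and> (\<rho> a \<in> A \<or> \<rho> b \<in> A)}"

text \<open>The paths at the two ends of \<open>e\<close> become one path, whose ends are the far
  ends of both, inside or outside \<open>A\<close>. \<open>Min\<close> and \<open>Max\<close> merely
  name the two elements of an unordered pair; the result does not depend on their order
  (\<open>merge_partner_pair\<close>).\<close>

definition merge_partner :: "nat set \<Rightarrow> (nat \<Rightarrow> nat) \<Rightarrow> nat \<Rightarrow> nat" where
  "merge_partner e \<rho> = \<rho>(\<rho> (Min e) := \<rho> (Max e), \<rho> (Max e) := \<rho> (Min e))"

text \<open>The \<open>+ 1\<close> is the correction that the new path carries in later merges. The
  weight of a path that leaves \<open>A\<close> no longer matters, since only \<open>reps\<close>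
  enter the weight polynomial.\<close>

definition merge_weight :: "nat set \<Rightarrow> (nat \<Rightarrow> nat) \<Rightarrow> (nat \<Rightarrow> nat) \<Rightarrow> nat \<Rightarrow> nat" where
  "merge_weight e \<rho> w = w(\<rho> (Min e) := w (Min e) + w (Max e) + 1, \<rho> (Max e) := w (Min e) + w (Max e) + 1)"

text \<open>The denominator contains the number of ends of inside paths, which is the number of
  allowed edges at an exterior end.\<close>

definition edge_value :: "nat set \<Rightarrow> (nat \<Rightarrow> nat) \<Rightarrow> (nat \<Rightarrow> nat) \<Rightarrow> nat set \<Rightarrow> real" where
  "edge_value A \<rho> w e = (if e \<in> allowed A \<rho>
     then state_value (A - e) (merge_partner e \<rho>) (merge_weight e \<rho> w) / (2 * real (card (reps A \<rho>)) * state_value A \<rho> w) else 0)"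

text \<open>Of the exterior ends only the number is prescribed, since a merge may replace one of
  them by another vertex.\<close>

locale gadget =
  fixes A :: "nat set" and \<rho> w :: "nat \<Rightarrow> nat"
  assumes finA [simp]: "finite A"
    and rho_rho [simp]: "a \<in> A \<Longrightarrow> \<rho> (\<rho> a) = a"
    and rho_ne [simp]: "a \<in> A \<Longrightarrow> \<rho> a \<noteq> a"
    and card_ext: "card (exterior_ends A \<rho>) = 3"
    and w_rho: "a \<in> A \<Longrightarrow> \<rho> a \<in> A \<Longrightarrow> w (\<rho> a) = w a"

lemma sum_smult: "(\<Sum>k\<in>J. smult c (f k)) = smult c (\<Sum>k\<in>J. f k)"
  by (induction J rule: infinite_finite_induct) (auto simp: smult_add_right)

lemma Min_Max_pair:
  fixes a b :: nat assumes "a \<noteq> b"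
  shows "(Min {a, b} = a \<and> Max {a, b} = b) \<or> (Min {a, b} = b \<and> Max {a, b} = a)"
  using assms by (auto simp: min_def max_def)

lemma merge_partner_pair:
  assumes "a \<noteq> b" "\<rho> a \<noteq> \<rho> b"
  shows "merge_partner {a, b} \<rho> = \<rho>(\<rho> a := \<rho> b, \<rho> b := \<rho> a)"
  using Min_Max_pair[OF assms(1)] fun_upd_twist[OF assms(2), of \<rho> "\<rho> b" "\<rho> a"]
  unfolding merge_partner_def by auto

lemma merge_weight_pair:
  assumes "a \<noteq> b" "\<rho> a \<noteq> \<rho> b"
  shows "merge_weight {a, b} \<rho> w = w(\<rho> a := w a + w b + 1, \<rho> b := w a + w b + 1)"
  using Min_Max_pair[OF assms(1)] fun_upd_twist[OF assms(2), of w "w a + w b + 1" "w a + w b + 1"]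
  unfolding merge_weight_def by (auto simp: add.commute)

context gadget
begin

lemma rho_inj: "a \<in> A \<Longrightarrow> b \<in> A \<Longrightarrow> \<rho> a = \<rho> b \<longleftrightarrow> a = b"
  by (metis rho_rho)

lemma rho_flip: "a \<in> A \<Longrightarrow> b \<in> A \<Longrightarrow> b = \<rho> a \<longleftrightarrow> a = \<rho> b"
  by (metis rho_rho)

lemma pair_allowed:
  assumes "a \<in> A" "b \<in> A"
  shows "{a, b} \<in> allowed A \<rho> \<longleftrightarrow> a \<noteq> b \<and> b \<noteq> \<rho> a \<and> (\<rho> a \<in> A \<or> \<rho> b \<in> A)"
  using assms rho_flip unfolding allowed_def by (auto simp: doubleton_eq_iff)

text \<open>In particular \<open>card A\<close> is odd, which decides the case of a cut that splits
  neither clique.\<close>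

lemma card_A: "card A = 2 * card (reps A \<rho>) + 3"
proof -
  have *: "A = exterior_ends A \<rho> \<union> (reps A \<rho> \<union> \<rho> ` reps A \<rho>)"
  proof (intro set_eqI iffI)
    fix a assume "a \<in> A"
    then consider "\<rho> a \<notin> A" | "\<rho> a \<in> A" "a < \<rho> a" | "\<rho> a \<in> A" "\<rho> a < a"
      using rho_ne[of a] by (metis linorder_neqE_nat)
    then show "a \<in> exterior_ends A \<rho> \<union> (reps A \<rho> \<union> \<rho> ` reps A \<rho>)"
    proof cases
      case 3
      then have "\<rho> a \<in> reps A \<rho>" "a = \<rho> (\<rho> a)" using \<open>a \<in> A\<close> by (auto simp: reps_def)
      then show ?thesis by blast
    qed (use \<open>a \<in> A\<close> in \<open>auto simp: exterior_ends_def reps_def\<close>)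
  qed (auto simp: exterior_ends_def reps_def)
  have inj: "inj_on \<rho> (reps A \<rho>)" by (auto simp: inj_on_def reps_def rho_inj)
  have d1: "reps A \<rho> \<inter> \<rho> ` reps A \<rho> = {}" by (auto simp: reps_def)
  have d2: "exterior_ends A \<rho> \<inter> (reps A \<rho> \<union> \<rho> ` reps A \<rho>) = {}" by (auto simp: reps_def exterior_ends_def)
  have fin: "finite (reps A \<rho>)" "finite (exterior_ends A \<rho>)" by (auto simp: reps_def exterior_ends_def)
  have "card A = card (exterior_ends A \<rho>) + card (reps A \<rho> \<union> \<rho> ` reps A \<rho>)"
    by (subst *) (rule card_Un_disjoint, use fin d2 in auto)
  also have "card (reps A \<rho> \<union> \<rho> ` reps A \<rho>) = card (reps A \<rho>) + card (\<rho> ` reps A \<rho>)"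
    by (rule card_Un_disjoint) (use fin d1 in auto)
  finally show ?thesis using card_ext inj by (simp add: card_image)
qed

lemma sum_internal_ends: "(\<Sum>a\<in>internal_ends A \<rho>. f a) = (\<Sum>a\<in>reps A \<rho>. f a + f (\<rho> a))" for f :: "nat \<Rightarrow> real"
proof -
  have *: "internal_ends A \<rho> = reps A \<rho> \<union> \<rho> ` reps A \<rho>"
  proof (intro set_eqI iffI)
    fix a assume a: "a \<in> internal_ends A \<rho>"
    then consider "a < \<rho> a" | "\<rho> a < a"
      using rho_ne[of a] by (metis (no_types, lifting) internal_ends_def linorder_neqE_nat mem_Collect_eq)
    then show "a \<in> reps A \<rho> \<union> \<rho> ` reps A \<rho>"
    proof cases
      case 2
      then have "\<rho> a \<in> reps A \<rho>" "a = \<rho> (\<rho> a)" using a by (auto simp: internal_ends_def reps_def)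
      then show ?thesis by blast
    qed (use a in \<open>auto simp: internal_ends_def reps_def\<close>)
  qed (auto simp: internal_ends_def reps_def)
  have inj: "inj_on \<rho> (reps A \<rho>)" by (auto simp: inj_on_def reps_def rho_inj)
  have d1: "reps A \<rho> \<inter> \<rho> ` reps A \<rho> = {}" by (auto simp: reps_def)
  have fin: "finite (reps A \<rho>)" by (auto simp: reps_def)
  show ?thesis
    by (subst *, subst sum.union_disjoint) (use fin d1 inj in \<open>auto simp: sum.reindex sum.distrib\<close>)
qed

text \<open>An allowed pair can always be ordered so that its second vertex is an end of an inside
  path; only \<open>a\<close> may be exterior.\<close>

context
  fixes a b assumes ab: "a \<in> A" "b \<in> A" "a \<noteq> b" "b \<noteq> \<rho> a" "\<rho> b \<in> A"
begin

lemma rho_ab: "\<rho> a \<noteq> \<rho> b" using ab rho_inj by auto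

lemma rho_b_ne: "\<rho> b \<noteq> a" "\<rho> b \<noteq> b" "\<rho> a \<noteq> a" "\<rho> a \<noteq> b" using ab rho_flip by auto

lemmas merge_partner_ab = merge_partner_pair[OF ab(3) rho_ab] and merge_weight_ab = merge_weight_pair[where w = w, OF ab(3) rho_ab]

lemma merge_partner_at: "merge_partner {a, b} \<rho> (\<rho> a) = \<rho> b" "merge_partner {a, b} \<rho> (\<rho> b) = \<rho> a"
  "c \<noteq> \<rho> a \<Longrightarrow> c \<noteq> \<rho> b \<Longrightarrow> merge_partner {a, b} \<rho> c = \<rho> c"
  using rho_ab by (simp_all add: merge_partner_ab)

text \<open>If both paths are inside, the exterior ends are unchanged. If \<open>a\<close> is
  exterior, its path absorbs the one at \<open>b\<close>, and \<open>\<rho> b\<close> replaces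
  \<open>a\<close> as an exterior end. Three remain in both cases.\<close>

lemma merged_gadget: "gadget (A - {a, b}) (merge_partner {a, b} \<rho>) (merge_weight {a, b} \<rho> w)"
proof -
  have inv: "merge_partner {a, b} \<rho> (merge_partner {a, b} \<rho> c) = c \<and> merge_partner {a, b} \<rho> c \<noteq> c" if c: "c \<in> A - {a, b}" for c
  proof -
    consider "c = \<rho> a" | "c = \<rho> b" | "c \<noteq> \<rho> a" "c \<noteq> \<rho> b" by blast
    then show ?thesis
    proof cases
      case 3
      then have "\<rho> c \<noteq> \<rho> a" "\<rho> c \<noteq> \<rho> b" using c ab rho_inj by auto
      then show ?thesis using 3 c by (simp add: merge_partner_at)
    qed (use rho_ab in \<open>simp_all add: merge_partner_at\<close>)
  qed
  have inn': "merge_partner {a, b} \<rho> c \<in> A - {a, b} \<longleftrightarrow> (if c = \<rho> b then \<rho> a \<in> A else \<rho> c \<in> A \<or> c = \<rho> a)"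
    if c: "c \<in> A - {a, b}" for c
  proof -
    consider "c = \<rho> a" | "c = \<rho> b" | "c \<noteq> \<rho> a" "c \<noteq> \<rho> b" by blast
    then show ?thesis
    proof cases
      case 3
      then have "\<rho> c \<noteq> a" "\<rho> c \<noteq> b" using c by auto
      then show ?thesis using 3 by (simp add: merge_partner_at)
    qed (use ab rho_ab rho_b_ne in \<open>simp_all add: merge_partner_at\<close>)
  qed
  have ext': "exterior_ends (A - {a, b}) (merge_partner {a, b} \<rho>) = (if \<rho> a \<in> A then exterior_ends A \<rho> else insert (\<rho> b) (exterior_ends A \<rho> - {a}))"
  proof -
    have "exterior_ends (A - {a, b}) (merge_partner {a, b} \<rho>) = {c \<in> A - {a, b}. \<not> (if c = \<rho> b then \<rho> a \<in> A else \<rho> c \<in> A \<or> c = \<rho> a)}"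
      unfolding exterior_ends_def using inn' by blast
    also have "\<dots> = (if \<rho> a \<in> A then exterior_ends A \<rho> else insert (\<rho> b) (exterior_ends A \<rho> - {a}))"
      using ab rho_ab rho_b_ne rho_rho by (auto simp: exterior_ends_def)
    finally show ?thesis .
  qed
  have e3: "card (exterior_ends A \<rho>) = 3" "finite (exterior_ends A \<rho>)" using card_ext by (auto simp: exterior_ends_def)
  have card': "card (exterior_ends (A - {a, b}) (merge_partner {a, b} \<rho>)) = 3"
  proof (cases "\<rho> a \<in> A")
    case False
    then have "a \<in> exterior_ends A \<rho>" "\<rho> b \<notin> exterior_ends A \<rho>" using ab by (auto simp: exterior_ends_def)
    then show ?thesis unfolding ext' using False e3 by simp
  qed (simp add: ext' e3)
  have wt: "merge_weight {a, b} \<rho> w (merge_partner {a, b} \<rho> c) = merge_weight {a, b} \<rho> w c"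
    if c: "c \<in> A - {a, b}" "merge_partner {a, b} \<rho> c \<in> A - {a, b}" for c
  proof (cases "c = \<rho> a \<or> c = \<rho> b")
    case True
    then show ?thesis using rho_ab by (auto simp: merge_partner_at merge_weight_ab)
  next
    case False
    have c3: "\<rho> c \<noteq> \<rho> a" "\<rho> c \<noteq> \<rho> b" using c ab rho_inj by auto
    have "\<rho> c \<in> A" using inn'[OF c(1)] c(2) False by simp
    then show ?thesis using False c c3 w_rho[of c] by (simp add: merge_partner_at merge_weight_ab)
  qed
  show ?thesis
    by unfold_locales (use inv card' wt in auto)
qed

lemma reps_merged:
  defines "J \<equiv> reps A \<rho> - {a, b, \<rho> a, \<rho> b}" and "r \<equiv> (if \<rho> a < \<rho> b then \<rho> a else \<rho> b)"
  shows "reps (A - {a, b}) (merge_partner {a, b} \<rho>) = (if \<rho> a \<in> A then insert r J else J)"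
proof (intro set_eqI)
  fix c
  show "c \<in> reps (A - {a, b}) (merge_partner {a, b} \<rho>) \<longleftrightarrow> c \<in> (if \<rho> a \<in> A then insert r J else J)"
  proof (cases "c = \<rho> a \<or> c = \<rho> b")
    case True
    then show ?thesis
    proof
      assume c: "c = \<rho> a"
      then have "merge_partner {a, b} \<rho> c = \<rho> b" by (simp add: merge_partner_at)
      then show ?thesis using ab rho_ab rho_b_ne unfolding c by (simp add: reps_def J_def r_def)
    next
      assume c: "c = \<rho> b"
      then have "merge_partner {a, b} \<rho> c = \<rho> a" by (simp add: merge_partner_at)
      then show ?thesis using ab rho_ab rho_b_ne unfolding c by (simp add: reps_def J_def r_def)
    qed
  next
    case False
    then have m: "merge_partner {a, b} \<rho> c = \<rho> c" by (simp add: merge_partner_at)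
    have "\<rho> c \<noteq> a \<and> \<rho> c \<noteq> b" if "c \<in> A" using False that by auto
    then show ?thesis using False m by (auto simp: reps_def J_def r_def)
  qed
qed

text \<open>The set \<open>T\<close> takes away further paths untouched by the merge; it is used
  when the effects of two merges are compared in \<open>merged_poly_far\<close>.\<close>

lemma weight_poly_merged:
  assumes T: "T \<inter> {a, b, \<rho> a, \<rho> b} = {}"
  shows "weight_poly (merge_weight {a, b} \<rho> w) (reps (A - {a, b}) (merge_partner {a, b} \<rho>) - T)
      = (if \<rho> a \<in> A then [:1, - real (w a + w b + 1):] else 1) * weight_poly w (reps A \<rho> - T - {a, b, \<rho> a, \<rho> b})"
proof -
  define r where "r = (if \<rho> a < \<rho> b then \<rho> a else \<rho> b)"
  define J where "J = reps A \<rho> - {a, b, \<rho> a, \<rho> b} - T"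
  have key: "reps (A - {a, b}) (merge_partner {a, b} \<rho>) - T = (if \<rho> a \<in> A then insert r J else J)"
  proof -
    have "insert r (reps A \<rho> - {a, b, \<rho> a, \<rho> b}) - T = insert r J" using T by (auto simp: r_def J_def)
    then show ?thesis unfolding reps_merged J_def r_def by simp
  qed
  have rJ: "r \<notin> J" by (auto simp: J_def r_def)
  have wr: "merge_weight {a, b} \<rho> w r = w a + w b + 1" by (auto simp: r_def merge_weight_ab)
  have "merge_weight {a, b} \<rho> w j = w j" if "j \<in> J" for j
    using that by (auto simp: J_def merge_weight_ab)
  then have wJ: "weight_poly (merge_weight {a, b} \<rho> w) J = weight_poly w J"
    unfolding weight_poly_def by (intro prod.cong) auto
  have fJ: "finite J" by (simp add: J_def reps_def)
  have Jeq: "reps A \<rho> - T - {a, b, \<rho> a, \<rho> b} = J" by (auto simp: J_def)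
  show ?thesis
  proof (cases "\<rho> a \<in> A")
    case True
    then have "weight_poly (merge_weight {a, b} \<rho> w) (reps (A - {a, b}) (merge_partner {a, b} \<rho>) - T)
       = [:1, - real (merge_weight {a, b} \<rho> w r):] * weight_poly (merge_weight {a, b} \<rho> w) J"
      unfolding key using rJ fJ by (simp add: weight_poly_def)
    then show ?thesis using True by (simp only: wr wJ if_True Jeq)
  qed (simp add: key wJ Jeq)
qed

lemma card_reps_merged: "Suc (card (reps (A - {a, b}) (merge_partner {a, b} \<rho>))) = card (reps A \<rho>)"
proof -
  interpret m: gadget "A - {a, b}" "merge_partner {a, b} \<rho>" "merge_weight {a, b} \<rho> w" by (rule merged_gadget)
  have "card A = card (A - {a, b}) + 2"
  proof -
    have "card {a, b} = 2" using ab by simp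
    moreover have "card {a, b} \<le> card A" using ab by (intro card_mono) auto
    ultimately show ?thesis using ab by (simp add: card_Diff_subset)
  qed
  then show ?thesis using card_A m.card_A by linarith
qed

end

lemma allowE:
  assumes "e \<in> allowed A \<rho>"
  obtains a b where "e = {a, b}" "a \<in> A" "b \<in> A" "a \<noteq> b" "b \<noteq> \<rho> a" "\<rho> b \<in> A"
proof -
  from assms obtain a b where *: "e = {a, b}" "a \<in> A" "b \<in> A" "a \<noteq> b" "b \<noteq> \<rho> a" "\<rho> a \<in> A \<or> \<rho> b \<in> A"
    unfolding allowed_def by blast
  show ?thesis
  proof (cases "\<rho> b \<in> A")
    case True
    then show ?thesis using that * by blast
  next
    case False
    then have "e = {b, a}" "b \<noteq> a" "a \<noteq> \<rho> b" "\<rho> a \<in> A" using * rho_flip by auto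
    then show ?thesis using that * by blast
  qed
qed

lemma allowed_sub: "e \<in> allowed A \<rho> \<Longrightarrow> e \<subseteq> A"
  by (elim allowE) auto

lemma allowed_card: "e \<in> allowed A \<rho> \<Longrightarrow> card e = 2"
  by (elim allowE) auto

lemma finite_allowed [simp]: "finite (allowed A \<rho>)"
  by (rule finite_subset[of _ "Pow A"]) (auto dest: allowed_sub)

lemma allowed_merged_gadget:
  "e \<in> allowed A \<rho> \<Longrightarrow> gadget (A - e) (merge_partner e \<rho>) (merge_weight e \<rho> w)"
  by (erule allowE) (simp add: merged_gadget)

lemma finite_reps [simp]: "finite (reps A \<rho>)" by (simp add: reps_def)

lemma rep_cases:
  assumes "a \<in> A" "\<rho> a \<in> A"
  obtains r where "r \<in> reps A \<rho>" "r = a \<or> r = \<rho> a" "reps A \<rho> \<inter> {a, \<rho> a} = {r}" "w r = w a"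
proof (cases "a < \<rho> a")
  case True
  then show ?thesis using that[of a] assms by (auto simp: reps_def)
next
  case False
  then have "\<rho> a < a" using rho_ne[OF assms(1)] by linarith
  then show ?thesis using that[of "\<rho> a"] assms w_rho by (auto simp: reps_def)
qed

lemma reps_split:
  assumes ab: "a \<in> A" "b \<in> A" "a \<noteq> b" "b \<noteq> \<rho> a" "\<rho> b \<in> A" and T: "T \<inter> {a, b, \<rho> a, \<rho> b} = {}"
  defines "J \<equiv> reps A \<rho> - T - {a, b, \<rho> a, \<rho> b}"
  shows "weight_poly w (reps A \<rho> - T) = (if \<rho> a \<in> A then [:1, - real (w a):] * [:1, - real (w b):]
             else [:1, - real (w b):]) * weight_poly w J \<and>
    (\<Sum>j\<in>reps A \<rho> - T. w j) = (if \<rho> a \<in> A then w a + w b else w b) + (\<Sum>j\<in>J. w j)"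
proof -
  obtain rb where rb: "rb \<in> reps A \<rho>" "rb = b \<or> rb = \<rho> b" "reps A \<rho> \<inter> {b, \<rho> b} = {rb}" "w rb = w b"
    using rep_cases[of b] ab by blast
  have fJ: "finite J" by (simp add: J_def)
  show ?thesis
  proof (cases "\<rho> a \<in> A")
    case True
    obtain ra where ra: "ra \<in> reps A \<rho>" "ra = a \<or> ra = \<rho> a" "reps A \<rho> \<inter> {a, \<rho> a} = {ra}" "w ra = w a"
      using rep_cases[of a] ab True by blast
    have ne: "ra \<noteq> rb" using ra(2) rb(2) ab rho_flip rho_inj by auto
    have "reps A \<rho> - T = (reps A \<rho> \<inter> {a, \<rho> a}) \<union> (reps A \<rho> \<inter> {b, \<rho> b}) \<union> J"
      using T unfolding J_def by fast
    then have eq: "reps A \<rho> - T = insert ra (insert rb J)" unfolding ra(3) rb(3) by (simp add: insert_commute)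
    have "ra \<notin> insert rb J" "rb \<notin> J" using ne ra(2) rb(2) by (auto simp: J_def)
    then have "weight_poly w (insert ra (insert rb J)) = [:1, - real (w ra):] * ([:1, - real (w rb):] * weight_poly w J)"
      "(\<Sum>j\<in>insert ra (insert rb J). w j) = w ra + (w rb + (\<Sum>j\<in>J. w j))"
      using fJ by (simp_all add: weight_poly_def)
    then show ?thesis unfolding eq using True ra(4) rb(4) by (simp only: if_True mult.assoc add.assoc)
  next
    case False
    then have ra: "reps A \<rho> \<inter> {a, \<rho> a} = {}" by (auto simp: reps_def)
    have "reps A \<rho> - T = (reps A \<rho> \<inter> {a, \<rho> a}) \<union> (reps A \<rho> \<inter> {b, \<rho> b}) \<union> J"
      using T unfolding J_def by fast
    then have eq: "reps A \<rho> - T = insert rb J" unfolding ra rb(3) by simp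
    have "rb \<notin> J" using rb(2) by (auto simp: J_def)
    then have "weight_poly w (insert rb J) = [:1, - real (w rb):] * weight_poly w J"
      "(\<Sum>j\<in>insert rb J. w j) = w rb + (\<Sum>j\<in>J. w j)"
      using fJ by (simp_all add: weight_poly_def)
    then show ?thesis unfolding eq using False rb(4) by (simp only: if_False)
  qed
qed

lemma merged_weight_le:
  assumes ab: "a \<in> A" "b \<in> A" "a \<noteq> b" "b \<noteq> \<rho> a" "\<rho> b \<in> A"
  shows "(\<Sum>j\<in>reps (A - {a, b}) (merge_partner {a, b} \<rho>). merge_weight {a, b} \<rho> w j) \<le> (\<Sum>j\<in>reps A \<rho>. w j) + 1"
proof -
  define J where "J = reps A \<rho> - {a, b, \<rho> a, \<rho> b}"
  define K where "K = reps (A - {a, b}) (merge_partner {a, b} \<rho>)"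
  note [simp] = merge_partner_at[OF ab]
  have fJ: "finite J" by (simp add: J_def)
  have m: "merge_weight {a, b} \<rho> w j = w j" if "j \<in> J" for j
    using that by (auto simp: J_def merge_weight_ab[OF ab])
  have KJ: "K - {\<rho> a, \<rho> b} \<subseteq> J"
  proof
    fix c assume c: "c \<in> K - {\<rho> a, \<rho> b}"
    then show "c \<in> J" by (auto simp: K_def J_def reps_def)
  qed
  have K1: "K \<inter> {\<rho> a, \<rho> b} = {} \<or> (\<exists>r. K \<inter> {\<rho> a, \<rho> b} = {r} \<and> r \<in> {\<rho> a, \<rho> b} \<and> \<rho> a \<in> A)"
    using rho_ab[OF ab] by (auto simp: K_def reps_def)
  have fK: "finite K" by (simp add: K_def reps_def)
  have "(\<Sum>j\<in>K. merge_weight {a, b} \<rho> w j) = (\<Sum>j\<in>K \<inter> {\<rho> a, \<rho> b}. merge_weight {a, b} \<rho> w j) + (\<Sum>j\<in>K - {\<rho> a, \<rho> b}. merge_weight {a, b} \<rho> w j)"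
    using fK by (metis sum.Int_Diff)
  also have "(\<Sum>j\<in>K - {\<rho> a, \<rho> b}. merge_weight {a, b} \<rho> w j) \<le> (\<Sum>j\<in>J. w j)"
    using sum_mono2[OF fJ KJ, of "merge_weight {a, b} \<rho> w"] m by simp
  also have "(\<Sum>j\<in>K \<inter> {\<rho> a, \<rho> b}. merge_weight {a, b} \<rho> w j) \<le> (if \<rho> a \<in> A then w a + w b + 1 else 0)"
    using K1
  proof (elim disjE exE conjE)
    fix r assume "K \<inter> {\<rho> a, \<rho> b} = {r}" "r \<in> {\<rho> a, \<rho> b}" "\<rho> a \<in> A"
    then show ?thesis by (auto simp: merge_weight_ab[OF ab] simp del: Int_insert_right)
  qed simp
  finally show ?thesis
    using reps_split[OF ab, of "{}"] unfolding K_def J_def by (auto split: if_splits)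
qed

lemma edge_value_pair:
  assumes ab: "a \<in> A" "b \<in> A" "a \<noteq> b" "b \<noteq> \<rho> a" "\<rho> b \<in> A"
  shows "edge_value A \<rho> w {a, b} = moment_eval (card (reps A \<rho>) - 1) ((if \<rho> a \<in> A then [:1, - real (w a + w b + 1):] else 1)
        * weight_poly w (reps A \<rho> - {a, b, \<rho> a, \<rho> b})) / (2 * real (card (reps A \<rho>)) * state_value A \<rho> w)"
proof -
  have "{a, b} \<in> allowed A \<rho>" using ab by (simp add: pair_allowed)
  moreover have "card (reps (A - {a, b}) (merge_partner {a, b} \<rho>)) = card (reps A \<rho>) - 1"
    using card_reps_merged[OF ab] by linarith
  ultimately show ?thesis
    using weight_poly_merged[OF ab, of "{}"] by (simp only: edge_value_def state_value_def if_True Diff_empty Int_empty_left)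
qed

lemma edge_value_nonallow: "e \<notin> allowed A \<rho> \<Longrightarrow> edge_value A \<rho> w e = 0"
  by (simp add: edge_value_def)

section \<open>Degree equations\<close>

definition star :: "nat \<Rightarrow> nat set set" where
  "star a = {e \<in> allowed A \<rho>. a \<in> e}"

lemma sum_star:
  fixes f :: "nat set \<Rightarrow> real"
  assumes a: "a \<in> A"
  shows "(\<Sum>e\<in>star a. f e) = (\<Sum>b | b \<in> A \<and> {a, b} \<in> allowed A \<rho>. f {a, b})"
proof -
  have "star a = (\<lambda>b. {a, b}) ` {b. b \<in> A \<and> {a, b} \<in> allowed A \<rho>}"
  proof (intro set_eqI iffI)
    fix e assume e: "e \<in> star a"
    then obtain c d where cd: "e = {c, d}" "c \<in> A" "d \<in> A" by (auto simp: star_def elim: allowE)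
    from e have "a = c \<or> a = d" using cd by (auto simp: star_def)
    then show "e \<in> (\<lambda>b. {a, b}) ` {b. b \<in> A \<and> {a, b} \<in> allowed A \<rho>}"
      using cd e by (auto simp: star_def insert_commute)
  qed (auto simp: star_def)
  moreover have "inj_on (\<lambda>b. {a, b}) {b. b \<in> A \<and> {a, b} \<in> allowed A \<rho>}"
    by (auto simp: inj_on_def doubleton_eq_iff)
  ultimately show ?thesis by (simp add: sum.reindex)
qed

text \<open>Both ends of an inside path give the same polynomial after a merge, which accounts for
  the factors 2. At an exterior vertex the sum is evaluated by \<open>moment_eval_exterior\<close>,
  at an internal one the three exterior neighbours and the inside paths together by
  \<open>moment_eval_interior\<close>. The \<open>+ 2\<close> in the hypothesis yields degree below
  \<open>card (reps A \<rho>) - 1\<close>, where the identities hold.\<close>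

lemma edge_value_star:
  assumes a: "a \<in> A"
    and deg: "(\<Sum>j\<in>reps A \<rho>. w j) + 2 \<le> card (reps A \<rho>)"
    and pos: "state_value A \<rho> w \<noteq> 0"
  shows "(\<Sum>e\<in>star a. edge_value A \<rho> w e) = 1"
proof -
  let ?P = "reps A \<rho>"
  obtain M where M: "card ?P = Suc M" using deg by (cases "card ?P") auto
  have fin: "finite ?P" by simp
  define D where "D = 2 * real (Suc M) * state_value A \<rho> w"
  have D0: "D \<noteq> 0" using pos by (simp add: D_def)
  have deg': "degree (weight_poly w J) < M" if "J \<subseteq> ?P" for J
  proof -
    have "degree (weight_poly w J) \<le> (\<Sum>j\<in>J. w j)" using that fin by (intro weight_poly_degree) (auto dest: finite_subset)
    also have "\<dots> \<le> (\<Sum>j\<in>?P. w j)" using that fin by (intro sum_mono2) auto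
    finally show ?thesis using deg M by simp
  qed
  show ?thesis
  proof (cases "\<rho> a \<in> A")
    case False
    have part: "{b. b \<in> A \<and> {a, b} \<in> allowed A \<rho>} = internal_ends A \<rho>"
      using a False rho_flip by (auto simp: pair_allowed internal_ends_def)
    have fr: "edge_value A \<rho> w {a, b} = moment_eval M (weight_poly w (?P - {b, \<rho> b})) / D" if b: "b \<in> internal_ends A \<rho>" for b
    proof -
      have b': "b \<in> A" "\<rho> b \<in> A" "a \<noteq> b" "b \<noteq> \<rho> a" using b a False by (auto simp: internal_ends_def)
      have "?P - {a, b, \<rho> a, \<rho> b} = ?P - {b, \<rho> b}" using False by (auto simp: reps_def)
      then show ?thesis using edge_value_pair[OF a b'(1,3,4,2)] False M by (simp add: D_def)
    qed
    have "(\<Sum>e\<in>star a. edge_value A \<rho> w e) = (\<Sum>b\<in>internal_ends A \<rho>. moment_eval M (weight_poly w (?P - {b, \<rho> b})) / D)"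
      unfolding sum_star[OF a] part by (rule sum.cong) (auto simp: fr)
    also have "\<dots> = (\<Sum>b\<in>?P. 2 * moment_eval M (weight_poly w (?P - {b})) / D)"
      unfolding sum_internal_ends
    proof (rule sum.cong[OF refl])
      fix b assume b: "b \<in> ?P"
      then have "?P - {b, \<rho> b} = ?P - {b}" "?P - {\<rho> b, \<rho> (\<rho> b)} = ?P - {b}" by (auto simp: reps_def)
      then show "moment_eval M (weight_poly w (?P - {b, \<rho> b})) / D + moment_eval M (weight_poly w (?P - {\<rho> b, \<rho> (\<rho> b)})) / D
        = 2 * moment_eval M (weight_poly w (?P - {b})) / D" by simp
    qed
    also have "\<dots> = 2 * moment_eval M (\<Sum>b\<in>?P. weight_poly w (?P - {b})) / D"
      by (simp add: moment_eval_sum sum_distrib_left sum_divide_distrib)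
    also have "\<dots> = 2 * (real (Suc M) * moment_eval (Suc M) (weight_poly w ?P)) / D"
      using moment_eval_exterior[of "weight_poly w ?P" M] deg'[of ?P] weight_poly_sum_remove[OF fin, of w] M by simp
    also have "\<dots> = 1" using D0 by (simp add: D_def state_value_def M)
    finally show ?thesis .
  next
    case True
    obtain r where r: "r \<in> ?P" "r = a \<or> r = \<rho> a" "?P \<inter> {a, \<rho> a} = {r}" "w r = w a"
      using rep_cases[OF a True] by blast
    define J where "J = ?P - {r}"
    have Ja: "J = ?P - {a, \<rho> a}" using r(3) unfolding J_def by blast
    have fJ: "finite J" and cJ: "card J = M" using r(1) M by (auto simp: J_def)
    let ?q = "weight_poly w J" and ?y = "real (w a)"
    have part: "{b. b \<in> A \<and> {a, b} \<in> allowed A \<rho>} = exterior_ends A \<rho> \<union> (internal_ends A \<rho> - {a, \<rho> a})"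
      using a True allowed_card[of "{a}"] by (auto simp: pair_allowed internal_ends_def exterior_ends_def)
    have disj: "exterior_ends A \<rho> \<inter> (internal_ends A \<rho> - {a, \<rho> a}) = {}" by (auto simp: internal_ends_def exterior_ends_def)
    have fins: "finite (exterior_ends A \<rho>)" "finite (internal_ends A \<rho>)" by (auto simp: internal_ends_def exterior_ends_def)
    have fr1: "edge_value A \<rho> w {a, b} = moment_eval M ?q / D" if b: "b \<in> exterior_ends A \<rho>" for b
    proof -
      have b': "b \<in> A" "\<rho> b \<notin> A" "b \<noteq> a" "a \<noteq> \<rho> b" using b a True by (auto simp: exterior_ends_def)
      have "?P - {b, a, \<rho> b, \<rho> a} = J" unfolding Ja using b' by (auto simp: reps_def)
      then show ?thesis using edge_value_pair[OF b'(1) a b'(3,4) True] b' M by (simp add: D_def insert_commute)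
    qed
    have fr2: "edge_value A \<rho> w {a, b} = moment_eval M ([:1, - real (w a + w b + 1):] * weight_poly w (J - {b, \<rho> b})) / D"
      if b: "b \<in> internal_ends A \<rho> - {a, \<rho> a}" for b
    proof -
      have b': "b \<in> A" "\<rho> b \<in> A" "a \<noteq> b" "b \<noteq> \<rho> a" using b by (auto simp: internal_ends_def)
      have "?P - {a, b, \<rho> a, \<rho> b} = J - {b, \<rho> b}" unfolding Ja by blast
      then show ?thesis using edge_value_pair[OF a b'(1,3,4,2)] True M by (simp add: D_def)
    qed
    \<comment> \<open>The value 0 at \<open>a\<close> and its partner allows the sum to run over all
      internal ends, so that \<open>sum_internal_ends\<close> applies.\<close>
    define F where "F b = (if b \<in> {a, \<rho> a} then 0 else
       moment_eval M ([:1, - real (w a + w b + 1):] * weight_poly w (J - {b, \<rho> b})))" for b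
    \<comment> \<open>The factor of the merged path is split as
      \<open>1 - (w a + w k + 1) X = (1 - w k X) - (w a + 1) X\<close>. The first part restores the
      missing factor of \<open>?q\<close>; the second leads to a sum of polynomials with one factor
      removed.\<close>
    have polys: "(\<Sum>k\<in>J. [:1, - real (w a + w k + 1):] * weight_poly w (J - {k}))
       = smult (real M) ?q - smult (?y + 1) ([:0, 1:] * (smult (real M) ?q - [:0, 1:] * pderiv ?q))"
    proof -
      have "(\<Sum>k\<in>J. [:1, - real (w a + w k + 1):] * weight_poly w (J - {k}))
         = (\<Sum>k\<in>J. ?q - smult (?y + 1) ([:0, 1:] * weight_poly w (J - {k})))"
      proof (rule sum.cong[OF refl])
        fix k assume k: "k \<in> J"
        have "?q = [:1, - real (w k):] * weight_poly w (J - {k})"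
          using k fJ by (simp add: weight_poly_def prod.remove)
        moreover have "[:1, - real (w a + w k + 1):] = [:1, - real (w k):] - smult (?y + 1) [:0, 1:]" by simp
        ultimately show "[:1, - real (w a + w k + 1):] * weight_poly w (J - {k})
            = ?q - smult (?y + 1) ([:0, 1:] * weight_poly w (J - {k}))"
          by (simp only: left_diff_distrib mult_smult_left)
      qed
      also have "\<dots> = smult (real M) ?q - smult (?y + 1) ([:0, 1:] * (\<Sum>k\<in>J. weight_poly w (J - {k})))"
        by (simp add: sum_subtractf sum_smult sum_distrib_left cJ of_nat_poly del: mult_pCons_left)
          (simp add: of_nat_poly)
      finally show ?thesis using weight_poly_sum_remove[OF fJ, of w] cJ by simp
    qed
    have "(\<Sum>e\<in>star a. edge_value A \<rho> w e) = (\<Sum>b\<in>exterior_ends A \<rho>. moment_eval M ?q / D) + (\<Sum>b\<in>internal_ends A \<rho> - {a, \<rho> a}. F b / D)"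
      unfolding sum_star[OF a] part using disj fins
      by (subst sum.union_disjoint) (auto simp: fr1 fr2 F_def)
    also have "(\<Sum>b\<in>internal_ends A \<rho> - {a, \<rho> a}. F b / D) = (\<Sum>b\<in>internal_ends A \<rho>. F b / D)"
      using fins by (intro sum.mono_neutral_left) (auto simp: F_def)
    also have "\<dots> = (\<Sum>b\<in>?P. F b / D + F (\<rho> b) / D)" by (rule sum_internal_ends)
    also have "\<dots> = (\<Sum>b\<in>J. F b / D + F (\<rho> b) / D)"
    proof (rule sum.mono_neutral_right)
      show "\<forall>i\<in>?P - J. F i / D + F (\<rho> i) / D = 0"
      proof
        fix i assume "i \<in> ?P - J"
        then have "i = r" by (simp add: J_def)
        then show "F i / D + F (\<rho> i) / D = 0" using r(2) a by (auto simp: F_def)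
      qed
    qed (auto simp: J_def)
    also have "\<dots> = (\<Sum>b\<in>J. 2 * moment_eval M ([:1, - real (w a + w b + 1):] * weight_poly w (J - {b})) / D)"
    proof (rule sum.cong[OF refl])
      fix b assume b: "b \<in> J"
      then have bP: "b \<in> A" "\<rho> b \<in> A" "b < \<rho> b" "b \<noteq> a" "b \<noteq> \<rho> a" unfolding Ja by (auto simp: reps_def)
      then have "\<rho> b \<noteq> a" "\<rho> b \<noteq> \<rho> a" using rho_flip[OF a bP(1)] rho_inj[OF a bP(1)] by auto
      moreover have "J - {b, \<rho> b} = J - {b}" "J - {\<rho> b, \<rho> (\<rho> b)} = J - {b}"
        using bP by (auto simp: J_def reps_def)
      ultimately show "F b / D + F (\<rho> b) / D = 2 * moment_eval M ([:1, - real (w a + w b + 1):] * weight_poly w (J - {b})) / D"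
        using bP w_rho[OF bP(1,2)] by (simp add: F_def)
    qed
    also have "\<dots> = 2 * moment_eval M (\<Sum>k\<in>J. [:1, - real (w a + w k + 1):] * weight_poly w (J - {k})) / D"
      by (simp only: moment_eval_sum sum_distrib_left sum_divide_distrib)
    also have "(\<Sum>b\<in>exterior_ends A \<rho>. moment_eval M ?q / D) = 3 * moment_eval M ?q / D" by (simp add: card_ext)
    finally have S: "(\<Sum>e\<in>star a. edge_value A \<rho> w e)
       = (3 * moment_eval M ?q + 2 * moment_eval M (\<Sum>k\<in>J. [:1, - real (w a + w k + 1):] * weight_poly w (J - {k}))) / D"
      by (simp add: add_divide_distrib)
    have pr: "weight_poly w ?P = [:1, - ?y:] * ?q"
    proof -
      have "weight_poly w ?P = [:1, - real (w r):] * weight_poly w (?P - {r})"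
        unfolding weight_poly_def by (rule prod.remove[OF fin r(1)])
      then show ?thesis by (simp only: r(4) J_def)
    qed
    have "2 * real (Suc M) * moment_eval (Suc M) ([:1, - ?y:] * ?q)
      = moment_eval M (smult (2 * real M + 3) ?q - smult (2 * (?y + 1)) ([:0, 1:] * (smult (real M) ?q - [:0, 1:] * pderiv ?q)))"
      by (rule moment_eval_interior) (use deg'[of J] in \<open>auto simp: J_def\<close>)
    also have "\<dots> = 3 * moment_eval M ?q + 2 * moment_eval M (\<Sum>k\<in>J. [:1, - real (w a + w k + 1):] * weight_poly w (J - {k}))"
      unfolding polys moment_eval_diff moment_eval_smult by (simp add: algebra_simps)
    finally have "2 * real (Suc M) * moment_eval (Suc M) (weight_poly w ?P)
       = 3 * moment_eval M ?q + 2 * moment_eval M (\<Sum>k\<in>J. [:1, - real (w a + w k + 1):] * weight_poly w (J - {k}))"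
      unfolding pr .
    then show ?thesis unfolding S using D0 by (simp add: D_def state_value_def M)
  qed
qed

end

section \<open>Independence of the order of merges\<close>

lemma Diff_swap: "A - B - C = A - C - (B::nat set)"
  by auto

text \<open>Merges carried out in different orders need to agree only on the vertices that remain;
  on the others the resulting functions can differ.\<close>

lemma state_value_cong:
  assumes "\<And>a. a \<in> A \<Longrightarrow> \<rho> a = \<rho>' a" "\<And>a. a \<in> A \<Longrightarrow> w a = w' a"
  shows "state_value A \<rho> w = state_value A \<rho>' w'"
proof -
  have "reps A \<rho> = reps A \<rho>'" using assms by (auto simp: reps_def)
  moreover have "weight_poly w (reps A \<rho>') = weight_poly w' (reps A \<rho>')"
    unfolding weight_poly_def by (rule prod.cong) (use assms in \<open>auto simp: reps_def\<close>)
  ultimately show ?thesis by (simp add: state_value_def)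
qed

context gadget
begin

lemma pairD:
  assumes "{a, b} \<in> allowed A \<rho>"
  shows "a \<in> A" "b \<in> A" "a \<noteq> b" "b \<noteq> \<rho> a" "a \<noteq> \<rho> b" "\<rho> a \<in> A \<or> \<rho> b \<in> A" "\<rho> a \<noteq> \<rho> b"
    "\<rho> a \<noteq> a" "\<rho> b \<noteq> b"
proof -
  show A: "a \<in> A" "b \<in> A" using allowed_sub[OF assms] by auto
  then show "a \<noteq> b" "b \<noteq> \<rho> a" "\<rho> a \<in> A \<or> \<rho> b \<in> A" using assms pair_allowed by auto
  then show "a \<noteq> \<rho> b" "\<rho> a \<noteq> \<rho> b" "\<rho> a \<noteq> a" "\<rho> b \<noteq> b" using A rho_flip rho_inj by auto
qed

lemma merge_partner_allowed:
  assumes "{a, b} \<in> allowed A \<rho>"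
  shows "merge_partner {a, b} \<rho> = \<rho>(\<rho> a := \<rho> b, \<rho> b := \<rho> a)"
    "merge_weight {a, b} \<rho> w = w(\<rho> a := w a + w b + 1, \<rho> b := w a + w b + 1)"
  using merge_partner_pair merge_weight_pair pairD[OF assms] by blast+

lemma compat_far:
  assumes e: "{a, b} \<in> allowed A \<rho>" and f: "{c, d} \<in> allowed A \<rho>"
    and far: "{c, d} \<inter> {a, b, \<rho> a, \<rho> b} = {}"
  shows "{c, d} \<in> allowed (A - {a, b}) (merge_partner {a, b} \<rho>)"
    and "merge_partner {c, d} (merge_partner {a, b} \<rho>) = \<rho>(\<rho> a := \<rho> b, \<rho> b := \<rho> a, \<rho> c := \<rho> d, \<rho> d := \<rho> c)"
    and "merge_weight {c, d} (merge_partner {a, b} \<rho>) (merge_weight {a, b} \<rho> w)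
       = w(\<rho> a := w a + w b + 1, \<rho> b := w a + w b + 1, \<rho> c := w c + w d + 1, \<rho> d := w c + w d + 1)"
proof -
  interpret m: gadget "A - {a, b}" "merge_partner {a, b} \<rho>" "merge_weight {a, b} \<rho> w" by (rule allowed_merged_gadget[OF e])
  note E = pairD[OF e] and F = pairD[OF f]
  have cd: "c \<in> A - {a, b}" "d \<in> A - {a, b}" using F far by auto
  have m: "merge_partner {a, b} \<rho> c = \<rho> c" "merge_partner {a, b} \<rho> d = \<rho> d" "merge_weight {a, b} \<rho> w c = w c" "merge_weight {a, b} \<rho> w d = w d"
    using far by (auto simp: merge_partner_allowed[OF e])
  have n: "\<rho> c \<notin> {a, b}" "\<rho> d \<notin> {a, b}" using far F(1,2) E(1,2) rho_flip by auto
  show lin_part: "{c, d} \<in> allowed (A - {a, b}) (merge_partner {a, b} \<rho>)"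
    unfolding m.pair_allowed[OF cd] m using F n by auto
  show "merge_partner {c, d} (merge_partner {a, b} \<rho>) = \<rho>(\<rho> a := \<rho> b, \<rho> b := \<rho> a, \<rho> c := \<rho> d, \<rho> d := \<rho> c)"
    unfolding m.merge_partner_allowed[OF lin_part] m unfolding merge_partner_allowed[OF e] ..
  show "merge_weight {c, d} (merge_partner {a, b} \<rho>) (merge_weight {a, b} \<rho> w)
       = w(\<rho> a := w a + w b + 1, \<rho> b := w a + w b + 1, \<rho> c := w c + w d + 1, \<rho> d := w c + w d + 1)"
    unfolding m.merge_partner_allowed[OF lin_part] m unfolding merge_partner_allowed[OF e] ..
qed

text \<open>The second edge starts at the far end \<open>\<rho> a\<close> of a path used by the
  first, so three paths are joined in a row. It remains allowed unless it would close the path just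
  formed (\<open>d = \<rho> b\<close>) or join two exterior ends.\<close>

lemma compat_near:
  assumes e: "{a, b} \<in> allowed A \<rho>" and ra: "\<rho> a \<in> A" and d: "d \<in> A" "d \<noteq> a" "d \<noteq> b" "d \<noteq> \<rho> a"
  shows "{\<rho> a, d} \<in> allowed (A - {a, b}) (merge_partner {a, b} \<rho>) \<longleftrightarrow> d \<noteq> \<rho> b \<and> (\<rho> b \<in> A \<or> \<rho> d \<in> A)"
    and "{\<rho> a, d} \<in> allowed (A - {a, b}) (merge_partner {a, b} \<rho>) \<Longrightarrow> x \<in> A - {a, b} - {\<rho> a, d} \<Longrightarrow>
       merge_partner {\<rho> a, d} (merge_partner {a, b} \<rho>) x = (if x = \<rho> b then \<rho> d else if x = \<rho> d then \<rho> b else \<rho> x)"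
    and "{\<rho> a, d} \<in> allowed (A - {a, b}) (merge_partner {a, b} \<rho>) \<Longrightarrow> x \<in> A - {a, b} - {\<rho> a, d} \<Longrightarrow>
       merge_weight {\<rho> a, d} (merge_partner {a, b} \<rho>) (merge_weight {a, b} \<rho> w) x
        = (if x = \<rho> b \<or> x = \<rho> d then w a + w b + w d + 2 else w x)"
proof -
  interpret m: gadget "A - {a, b}" "merge_partner {a, b} \<rho>" "merge_weight {a, b} \<rho> w" by (rule allowed_merged_gadget[OF e])
  note E = pairD[OF e]
  have cd: "\<rho> a \<in> A - {a, b}" "d \<in> A - {a, b}" using E ra d by auto
  have m1: "merge_partner {a, b} \<rho> (\<rho> a) = \<rho> b" "merge_weight {a, b} \<rho> w (\<rho> a) = w a + w b + 1"
    using E(7) by (auto simp: merge_partner_allowed[OF e])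
  have m2: "merge_partner {a, b} \<rho> d = \<rho> d" "merge_weight {a, b} \<rho> w d = w d" if "d \<noteq> \<rho> b"
    using d that by (auto simp: merge_partner_allowed[OF e])
  have rb: "\<rho> b \<notin> {a, b}" using E by auto
  have rd: "\<rho> d \<notin> {a, b}" if "d \<noteq> \<rho> b" using d that E rho_flip by auto
  show iff: "{\<rho> a, d} \<in> allowed (A - {a, b}) (merge_partner {a, b} \<rho>) \<longleftrightarrow> d \<noteq> \<rho> b \<and> (\<rho> b \<in> A \<or> \<rho> d \<in> A)"
    unfolding m.pair_allowed[OF cd] m1 using m2 rb rd d by auto
  assume lin_part: "{\<rho> a, d} \<in> allowed (A - {a, b}) (merge_partner {a, b} \<rho>)" and x: "x \<in> A - {a, b} - {\<rho> a, d}"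
  then have db: "d \<noteq> \<rho> b" using iff by blast
  note m2 = m2[OF db]
  have bd: "\<rho> b \<noteq> \<rho> d" using E(2) d rho_inj by auto
  show "merge_partner {\<rho> a, d} (merge_partner {a, b} \<rho>) x = (if x = \<rho> b then \<rho> d else if x = \<rho> d then \<rho> b else \<rho> x)"
    unfolding m.merge_partner_allowed[OF lin_part] m1 m2 using x bd by (simp add: merge_partner_allowed[OF e])
  show "merge_weight {\<rho> a, d} (merge_partner {a, b} \<rho>) (merge_weight {a, b} \<rho> w) x
        = (if x = \<rho> b \<or> x = \<rho> d then w a + w b + w d + 2 else w x)"
    unfolding m.merge_partner_allowed[OF lin_part] m1 m2 using x bd by (simp add: merge_partner_allowed[OF e])
qed

definition merged_value :: "nat set \<Rightarrow> nat set \<Rightarrow> real" where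
  "merged_value e f = state_value (A - e - f) (merge_partner f (merge_partner e \<rho>)) (merge_weight f (merge_partner e \<rho>) (merge_weight e \<rho> w))"

text \<open>The resulting paths are the same in either order, and so are the weights, since every
  merge adds up the weights and 1. If the edges use opposite ends of one path, its weight is read
  off at different ends, which is harmless by \<open>w_rho\<close>. Symmetry of the second moments
  rests on this.\<close>

lemma merge_sym:
  assumes e: "e \<in> allowed A \<rho>" and f: "f \<in> allowed (A - e) (merge_partner e \<rho>)"
  shows "f \<in> allowed A \<rho>" "e \<in> allowed (A - f) (merge_partner f \<rho>)" "merged_value e f = merged_value f e"
proof -
  interpret m: gadget "A - e" "merge_partner e \<rho>" "merge_weight e \<rho> w" by (rule allowed_merged_gadget[OF e])
  have fA: "f \<subseteq> A - e" using m.allowed_sub[OF f] .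
  have "f \<in> allowed A \<rho> \<and> e \<in> allowed (A - f) (merge_partner f \<rho>) \<and> merged_value e f = merged_value f e"
  proof (cases "f \<inter> \<rho> ` e = {}")
    case True
    obtain a b where ab: "e = {a, b}" using e by (elim allowE) auto
    obtain c d where cd: "f = {c, d}" using f by (elim m.allowE) auto
    have far: "{c, d} \<inter> {a, b, \<rho> a, \<rho> b} = {}" "{c, d} \<inter> {\<rho> a, \<rho> b} = {}" using True fA ab cd by auto
    have e': "{a, b} \<in> allowed A \<rho>" using e ab by simp
    note E = pairD[OF e']
    have f': "{c, d} \<in> allowed (A - {a, b}) (merge_partner {a, b} \<rho>)" using f ab cd by simp
    have cA: "c \<in> A" "d \<in> A" using fA cd by auto
    have mm: "merge_partner {a, b} \<rho> c = \<rho> c" "merge_partner {a, b} \<rho> d = \<rho> d"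
      using far by (auto simp: merge_partner_allowed[OF e'])
    have fa: "{c, d} \<in> allowed A \<rho>"
      using m.pairD[of c d] f cA mm ab cd unfolding pair_allowed[OF cA] by auto
    note F = pairD[OF fa]
    have far': "{a, b} \<inter> {c, d, \<rho> c, \<rho> d} = {}" using far E(1,2) cA rho_flip by auto
    note c1 = compat_far[OF e' fa far(1)] and c2 = compat_far[OF fa e' far']
    have d: "\<rho> a \<noteq> \<rho> c" "\<rho> a \<noteq> \<rho> d" "\<rho> b \<noteq> \<rho> c" "\<rho> b \<noteq> \<rho> d" using far E(1,2) cA rho_inj by auto
    have "merge_partner {c, d} (merge_partner {a, b} \<rho>) = merge_partner {a, b} (merge_partner {c, d} \<rho>)"
      unfolding c1 c2 using d E(7) F(7) by (auto simp: fun_eq_iff)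
    moreover have "merge_weight {c, d} (merge_partner {a, b} \<rho>) (merge_weight {a, b} \<rho> w) = merge_weight {a, b} (merge_partner {c, d} \<rho>) (merge_weight {c, d} \<rho> w)"
      unfolding c1 c2 using d E(7) F(7) by (auto simp: fun_eq_iff)
    ultimately show ?thesis using fa c2(1) unfolding merged_value_def ab cd by (simp add: Diff_Diff_Int Un_commute Diff_insert2[symmetric] set_diff_eq conj_ac)
  next
    case False
    then obtain a where a: "a \<in> e" "\<rho> a \<in> f" by blast
    obtain b where ab: "e = {a, b}"
      using a(1) e by (elim allowE) (auto simp: insert_commute)
    obtain d where cd: "f = {\<rho> a, d}"
      using a(2) f by (elim m.allowE) (auto simp: insert_commute)
    have e': "{a, b} \<in> allowed A \<rho>" using e ab by simp
    note E = pairD[OF e']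
    have f': "{\<rho> a, d} \<in> allowed (A - {a, b}) (merge_partner {a, b} \<rho>)" using f ab cd by simp
    have d: "d \<in> A" "d \<noteq> a" "d \<noteq> b" "\<rho> a \<in> A" using fA ab cd by auto
    have da: "d \<noteq> \<rho> a" using m.pairD(3)[of "\<rho> a" d] f cd by auto
    note c1 = compat_near[OF e' d(4) d(1-3) da]
    have iff: "d \<noteq> \<rho> b" "\<rho> b \<in> A \<or> \<rho> d \<in> A" using c1(1) f' by auto
    have fa: "{\<rho> a, d} \<in> allowed A \<rho>"
      unfolding pair_allowed[OF d(4) d(1)] using da d E(1) by simp
    have rra: "\<rho> (\<rho> a) \<in> A" "\<rho> (\<rho> a) = a" using E(1) by auto
    have bb: "b \<in> A" "b \<noteq> \<rho> a" "b \<noteq> d" "b \<noteq> \<rho> (\<rho> a)" using E d by auto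
    note c2 = compat_near[OF fa rra(1) bb, unfolded rra(2)]
    have bd: "b \<noteq> \<rho> d" using iff rho_flip[OF d(1) bb(1)] by blast
    have ef: "{a, b} \<in> allowed (A - {\<rho> a, d}) (merge_partner {\<rho> a, d} \<rho>)" using c2(1) bd iff by blast
    have "merged_value {a, b} {\<rho> a, d} = merged_value {\<rho> a, d} {a, b}"
      unfolding merged_value_def
    proof (subst Diff_swap)
      show "state_value (A - {\<rho> a, d} - {a, b}) (merge_partner {\<rho> a, d} (merge_partner {a, b} \<rho>)) (merge_weight {\<rho> a, d} (merge_partner {a, b} \<rho>) (merge_weight {a, b} \<rho> w))
        = state_value (A - {\<rho> a, d} - {a, b}) (merge_partner {a, b} (merge_partner {\<rho> a, d} \<rho>)) (merge_weight {a, b} (merge_partner {\<rho> a, d} \<rho>) (merge_weight {\<rho> a, d} \<rho> w))"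
      proof (rule state_value_cong)
        fix x assume x: "x \<in> A - {\<rho> a, d} - {a, b}"
        then have x': "x \<in> A - {a, b} - {\<rho> a, d}" by auto
        show "merge_partner {\<rho> a, d} (merge_partner {a, b} \<rho>) x = merge_partner {a, b} (merge_partner {\<rho> a, d} \<rho>) x"
          using c1(2)[OF f' x'] c2(2)[OF ef x] by simp
        show "merge_weight {\<rho> a, d} (merge_partner {a, b} \<rho>) (merge_weight {a, b} \<rho> w) x = merge_weight {a, b} (merge_partner {\<rho> a, d} \<rho>) (merge_weight {\<rho> a, d} \<rho> w) x"
          using c1(3)[OF f' x'] c2(3)[OF ef x] w_rho[OF E(1) d(4)] by simp
      qed
    qed
    then show ?thesis using fa ef ab cd by simp
  qed
  then show "f \<in> allowed A \<rho>" "e \<in> allowed (A - f) (merge_partner f \<rho>)" "merged_value e f = merged_value f e" by auto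
qed

lemma compat_far':
  assumes e: "e \<in> allowed A \<rho>" and f: "f \<in> allowed A \<rho>" and far: "e \<inter> f = {}" "\<rho> ` e \<inter> f = {}"
  shows "f \<in> allowed (A - e) (merge_partner e \<rho>)"
proof -
  obtain a b where ab: "e = {a, b}" using e by (elim allowE) auto
  obtain c d where cd: "f = {c, d}" using f by (elim allowE) auto
  show ?thesis using compat_far(1)[of a b c d] e f far unfolding ab cd by auto
qed

text \<open>If \<open>f\<close> avoids the far ends of the paths merged by \<open>e\<close>, it
  stays allowed. Otherwise the criterion of \<open>compat_near\<close> fails only if the other
  vertex of \<open>f\<close> is a far end too, or exterior. So each \<open>e\<close> has only
  boundedly many disjoint incompatible \<open>f\<close>.\<close>

lemma incompat_near:
  assumes e: "e \<in> allowed A \<rho>" and f: "f \<in> allowed A \<rho>" and ef: "e \<inter> f = {}"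
    and n: "f \<notin> allowed (A - e) (merge_partner e \<rho>)"
  shows "f \<subseteq> \<rho> ` e \<union> exterior_ends A \<rho>" "\<rho> ` f \<inter> e \<noteq> {}" "\<rho> ` e \<inter> f \<noteq> {}" "e \<notin> allowed (A - f) (merge_partner f \<rho>)"
proof -
  show near: "\<rho> ` e \<inter> f \<noteq> {}" using compat_far' e f ef n by blast
  then obtain a where a: "a \<in> e" "\<rho> a \<in> f" by blast
  have aA: "a \<in> A" "\<rho> a \<in> A" using allowed_sub e f a by blast+
  then show "\<rho> ` f \<inter> e \<noteq> {}" using a rho_rho by (metis Int_iff empty_iff image_eqI)
  obtain b where ab: "e = {a, b}" using a(1) e by (elim allowE) (auto simp: insert_commute)
  obtain d where cd: "f = {\<rho> a, d}" using a(2) f by (elim allowE) (auto simp: insert_commute)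
  have e': "{a, b} \<in> allowed A \<rho>" and f': "{\<rho> a, d} \<in> allowed A \<rho>" using e f ab cd by auto
  note E = pairD[OF e'] and F = pairD[OF f']
  have d: "d \<noteq> a" "d \<noteq> b" "d \<noteq> \<rho> a" using F ef ab cd by auto
  have "\<not> (d \<noteq> \<rho> b \<and> (\<rho> b \<in> A \<or> \<rho> d \<in> A))"
    using compat_near(1)[OF e' aA(2) F(2) d] n ab cd by auto
  then show "f \<subseteq> \<rho> ` e \<union> exterior_ends A \<rho>" using F(2) by (auto simp: ab cd exterior_ends_def)
  show "e \<notin> allowed (A - f) (merge_partner f \<rho>)" using merge_sym(2)[OF f, of e] n by blast
qed

definition pair_value :: "nat set \<Rightarrow> nat set \<Rightarrow> real" where
  "pair_value e f = edge_value A \<rho> w e * edge_value (A - e) (merge_partner e \<rho>) (merge_weight e \<rho> w) f"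

text \<open>The state value after the first merge cancels. The order of \<open>e\<close> and
  \<open>f\<close> then enters only through \<open>merged_value\<close>, which is symmetric.\<close>

lemma pair_value_eq:
  assumes e: "e \<in> allowed A \<rho>" and nz: "state_value (A - e) (merge_partner e \<rho>) (merge_weight e \<rho> w) \<noteq> 0"
  shows "pair_value e f = (if f \<in> allowed (A - e) (merge_partner e \<rho>) then
     merged_value e f / (2 * real (card (reps A \<rho>)) * (2 * real (card (reps A \<rho>) - 1)) * state_value A \<rho> w) else 0)"
proof -
  obtain a b where ab: "e = {a, b}" "a \<in> A" "b \<in> A" "a \<noteq> b" "b \<noteq> \<rho> a" "\<rho> b \<in> A" using e by (rule allowE)
  have "card (reps (A - e) (merge_partner e \<rho>)) = card (reps A \<rho>) - 1"
    using card_reps_merged[OF ab(2-6)] ab(1) by simp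
  then show ?thesis using e nz by (simp add: pair_value_def edge_value_def merged_value_def field_simps)
qed

end

section \<open>Estimates for quadratic forms\<close>

text \<open>One step of Gram-Schmidt orthogonalisation: the new vector \<open>k b\<close> is first
  made orthogonal to the old ones, then its multiple is subtracted from \<open>z\<close>.\<close>

lemma orthogonal_decomposition:
  fixes k :: "'a \<Rightarrow> 'e \<Rightarrow> real"
  assumes "finite E" "finite I"
  shows "\<exists>y. \<forall>a\<in>I. (\<Sum>e\<in>E. (z e - (\<Sum>b\<in>I. y b * k b e)) * k a e) = 0"
  using assms(2)
proof (induction I arbitrary: z rule: finite_induct)
  case (insert b I)
  obtain yb where yb: "\<forall>a\<in>I. (\<Sum>e\<in>E. (k b e - (\<Sum>c\<in>I. yb c * k c e)) * k a e) = 0"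
    using insert.IH[of "k b"] by blast
  obtain y where y: "\<forall>a\<in>I. (\<Sum>e\<in>E. (z e - (\<Sum>c\<in>I. y c * k c e)) * k a e) = 0"
    using insert.IH[of z] by blast
  define kb where "kb e = k b e - (\<Sum>c\<in>I. yb c * k c e)" for e
  define z1 where "z1 e = z e - (\<Sum>c\<in>I. y c * k c e)" for e
  define N where "N = (\<Sum>e\<in>E. kb e * kb e)"
  \<comment> \<open>If \<open>N = 0\<close>, division by zero makes \<open>t = 0\<close>, which is
    right because \<open>kb\<close> vanishes on \<open>E\<close>.\<close>
  define t where "t = (\<Sum>e\<in>E. z1 e * kb e) / N"
  define y' where "y' c = (if c = b then t else y c - t * yb c)" for c
  have z2: "z e - (\<Sum>c\<in>insert b I. y' c * k c e) = z1 e - t * kb e" for e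
  proof -
    have "(\<Sum>c\<in>I. y' c * k c e) = (\<Sum>c\<in>I. (y c - t * yb c) * k c e)"
      by (rule sum.cong) (use insert.hyps in \<open>auto simp: y'_def\<close>)
    then show ?thesis using insert.hyps
      by (simp add: z1_def kb_def y'_def algebra_simps sum_subtractf sum_distrib_left)
  qed
  have o1: "(\<Sum>e\<in>E. (z1 e - t * kb e) * k a e) = 0" if "a \<in> I" for a
  proof -
    have "(\<Sum>e\<in>E. (z1 e - t * kb e) * k a e) = (\<Sum>e\<in>E. z1 e * k a e) - t * (\<Sum>e\<in>E. kb e * k a e)"
      by (simp add: algebra_simps sum_subtractf sum_distrib_left)
    then show ?thesis using y yb that by (simp add: z1_def kb_def)
  qed
  have o2: "(\<Sum>e\<in>E. (z1 e - t * kb e) * kb e) = 0"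
  proof (cases "N = 0")
    case True
    then have "\<forall>e\<in>E. kb e * kb e = 0" using assms(1) unfolding N_def by (subst (asm) sum_nonneg_eq_0_iff) auto
    then show ?thesis by simp
  next
    case False
    have "(\<Sum>e\<in>E. (z1 e - t * kb e) * kb e) = (\<Sum>e\<in>E. z1 e * kb e) - t * N"
      by (simp add: N_def algebra_simps sum_subtractf sum_distrib_left)
    then show ?thesis using False by (simp add: t_def)
  qed
  have o3: "(\<Sum>e\<in>E. (z1 e - t * kb e) * k b e) = 0"
  proof -
    have "(\<Sum>e\<in>E. (z1 e - t * kb e) * k b e)
       = (\<Sum>e\<in>E. (z1 e - t * kb e) * kb e) + (\<Sum>e\<in>E. \<Sum>c\<in>I. yb c * ((z1 e - t * kb e) * k c e))"
      unfolding sum.distrib[symmetric]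
    proof (rule sum.cong[OF refl])
      fix e
      have "k b e = kb e + (\<Sum>c\<in>I. yb c * k c e)" by (simp add: kb_def)
      then show "(z1 e - t * kb e) * k b e = (z1 e - t * kb e) * kb e + (\<Sum>c\<in>I. yb c * ((z1 e - t * kb e) * k c e))"
        by (simp only: distrib_left sum_distrib_left) (simp add: mult_ac)
    qed
    also have "(\<Sum>e\<in>E. \<Sum>c\<in>I. yb c * ((z1 e - t * kb e) * k c e))
        = (\<Sum>c\<in>I. yb c * (\<Sum>e\<in>E. (z1 e - t * kb e) * k c e))"
      by (subst sum.swap) (simp add: sum_distrib_left)
    finally show ?thesis using o1 o2 by simp
  qed
  show ?case
    by (rule exI[of _ y']) (use o1 o3 in \<open>simp add: z2\<close>)
qed simp

lemma sum_product_bound: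
  fixes c z :: "'e \<Rightarrow> real"
  shows "(\<Sum>e\<in>E. \<Sum>f\<in>E. c e * c f * (\<bar>z e\<bar> * \<bar>z f\<bar>)) \<le> (\<Sum>e\<in>E. (c e)\<^sup>2) * (\<Sum>e\<in>E. (z e)\<^sup>2)"
proof -
  have "(\<Sum>e\<in>E. \<Sum>f\<in>E. c e * c f * (\<bar>z e\<bar> * \<bar>z f\<bar>))
      \<le> (\<Sum>e\<in>E. \<Sum>f\<in>E. ((c e)\<^sup>2 * (z f)\<^sup>2 + (c f)\<^sup>2 * (z e)\<^sup>2) / 2)"
  proof (intro sum_mono)
    fix e f
    have "0 \<le> (c e * \<bar>z f\<bar> - c f * \<bar>z e\<bar>)\<^sup>2" by simp
    then show "c e * c f * (\<bar>z e\<bar> * \<bar>z f\<bar>) \<le> ((c e)\<^sup>2 * (z f)\<^sup>2 + (c f)\<^sup>2 * (z e)\<^sup>2) / 2"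
      by (simp add: power2_diff power_mult_distrib mult_ac)
  qed
  also have "\<dots> = ((\<Sum>e\<in>E. \<Sum>f\<in>E. (c e)\<^sup>2 * (z f)\<^sup>2) + (\<Sum>e\<in>E. \<Sum>f\<in>E. (c f)\<^sup>2 * (z e)\<^sup>2)) / 2"
    by (simp add: sum.distrib sum_divide_distrib add_divide_distrib)
  also have "(\<Sum>e\<in>E. \<Sum>f\<in>E. (c f)\<^sup>2 * (z e)\<^sup>2) = (\<Sum>e\<in>E. \<Sum>f\<in>E. (c e)\<^sup>2 * (z f)\<^sup>2)"
    by (rule sum.swap)
  finally show ?thesis by (simp add: sum_product)
qed

lemma square_sum_le:
  fixes c z :: "'e \<Rightarrow> real"
  shows "(\<Sum>e\<in>E. c e * z e)\<^sup>2 \<le> (\<Sum>e\<in>E. (c e)\<^sup>2) * (\<Sum>e\<in>E. (z e)\<^sup>2)"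
proof -
  have "(\<Sum>e\<in>E. c e * z e)\<^sup>2 = (\<Sum>e\<in>E. \<Sum>f\<in>E. (c e * z e) * (c f * z f))"
    by (simp add: power2_eq_square sum_product)
  also have "\<dots> \<le> (\<Sum>e\<in>E. \<Sum>f\<in>E. \<bar>c e\<bar> * \<bar>c f\<bar> * (\<bar>z e\<bar> * \<bar>z f\<bar>))"
  proof (intro sum_mono)
    fix e f
    have "(c e * z e) * (c f * z f) \<le> \<bar>(c e * z e) * (c f * z f)\<bar>" by (rule abs_ge_self)
    then show "(c e * z e) * (c f * z f) \<le> \<bar>c e\<bar> * \<bar>c f\<bar> * (\<bar>z e\<bar> * \<bar>z f\<bar>)"
      by (simp only: abs_mult mult_ac)
  qed
  also have "\<dots> \<le> (\<Sum>e\<in>E. \<bar>c e\<bar>\<^sup>2) * (\<Sum>e\<in>E. (z e)\<^sup>2)" by (rule sum_product_bound)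
  finally show ?thesis by simp
qed

text \<open>The Schur test: the inequality between geometric and arithmetic mean distributes each
  entry evenly to its row and its column.\<close>

lemma kernel_bound:
  fixes K :: "'e \<Rightarrow> 'e \<Rightarrow> real"
  assumes row: "\<And>e. e \<in> E \<Longrightarrow> (\<Sum>f\<in>E. K e f) \<le> B" and col: "\<And>f. f \<in> E \<Longrightarrow> (\<Sum>e\<in>E. K e f) \<le> B"
    and nn: "\<And>e f. e \<in> E \<Longrightarrow> f \<in> E \<Longrightarrow> 0 \<le> K e f"
  shows "(\<Sum>e\<in>E. \<Sum>f\<in>E. K e f * (\<bar>z e\<bar> * \<bar>z f\<bar>)) \<le> B * (\<Sum>e\<in>E. (z e)\<^sup>2)"
proof -
  have "(\<Sum>e\<in>E. \<Sum>f\<in>E. K e f * (\<bar>z e\<bar> * \<bar>z f\<bar>))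
      \<le> (\<Sum>e\<in>E. \<Sum>f\<in>E. (K e f * (z e)\<^sup>2 + K e f * (z f)\<^sup>2) / 2)"
  proof (intro sum_mono)
    fix e f assume ef: "e \<in> E" "f \<in> E"
    have "0 \<le> (\<bar>z e\<bar> - \<bar>z f\<bar>)\<^sup>2" by simp
    then have "\<bar>z e\<bar> * \<bar>z f\<bar> \<le> ((z e)\<^sup>2 + (z f)\<^sup>2) / 2" by (simp add: power2_diff)
    then have "K e f * (\<bar>z e\<bar> * \<bar>z f\<bar>) \<le> K e f * (((z e)\<^sup>2 + (z f)\<^sup>2) / 2)" using nn[OF ef] by (rule mult_left_mono)
    then show "K e f * (\<bar>z e\<bar> * \<bar>z f\<bar>) \<le> (K e f * (z e)\<^sup>2 + K e f * (z f)\<^sup>2) / 2"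
      by (simp add: algebra_simps)
  qed
  also have "\<dots> = ((\<Sum>e\<in>E. \<Sum>f\<in>E. K e f * (z e)\<^sup>2) + (\<Sum>e\<in>E. \<Sum>f\<in>E. K e f * (z f)\<^sup>2)) / 2"
    by (simp add: sum.distrib sum_divide_distrib add_divide_distrib)
  also have "(\<Sum>e\<in>E. \<Sum>f\<in>E. K e f * (z f)\<^sup>2) = (\<Sum>f\<in>E. \<Sum>e\<in>E. K e f * (z f)\<^sup>2)"
    by (rule sum.swap)
  also have "((\<Sum>e\<in>E. \<Sum>f\<in>E. K e f * (z e)\<^sup>2) + (\<Sum>f\<in>E. \<Sum>e\<in>E. K e f * (z f)\<^sup>2)) / 2
     = ((\<Sum>e\<in>E. (\<Sum>f\<in>E. K e f) * (z e)\<^sup>2) + (\<Sum>f\<in>E. (\<Sum>e\<in>E. K e f) * (z f)\<^sup>2)) / 2"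
    by (simp add: sum_distrib_right)
  also have "\<dots> \<le> ((\<Sum>e\<in>E. B * (z e)\<^sup>2) + (\<Sum>f\<in>E. B * (z f)\<^sup>2)) / 2"
    by (intro divide_right_mono add_mono sum_mono mult_right_mono row col) auto
  also have "\<dots> = B * (\<Sum>e\<in>E. (z e)\<^sup>2)" by (simp only: sum_distrib_left[symmetric]) simp
  finally show ?thesis .
qed

text \<open>On vectors with sum zero the additive part \<open>\<alpha> e + \<alpha> f - c\<close>
  disappears. \<open>S\<close> takes the part of \<open>T\<close> that is large but of known sign.
  Of the errors, \<open>K\<close> is handled by its row and column sums, the rank-one kernel
  \<open>C * (u e * u f)\<close> by Cauchy-Schwarz.\<close>

lemma quad_form_lower:
  fixes z \<alpha> u :: "'e \<Rightarrow> real" and T K S :: "'e \<Rightarrow> 'e \<Rightarrow> real"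
  assumes bd: "\<And>e f. e \<in> E \<Longrightarrow> f \<in> E \<Longrightarrow> \<bar>T e f - (\<alpha> e + \<alpha> f - c) + S e f\<bar> \<le> K e f + C * (u e * u f)"
    and row: "\<And>e. e \<in> E \<Longrightarrow> (\<Sum>f\<in>E. K e f) \<le> B" and col: "\<And>f. f \<in> E \<Longrightarrow> (\<Sum>e\<in>E. K e f) \<le> B"
    and nn: "\<And>e f. e \<in> E \<Longrightarrow> f \<in> E \<Longrightarrow> 0 \<le> K e f" and C: "0 \<le> C"
    and z0: "(\<Sum>e\<in>E. z e) = 0"
    and S: "(\<Sum>e\<in>E. \<Sum>f\<in>E. S e f * (z e * z f)) \<le> 0"
  shows "- ((B + C * (\<Sum>e\<in>E. (u e)\<^sup>2)) * (\<Sum>e\<in>E. (z e)\<^sup>2)) \<le> (\<Sum>e\<in>E. \<Sum>f\<in>E. T e f * (z e * z f))"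
proof -
  let ?D = "\<lambda>e f. T e f - (\<alpha> e + \<alpha> f - c) + S e f"
  have "(\<Sum>f\<in>E. (\<alpha> e + \<alpha> f - c) * (z e * z f)) = (\<alpha> e - c) * z e * (\<Sum>f\<in>E. z f) + z e * (\<Sum>f\<in>E. \<alpha> f * z f)" for e
    by (simp only: sum_distrib_left sum.distrib[symmetric]) (simp add: algebra_simps)
  then have a0: "(\<Sum>e\<in>E. \<Sum>f\<in>E. (\<alpha> e + \<alpha> f - c) * (z e * z f)) = 0"
    by (simp add: z0 sum_distrib_right[symmetric])
  have "(\<Sum>e\<in>E. \<Sum>f\<in>E. T e f * (z e * z f))
     = (\<Sum>e\<in>E. \<Sum>f\<in>E. ?D e f * (z e * z f)) + (\<Sum>e\<in>E. \<Sum>f\<in>E. (\<alpha> e + \<alpha> f - c) * (z e * z f))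
       - (\<Sum>e\<in>E. \<Sum>f\<in>E. S e f * (z e * z f))"
    by (simp only: sum.distrib[symmetric] sum_subtractf[symmetric]) (simp add: algebra_simps)
  then have 1: "(\<Sum>e\<in>E. \<Sum>f\<in>E. ?D e f * (z e * z f)) \<le> (\<Sum>e\<in>E. \<Sum>f\<in>E. T e f * (z e * z f))"
    using S a0 by linarith
  have "- (\<Sum>e\<in>E. \<Sum>f\<in>E. ?D e f * (z e * z f)) \<le> (\<Sum>e\<in>E. \<Sum>f\<in>E. (K e f + C * (u e * u f)) * (\<bar>z e\<bar> * \<bar>z f\<bar>))"
    unfolding sum_negf[symmetric]
  proof (intro sum_mono)
    fix e f assume ef: "e \<in> E" "f \<in> E"
    have "- (?D e f * (z e * z f)) \<le> \<bar>?D e f\<bar> * (\<bar>z e\<bar> * \<bar>z f\<bar>)"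
      by (metis abs_ge_minus_self abs_mult)
    also have "\<dots> \<le> (K e f + C * (u e * u f)) * (\<bar>z e\<bar> * \<bar>z f\<bar>)"
      by (intro mult_right_mono bd ef) auto
    finally show "- (?D e f * (z e * z f)) \<le> (K e f + C * (u e * u f)) * (\<bar>z e\<bar> * \<bar>z f\<bar>)" .
  qed
  also have "\<dots> = (\<Sum>e\<in>E. \<Sum>f\<in>E. K e f * (\<bar>z e\<bar> * \<bar>z f\<bar>)) + C * (\<Sum>e\<in>E. \<Sum>f\<in>E. u e * u f * (\<bar>z e\<bar> * \<bar>z f\<bar>))"
    by (simp only: distrib_right sum.distrib sum_distrib_left mult.assoc)
  also have "\<dots> \<le> B * (\<Sum>e\<in>E. (z e)\<^sup>2) + C * ((\<Sum>e\<in>E. (u e)\<^sup>2) * (\<Sum>e\<in>E. (z e)\<^sup>2))"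
    by (intro add_mono kernel_bound mult_left_mono sum_product_bound row col nn C) auto
  finally show ?thesis using 1 by (simp add: algebra_simps)
qed

section \<open>Effect of a merge on the weight polynomial\<close>

text \<open>Each power of \<open>X\<close> gains a factor of order \<open>1 / K\<close>. The
  coefficients of higher powers may be larger by a factor \<open>R\<close>, which is harmless
  because \<open>R / K \<le> 1 / 390\<close>: the leading constants 4 and 16 only grow to 5 and
  17.\<close>

lemma moment_eval_low_weight_poly_le:
  assumes J: "finite J" and R: "(\<Sum>j\<in>J. w j) \<le> R" and K: "real K \<le> real N - real R - 4" "390 * R \<le> K" "0 < K"
    and u: "\<bar>a\<bar> \<le> u" "\<bar>b\<bar> \<le> real R * u" and v: "\<bar>c\<bar> \<le> v" "\<bar>d\<bar> \<le> real R * v"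
  shows "\<bar>moment_eval N ([:0, a, b:] * weight_poly w J)\<bar> \<le> 5 / real K * u"
    and "\<bar>moment_eval N ([:0, a, b:] * [:0, c, d:] * weight_poly w J)\<bar> \<le> 17 / (real K)\<^sup>2 * (u * v)"
proof -
  let ?p = "weight_poly w J" and ?k = "1 / real K"
  have u0: "0 \<le> u" "0 \<le> v" using u v by linarith+
  have L: "\<bar>moment_eval N (monom 1 i * ?p)\<bar> \<le> 2 * fact i * (2 / real K) ^ i" if "i \<le> 4" for i
    using K that by (intro moment_eval_monom_weight_poly_le[OF J R]) auto
  have L1: "\<bar>moment_eval N (monom 1 1 * ?p)\<bar> \<le> 4 * ?k" using L[of 1] by simp
  have L2: "\<bar>moment_eval N (monom 1 2 * ?p)\<bar> \<le> 16 * ?k ^ 2" using L[of 2] by (simp add: power_divide)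
  have L3: "\<bar>moment_eval N (monom 1 3 * ?p)\<bar> \<le> 96 * ?k ^ 3" using L[of 3] by (simp add: power_divide fact_numeral)
  have L4: "\<bar>moment_eval N (monom 1 4 * ?p)\<bar> \<le> 768 * ?k ^ 4" using L[of 4] by (simp add: power_divide fact_numeral)
  have k0: "0 \<le> ?k" by simp
  have Rk: "real R * ?k \<le> 1 / 390" using K by (simp add: field_simps)
  have p1: "[:0, a, b:] * ?p = smult a (monom 1 1 * ?p) + smult b (monom 1 2 * ?p)"
  proof -
    have "[:0, a, b:] = smult a (monom 1 1) + smult b (monom 1 2)"
      by (simp add: monom_altdef numeral_2_eq_2)
    then show ?thesis by (simp only: distrib_right mult_smult_left)
  qed
  have "\<bar>moment_eval N ([:0, a, b:] * ?p)\<bar> \<le> \<bar>a\<bar> * \<bar>moment_eval N (monom 1 1 * ?p)\<bar> + \<bar>b\<bar> * \<bar>moment_eval N (monom 1 2 * ?p)\<bar>"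
    unfolding p1 moment_eval_add moment_eval_smult by (rule order_trans[OF abs_triangle_ineq]) (simp add: abs_mult)
  also have "\<dots> \<le> u * (4 * ?k) + (real R * u) * (16 * ?k ^ 2)"
    using u u0 L1 L2 by (intro add_mono mult_mono) auto
  also have "\<dots> = ?k * u * (4 + 16 * (real R * ?k))" by (simp add: power2_eq_square algebra_simps)
  also have "\<dots> \<le> ?k * u * 5" using Rk u0 k0 by (intro mult_left_mono) auto
  finally show "\<bar>moment_eval N ([:0, a, b:] * ?p)\<bar> \<le> 5 / real K * u" by (simp add: mult.commute)
  have p2: "[:0, a, b:] * [:0, c, d:] * ?p = smult (a * c) (monom 1 2 * ?p)
     + (smult (a * d + b * c) (monom 1 3 * ?p) + smult (b * d) (monom 1 4 * ?p))"
  proof -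
    have "[:0, a, b:] * [:0, c, d:] = smult (a * c) (monom 1 2) + (smult (a * d + b * c) (monom 1 3) + smult (b * d) (monom 1 4))"
      by (simp add: monom_altdef numeral_2_eq_2 numeral_3_eq_3 eval_nat_numeral)
    then show ?thesis by (simp only: distrib_right mult_smult_left)
  qed
  have ac: "\<bar>a * c\<bar> \<le> u * v" unfolding abs_mult using u v u0 by (intro mult_mono) auto
  have adbc: "\<bar>a * d + b * c\<bar> \<le> 2 * real R * (u * v)"
  proof -
    have "\<bar>a * d\<bar> \<le> u * (real R * v)" "\<bar>b * c\<bar> \<le> (real R * u) * v"
      unfolding abs_mult using u v u0 by (auto intro!: mult_mono)
    then show ?thesis using abs_triangle_ineq[of "a * d" "b * c"] by (simp add: algebra_simps)
  qed
  have bd: "\<bar>b * d\<bar> \<le> (real R)\<^sup>2 * (u * v)"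
  proof -
    have "\<bar>b * d\<bar> \<le> (real R * u) * (real R * v)" unfolding abs_mult using u v u0 by (intro mult_mono) auto
    then show ?thesis by (simp add: power2_eq_square algebra_simps)
  qed
  have "\<bar>moment_eval N ([:0, a, b:] * [:0, c, d:] * ?p)\<bar> \<le> \<bar>a * c\<bar> * \<bar>moment_eval N (monom 1 2 * ?p)\<bar>
      + (\<bar>a * d + b * c\<bar> * \<bar>moment_eval N (monom 1 3 * ?p)\<bar> + \<bar>b * d\<bar> * \<bar>moment_eval N (monom 1 4 * ?p)\<bar>)"
    unfolding p2 moment_eval_add moment_eval_smult abs_mult[symmetric]
    by (rule order_trans[OF abs_triangle_ineq add_left_mono[OF abs_triangle_ineq]])
  also have "\<dots> \<le> (u * v) * (16 * ?k ^ 2) + ((2 * real R * (u * v)) * (96 * ?k ^ 3) + ((real R)\<^sup>2 * (u * v)) * (768 * ?k ^ 4))"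
    using ac adbc bd u0 L2 L3 L4 by (intro add_mono mult_mono) auto
  also have "\<dots> = ?k ^ 2 * (u * v) * (16 + 192 * (real R * ?k) + 768 * (real R * ?k) ^ 2)"
    by (simp add: eval_nat_numeral algebra_simps)
  also have "\<dots> \<le> ?k ^ 2 * (u * v) * 17"
  proof (rule mult_left_mono)
    have "(real R * ?k) ^ 2 \<le> (1 / 390) ^ 2" using Rk by (intro power_mono) auto
    then show "16 + 192 * (real R * ?k) + 768 * (real R * ?k) ^ 2 \<le> 17" using Rk by (simp add: power2_eq_square)
  qed (use u0 in auto)
  finally show "\<bar>moment_eval N ([:0, a, b:] * [:0, c, d:] * ?p)\<bar> \<le> 17 / (real K)\<^sup>2 * (u * v)" by (simp add: power_divide mult_ac)
qed

text \<open>A merge along \<open>e\<close> changes the weight polynomial by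
  \<open>lin_part X + quad_part X^2\<close> times the product of the factors of all paths not ending
  in \<open>e\<close>. For two inside paths of weights \<open>u\<close>, \<open>v\<close> this is
  \<open>1 - (u + v + 1) X = (1 - u X) (1 - v X) - X - u v X^2\<close>; for an inside path of weight
  \<open>v\<close> absorbed by a leaving one it is \<open>1 = (1 - v X) + v X\<close>.\<close>

definition lin_part :: "nat set \<Rightarrow> (nat \<Rightarrow> nat) \<Rightarrow> (nat \<Rightarrow> nat) \<Rightarrow> nat set \<Rightarrow> real" where
  "lin_part A \<rho> w e = (if \<rho> ` e \<subseteq> A then - 1 else (\<Sum>a\<in>e \<inter> internal_ends A \<rho>. real (w a)))"

definition quad_part :: "nat set \<Rightarrow> (nat \<Rightarrow> nat) \<Rightarrow> (nat \<Rightarrow> nat) \<Rightarrow> nat set \<Rightarrow> real" where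
  "quad_part A \<rho> w e = (if \<rho> ` e \<subseteq> A then - (\<Prod>a\<in>e. real (w a)) else 0)"

context gadget
begin

definition merged_poly :: "nat set \<Rightarrow> nat set \<Rightarrow> real poly" where
  "merged_poly e T = weight_poly (merge_weight e \<rho> w) (reps (A - e) (merge_partner e \<rho>) - T)"

lemma merged_poly_expand:
  assumes e: "e \<in> allowed A \<rho>" and T: "T \<inter> (e \<union> \<rho> ` e) = {}"
  shows "merged_poly e T = weight_poly w (reps A \<rho> - T) + [:0, lin_part A \<rho> w e, quad_part A \<rho> w e:] * weight_poly w (reps A \<rho> - T - (e \<union> \<rho> ` e))"
proof -
  obtain a b where ab: "e = {a, b}" "a \<in> A" "b \<in> A" "a \<noteq> b" "b \<noteq> \<rho> a" "\<rho> b \<in> A" using e by (rule allowE)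
  have T': "T \<inter> {a, b, \<rho> a, \<rho> b} = {}" using T ab(1) by auto
  have S: "reps A \<rho> - T - (e \<union> \<rho> ` e) = reps A \<rho> - T - {a, b, \<rho> a, \<rho> b}" using ab(1) by auto
  let ?q = "weight_poly w (reps A \<rho> - T - {a, b, \<rho> a, \<rho> b})"
  have m: "merged_poly e T = (if \<rho> a \<in> A then [:1, - real (w a + w b + 1):] else 1) * ?q"
    unfolding merged_poly_def ab(1) by (rule weight_poly_merged[OF ab(2-6) T'])
  have s: "weight_poly w (reps A \<rho> - T) = (if \<rho> a \<in> A then [:1, - real (w a):] * [:1, - real (w b):]
             else [:1, - real (w b):]) * ?q"
    using reps_split[OF ab(2-6) T'] by blast
  show ?thesis
  proof (cases "\<rho> a \<in> A")
    case True
    have "lin_part A \<rho> w e = - 1" "quad_part A \<rho> w e = - (real (w a) * real (w b))" using True ab by (auto simp: lin_part_def quad_part_def)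
    moreover have "[:1, - real (w a + w b + 1):] = [:1, - real (w a):] * [:1, - real (w b):] + [:0, - 1, - (real (w a) * real (w b)):]"
      by simp
    ultimately show ?thesis unfolding m s S using True by (simp only: if_True distrib_right)
  next
    case False
    have "e \<inter> internal_ends A \<rho> = {b}" using False ab by (auto simp: internal_ends_def)
    then have "lin_part A \<rho> w e = real (w b)" "quad_part A \<rho> w e = 0" using False ab by (auto simp: lin_part_def quad_part_def)
    moreover have "1 = [:1, - real (w b):] + [:0, real (w b), 0:]" by (simp add: one_pCons)
    ultimately show ?thesis unfolding m s S using False by (simp only: if_False distrib_right[symmetric])
  qed
qed

text \<open>The edges concern different paths, hence different factors, so the changes they cause
  combine by inclusion and exclusion. The first three terms form the additive part of
  \<open>quad_form_lower\<close>; only the product of both changes, divisible by \<open>X^2\<close>,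
  needs an estimate.\<close>

lemma merged_poly_far:
  assumes e: "e \<in> allowed A \<rho>" and f: "f \<in> allowed A \<rho>" and far: "e \<inter> f = {}" "\<rho> ` e \<inter> f = {}"
  shows "gadget.merged_poly (A - e) (merge_partner e \<rho>) (merge_weight e \<rho> w) f {} = merged_poly e {} + merged_poly f {} - weight_poly w (reps A \<rho>)
     + [:0, lin_part A \<rho> w e, quad_part A \<rho> w e:] * [:0, lin_part A \<rho> w f, quad_part A \<rho> w f:]
        * weight_poly w (reps A \<rho> - (f \<union> \<rho> ` f) - (e \<union> \<rho> ` e))"
proof -
  interpret m: gadget "A - e" "merge_partner e \<rho>" "merge_weight e \<rho> w" by (rule allowed_merged_gadget[OF e])
  have f': "f \<in> allowed (A - e) (merge_partner e \<rho>)" by (rule compat_far'[OF e f far])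
  obtain a b where ab: "e = {a, b}" using e by (elim allowE) auto
  have e': "{a, b} \<in> allowed A \<rho>" using e ab by simp
  have on: "merge_partner e \<rho> c = \<rho> c" "merge_weight e \<rho> w c = w c" "\<rho> c \<notin> e" if "c \<in> f" for c
  proof -
    have c: "c \<notin> {\<rho> a, \<rho> b}" "c \<in> A" using that far allowed_sub[OF f] unfolding ab by auto
    then show "merge_partner e \<rho> c = \<rho> c" "merge_weight e \<rho> w c = w c" unfolding ab merge_partner_allowed[OF e'] by auto
    show "\<rho> c \<notin> e" using c pairD(1,2)[OF e'] rho_flip unfolding ab by auto
  qed
  have im: "merge_partner e \<rho> ` f = \<rho> ` f" using on by auto
  have sub: "merge_partner e \<rho> ` f \<subseteq> A - e \<longleftrightarrow> \<rho> ` f \<subseteq> A" unfolding im using on by blast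
  have internal_ends: "f \<inter> internal_ends (A - e) (merge_partner e \<rho>) = f \<inter> internal_ends A \<rho>"
    using on far by (auto simp: internal_ends_def)
  have lin_part: "lin_part (A - e) (merge_partner e \<rho>) (merge_weight e \<rho> w) f = lin_part A \<rho> w f"
    unfolding lin_part_def sub internal_ends using on by (auto intro!: sum.cong)
  have quad_part: "quad_part (A - e) (merge_partner e \<rho>) (merge_weight e \<rho> w) f = quad_part A \<rho> w f"
    unfolding quad_part_def sub using on by (auto intro!: prod.cong)
  have "\<rho> x \<noteq> \<rho> y" if "x \<in> f" "y \<in> e" for x y
  proof -
    have "x \<in> A" "y \<in> A" "x \<noteq> y" using that far(1) allowed_sub[OF e] allowed_sub[OF f] by auto
    then show ?thesis using rho_inj by simp
  qed
  then have disj: "(f \<union> \<rho> ` f) \<inter> (e \<union> \<rho> ` e) = {}"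
    using far on(3) by fast
  have "m.merged_poly f {} = merged_poly e {} + [:0, lin_part A \<rho> w f, quad_part A \<rho> w f:] * merged_poly e (f \<union> \<rho> ` f)"
    using m.merged_poly_expand[OF f', of "{}"] unfolding lin_part quad_part im merged_poly_def by simp
  also have "merged_poly e (f \<union> \<rho> ` f) = weight_poly w (reps A \<rho> - (f \<union> \<rho> ` f)) + [:0, lin_part A \<rho> w e, quad_part A \<rho> w e:] * weight_poly w (reps A \<rho> - (f \<union> \<rho> ` f) - (e \<union> \<rho> ` e))"
    by (rule merged_poly_expand[OF e disj])
  also have "merged_poly f {} = weight_poly w (reps A \<rho>) + [:0, lin_part A \<rho> w f, quad_part A \<rho> w f:] * weight_poly w (reps A \<rho> - (f \<union> \<rho> ` f))"
    using merged_poly_expand[OF f, of "{}"] by simp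
  ultimately show ?thesis by (simp only: distrib_left mult.assoc mult.left_commute[of "[:0, lin_part A \<rho> w f, quad_part A \<rho> w f:]"])
qed

end

section \<open>Positive semidefiniteness\<close>

text \<open>\<open>R\<close> bounds the total weight, which grows by at most one per merge.
  \<open>R + 3\<close> leaves room for the two merges of a second moment, and the absolute bound
  absorbs additive constants in the estimates.\<close>

locale rich_gadget = gadget +
  fixes R :: nat
  assumes weight_le: "(\<Sum>j\<in>reps A \<rho>. w j) \<le> R"
    and few: "400 * (R + 3) \<le> card (reps A \<rho>)"
    and large: "1000000 \<le> card (reps A \<rho>)"
begin

abbreviation "M \<equiv> card (reps A \<rho>)"
abbreviation "E \<equiv> allowed A \<rho>"
abbreviation "\<phi> \<equiv> edge_value A \<rho> w"

lemma merged_card: "e \<in> E \<Longrightarrow> card (reps (A - e) (merge_partner e \<rho>)) = M - 1"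
proof (elim allowE)
  fix a b assume ab: "e = {a, b}" "a \<in> A" "b \<in> A" "a \<noteq> b" "b \<noteq> \<rho> a" "\<rho> b \<in> A"
  then show ?thesis using card_reps_merged[OF ab(2-6)] by simp
qed

lemma merged_weight: "e \<in> E \<Longrightarrow> (\<Sum>j\<in>reps (A - e) (merge_partner e \<rho>). merge_weight e \<rho> w j) \<le> R + 1"
proof (elim allowE)
  fix a b assume ab: "e = {a, b}" "a \<in> A" "b \<in> A" "a \<noteq> b" "b \<noteq> \<rho> a" "\<rho> b \<in> A"
  then show ?thesis using merged_weight_le[OF ab(2-6)] weight_le by simp
qed

lemma val_near: "\<bar>state_value A \<rho> w - 1\<bar> \<le> 1 / 100"
  unfolding state_value_def using weight_le few by (intro moment_eval_weight_poly_near_1[where R = R]) auto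

lemma val_pos: "99 / 100 \<le> state_value A \<rho> w" "state_value A \<rho> w \<le> 101 / 100" "state_value A \<rho> w \<noteq> 0" "0 < state_value A \<rho> w"
  using val_near by linarith+

lemma val_near_merged: "e \<in> E \<Longrightarrow> \<bar>state_value (A - e) (merge_partner e \<rho>) (merge_weight e \<rho> w) - 1\<bar> \<le> 1 / 100"
  unfolding state_value_def using merged_weight[of e] merged_card[of e] few finA
  by (intro moment_eval_weight_poly_near_1[where R = "R + 1"]) (auto simp: reps_def)

lemma val_merged_pos: "e \<in> E \<Longrightarrow> state_value (A - e) (merge_partner e \<rho>) (merge_weight e \<rho> w) \<noteq> 0"
  using val_near_merged[of e] by linarith

lemma val_near2:
  assumes e: "e \<in> E" and f: "f \<in> allowed (A - e) (merge_partner e \<rho>)"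
  shows "\<bar>merged_value e f - 1\<bar> \<le> 1 / 100"
proof -
  interpret m: gadget "A - e" "merge_partner e \<rho>" "merge_weight e \<rho> w" by (rule allowed_merged_gadget[OF e])
  obtain a b where ab: "f = {a, b}" "a \<in> A - e" "b \<in> A - e" "a \<noteq> b" "b \<noteq> merge_partner e \<rho> a" "merge_partner e \<rho> b \<in> A - e"
    using f by (rule m.allowE)
  have "card (reps (A - e - f) (merge_partner f (merge_partner e \<rho>))) = M - 2"
    using m.card_reps_merged[OF ab(2-6)] merged_card[OF e] ab(1) by simp
  moreover have "(\<Sum>j\<in>reps (A - e - f) (merge_partner f (merge_partner e \<rho>)). merge_weight f (merge_partner e \<rho>) (merge_weight e \<rho> w) j) \<le> R + 2"
    using m.merged_weight_le[OF ab(2-6)] merged_weight[OF e] ab(1) by simp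
  ultimately show ?thesis
    unfolding merged_value_def state_value_def using few finA by (intro moment_eval_weight_poly_near_1[where R = "R + 2"]) (auto simp: reps_def)
qed

text \<open>State values are within one percent of 1, so an allowed edge has value close to
  \<open>1 / (2 * M)\<close>; the quotient of \<open>99 / 100\<close> by
  \<open>2 * (101 / 100)\<close> still exceeds \<open>49 / 100\<close>.\<close>

lemma edge_value_ge: "e \<in> E \<Longrightarrow> 49 / (100 * real M) \<le> \<phi> e"
proof -
  assume e: "e \<in> E"
  have v: "99 / 100 \<le> state_value (A - e) (merge_partner e \<rho>) (merge_weight e \<rho> w)" using val_near_merged[OF e] by linarith
  have M0: "0 < real M" using large by linarith
  have "49 / (100 * real M) = (49 * 101 / 5000) / (2 * real M * (101 / 100))" using M0 by (simp add: field_simps)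
  also have "\<dots> \<le> (99 / 100) / (2 * real M * (101 / 100))"
    using M0 by (intro divide_right_mono) auto
  also have "\<dots> \<le> state_value (A - e) (merge_partner e \<rho>) (merge_weight e \<rho> w) / (2 * real M * state_value A \<rho> w)"
    using M0 v val_pos by (intro frac_le mult_left_mono mult_pos_pos) auto
  finally show ?thesis using e by (simp add: edge_value_def)
qed

lemma edge_value_nonneg: "0 \<le> \<phi> e"
  using edge_value_ge[of e] edge_value_nonallow[of e] by (cases "e \<in> E") (auto intro: order_trans[rotated])

lemma edge_value_star1: "a \<in> A \<Longrightarrow> (\<Sum>e\<in>star a. \<phi> e) = 1"
  using weight_le few val_pos by (intro edge_value_star) auto

lemma pair_value_sym: "pair_value e f = pair_value f e"
proof -
  have half: "pair_value e f = pair_value f e" if e: "e \<in> E" "f \<in> allowed (A - e) (merge_partner e \<rho>)" for e f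
    using merge_sym[OF e] e pair_value_eq[OF e(1) val_merged_pos[OF e(1)], of f]
      pair_value_eq[of f e] val_merged_pos[of f] by simp
  have zero: "pair_value e f = 0" if "\<not> (e \<in> E \<and> f \<in> allowed (A - e) (merge_partner e \<rho>))" for e f
    using that edge_value_nonallow[of e] by (auto simp: pair_value_def edge_value_def)
  show ?thesis
    using half[of e f] half[of f e] zero[of e f] zero[of f e] by metis
qed

text \<open>The star is that of the original gadget. After the merge no new edges become allowed,
  and those no longer allowed have value 0, so this is the degree equation of the merged
  gadget.\<close>

lemma edge_value_merged_star:
  assumes e: "e \<in> E" and a: "a \<in> A - e"
  shows "(\<Sum>f\<in>star a. edge_value (A - e) (merge_partner e \<rho>) (merge_weight e \<rho> w) f) = 1"
proof -
  interpret m: gadget "A - e" "merge_partner e \<rho>" "merge_weight e \<rho> w" by (rule allowed_merged_gadget[OF e])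
  have "(\<Sum>f\<in>star a. edge_value (A - e) (merge_partner e \<rho>) (merge_weight e \<rho> w) f) = (\<Sum>f\<in>m.star a. edge_value (A - e) (merge_partner e \<rho>) (merge_weight e \<rho> w) f)"
  proof (rule sum.mono_neutral_right)
    show "m.star a \<subseteq> star a" using merge_sym(1)[OF e] by (auto simp: star_def m.star_def)
    show "\<forall>i\<in>star a - m.star a. edge_value (A - e) (merge_partner e \<rho>) (merge_weight e \<rho> w) i = 0"
      by (auto simp: star_def m.star_def edge_value_def)
  qed (simp add: star_def)
  also have "\<dots> = 1"
    using a merged_weight[OF e] merged_card[OF e] few val_merged_pos[OF e] by (intro m.edge_value_star) auto
  finally show ?thesis .
qed

section \<open>Second moments\<close>

text \<open>On the diagonal \<open>pair_value\<close> vanishes, as the vertices of a merged edge are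
  gone; the first summand supplies the second moment of a 0-1 quantity.\<close>

definition B :: "nat set \<Rightarrow> nat set \<Rightarrow> real" where
  "B e f = (if e = f then \<phi> e else 0) + pair_value e f"

lemma B_sym: "B e f = B f e"
  using pair_value_sym[of e f] by (auto simp: B_def)

text \<open>The degree equation at \<open>a\<close> survives conditioning on \<open>e\<close>: if
  \<open>a \<in> e\<close>, then \<open>e\<close> itself is the one chosen edge at \<open>a\<close>;
  otherwise \<open>a\<close> keeps degree 1 in the merged gadget.\<close>

lemma B_star:
  assumes e: "e \<in> E" and a: "a \<in> A"
  shows "(\<Sum>f\<in>star a. B e f) = \<phi> e"
proof -
  have fs: "finite (star a)" by (simp add: star_def)
  interpret m: gadget "A - e" "merge_partner e \<rho>" "merge_weight e \<rho> w" by (rule allowed_merged_gadget[OF e])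
  have "(\<Sum>f\<in>star a. B e f) = (if e \<in> star a then \<phi> e else 0) + \<phi> e * (\<Sum>f\<in>star a. edge_value (A - e) (merge_partner e \<rho>) (merge_weight e \<rho> w) f)"
    using fs by (simp add: B_def sum.distrib pair_value_def sum_distrib_left sum.delta)
  also have "\<dots> = \<phi> e"
  proof (cases "a \<in> e")
    case True
    have "edge_value (A - e) (merge_partner e \<rho>) (merge_weight e \<rho> w) f = 0" if "f \<in> star a" for f
      using that True m.allowed_sub[of f] by (auto simp: star_def edge_value_def)
    then show ?thesis using True e by (simp add: star_def)
  next
    case False
    then show ?thesis using edge_value_merged_star[OF e, of a] a by (simp add: star_def)
  qed
  finally show ?thesis .
qed

lemma star_card: "a \<in> A \<Longrightarrow> card (star a) \<le> card A"
proof -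
  assume a: "a \<in> A"
  have "card (star a) = (\<Sum>e\<in>star a. (1::real))" by simp
  also have "\<dots> = (\<Sum>b | b \<in> A \<and> {a, b} \<in> E. (1::real))" by (rule sum_star[OF a])
  also have "\<dots> \<le> card A" by (simp add: card_mono)
  finally show ?thesis by simp
qed

lemma sum_over_ends: "(\<Sum>e\<in>E. \<Sum>a\<in>e. g e a) = (\<Sum>a\<in>A. \<Sum>e\<in>star a. g e a)" for g :: "nat set \<Rightarrow> nat \<Rightarrow> real"
proof -
  have "(\<Sum>e\<in>E. \<Sum>a\<in>e. g e a) = (\<Sum>e\<in>E. \<Sum>a\<in>{a\<in>A. a \<in> e}. g e a)"
    by (intro sum.cong refl) (use allowed_sub in auto)
  also have "\<dots> = (\<Sum>a\<in>A. \<Sum>e\<in>{e\<in>E. a \<in> e}. g e a)"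
    by (rule sum.swap_restrict) auto
  finally show ?thesis by (simp add: star_def)
qed

text \<open>A common measure for the change caused by a merge. It becomes the vector
  \<open>u\<close> of the rank-one error in \<open>quad_form_lower\<close>.\<close>

definition edge_weight :: "nat set \<Rightarrow> real" where
  "edge_weight e = 1 + (\<Sum>a\<in>e \<inter> internal_ends A \<rho>. real (w a))"

lemma w_le_R: "a \<in> internal_ends A \<rho> \<Longrightarrow> w a \<le> R"
proof -
  assume a: "a \<in> internal_ends A \<rho>"
  then obtain r where r: "r \<in> reps A \<rho>" "w r = w a" using rep_cases[of a] by (auto simp: internal_ends_def)
  have "w r \<le> (\<Sum>j\<in>reps A \<rho>. w j)" using r(1) by (intro member_le_sum) auto
  then show ?thesis using r(2) weight_le by simp
qed

lemma lin_part_be_le: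
  assumes e: "e \<in> E"
  shows "\<bar>lin_part A \<rho> w e\<bar> \<le> edge_weight e" "\<bar>quad_part A \<rho> w e\<bar> \<le> real R * edge_weight e" "0 \<le> edge_weight e"
proof -
  have s0: "0 \<le> (\<Sum>a\<in>e \<inter> internal_ends A \<rho>. real (w a))" by (simp add: sum_nonneg)
  then show "\<bar>lin_part A \<rho> w e\<bar> \<le> edge_weight e" "0 \<le> edge_weight e" by (auto simp: lin_part_def edge_weight_def)
  show "\<bar>quad_part A \<rho> w e\<bar> \<le> real R * edge_weight e"
  proof (cases "\<rho> ` e \<subseteq> A")
    case False
    then show ?thesis using s0 by (simp add: quad_part_def edge_weight_def)
  next
    case True
    obtain a b where ab: "e = {a, b}" "a \<in> A" "b \<in> A" "a \<noteq> b" using e by (elim allowE) auto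
    have internal_ends: "a \<in> internal_ends A \<rho>" "b \<in> internal_ends A \<rho>" using True ab by (auto simp: internal_ends_def)
    then have "edge_weight e = 1 + (real (w a) + real (w b))" using ab by (simp add: edge_weight_def)
    moreover have "real (w a) * real (w b) \<le> real R * (1 + (real (w a) + real (w b)))"
      using w_le_R[OF internal_ends(1)] by (intro mult_mono) auto
    ultimately show ?thesis using True ab by (simp add: quad_part_def)
  qed
qed

text \<open>Uses \<open>(1 + u + v)^2 \<le> 3 * (1 + u^2 + v^2)\<close> and, as no weight exceeds
  \<open>R\<close>, that the squares of the weights sum to at most \<open>R^2\<close>. Each weight
  occurs at both ends of its path, whence the factor 2.\<close>

lemma sum_edge_weight_sq: "(\<Sum>e\<in>E. (edge_weight e)\<^sup>2) \<le> 3 * ((real (card A))\<^sup>2 + real (card A) * (2 * (real R)\<^sup>2))"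
proof -
  define v where "v a = (if a \<in> internal_ends A \<rho> then real (w a) else 0)" for a
  have u: "(edge_weight e)\<^sup>2 \<le> 3 * (1 + (\<Sum>a\<in>e. (v a)\<^sup>2))" if e: "e \<in> E" for e
  proof -
    obtain a b where ab: "e = {a, b}" "a \<noteq> b" using e by (elim allowE) auto
    have "(\<Sum>a\<in>e \<inter> internal_ends A \<rho>. real (w a)) = (\<Sum>a\<in>e. v a)"
      using ab by (auto simp: v_def sum.inter_restrict[symmetric] intro!: sum.mono_neutral_cong_left)
    then have eq: "edge_weight e = 1 + (v a + v b)" using ab by (simp add: edge_weight_def)
    have "(1 + (v a + v b))\<^sup>2 \<le> 3 * (1 + ((v a)\<^sup>2 + (v b)\<^sup>2))"
      using sum_squares_ge_zero[of "1 - v a" "1 - v b"] zero_le_square[of "v a - v b"]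
      by (simp add: power2_eq_square algebra_simps)
    moreover have "(\<Sum>a\<in>e. (v a)\<^sup>2) = (v a)\<^sup>2 + (v b)\<^sup>2" using ab by simp
    ultimately show ?thesis unfolding eq by simp
  qed
  have cE: "real (card E) \<le> (real (card A))\<^sup>2"
  proof -
    have "2 * real (card E) = (\<Sum>e\<in>E. \<Sum>a\<in>e. 1)" using allowed_card by simp
    also have "\<dots> = (\<Sum>a\<in>A. real (card (star a)))" by (subst sum_over_ends) simp
    also have "\<dots> \<le> (\<Sum>a\<in>A. real (card A))" by (intro sum_mono) (use star_card in simp)
    finally show ?thesis by (simp add: power2_eq_square)
  qed
  have v2: "(\<Sum>a\<in>A. (v a)\<^sup>2) \<le> 2 * (real R)\<^sup>2"
  proof -
    have "(\<Sum>a\<in>A. (v a)\<^sup>2) = (\<Sum>a\<in>internal_ends A \<rho>. (real (w a))\<^sup>2)"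
      by (rule sum.mono_neutral_cong_right) (auto simp: v_def internal_ends_def)
    also have "\<dots> = (\<Sum>a\<in>reps A \<rho>. 2 * (real (w a))\<^sup>2)"
      unfolding sum_internal_ends by (rule sum.cong) (auto simp: reps_def w_rho)
    also have "\<dots> \<le> (\<Sum>a\<in>reps A \<rho>. 2 * (real R * real (w a)))"
    proof (intro sum_mono)
      fix a assume "a \<in> reps A \<rho>"
      then have "w a \<le> R" by (intro w_le_R) (auto simp: reps_def internal_ends_def)
      then show "2 * (real (w a))\<^sup>2 \<le> 2 * (real R * real (w a))" by (simp add: power2_eq_square mult_right_mono)
    qed
    also have "\<dots> = 2 * real R * real (\<Sum>a\<in>reps A \<rho>. w a)" by (simp add: sum_distrib_left mult.assoc)
    also have "\<dots> \<le> 2 * real R * real R" using of_nat_mono[OF weight_le] by (intro mult_left_mono) auto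
    finally show ?thesis by (simp add: power2_eq_square)
  qed
  have 1: "(\<Sum>e\<in>E. (edge_weight e)\<^sup>2) \<le> 3 * (real (card E) + (\<Sum>e\<in>E. \<Sum>a\<in>e. (v a)\<^sup>2))"
  proof -
    have "(\<Sum>e\<in>E. (edge_weight e)\<^sup>2) \<le> (\<Sum>e\<in>E. 3 * (1 + (\<Sum>a\<in>e. (v a)\<^sup>2)))" by (intro sum_mono u)
    also have "\<dots> = 3 * (real (card E) + (\<Sum>e\<in>E. \<Sum>a\<in>e. (v a)\<^sup>2))"
      by (simp only: sum_distrib_left[symmetric] sum.distrib) simp
    finally show ?thesis .
  qed
  have "(\<Sum>e\<in>E. \<Sum>a\<in>e. (v a)\<^sup>2) = (\<Sum>a\<in>A. real (card (star a)) * (v a)\<^sup>2)"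
    by (subst sum_over_ends) simp
  also have "\<dots> \<le> (\<Sum>a\<in>A. real (card A) * (v a)\<^sup>2)"
    using star_card by (intro sum_mono mult_right_mono) auto
  also have "\<dots> = real (card A) * (\<Sum>a\<in>A. (v a)\<^sup>2)" by (simp add: sum_distrib_left)
  also have "\<dots> \<le> real (card A) * (2 * (real R)\<^sup>2)" using v2 by (intro mult_left_mono) auto
  finally have "3 * (real (card E) + (\<Sum>e\<in>E. \<Sum>a\<in>e. (v a)\<^sup>2))
      \<le> 3 * ((real (card A))\<^sup>2 + real (card A) * (2 * (real R)\<^sup>2))"
    using cE by (intro mult_left_mono add_mono) auto
  then show ?thesis by (rule order_trans[OF 1])
qed

text \<open>\<open>card (e \<inter> f)\<close> is the Gram matrix of the incidence vectors, so its
  form is the sum of the squared star sums of \<open>z\<close>, which vanish. The indicator of a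
  common vertex differs from it only by 1 on the diagonal, so its form is minus the sum of the
  squares of \<open>z\<close>.\<close>

lemma star_shared:
  assumes z: "\<And>a. a \<in> A \<Longrightarrow> (\<Sum>e\<in>star a. z e) = 0"
  shows "(\<Sum>e\<in>E. z e) = (0::real)"
    and "(\<Sum>e\<in>E. \<Sum>f\<in>E. (if e \<inter> f \<noteq> {} then 1 else 0) * (z e * z f)) \<le> (0::real)"
proof -
  have "2 * (\<Sum>e\<in>E. z e) = (\<Sum>e\<in>E. \<Sum>a\<in>e. z e)" using allowed_card by (simp add: sum_distrib_left)
  also have "\<dots> = 0" unfolding sum_over_ends using z by simp
  finally show "(\<Sum>e\<in>E. z e) = 0" by simp
  have *: "(\<Sum>f\<in>E. real (card (e \<inter> f)) * (z e * z f)) = 0" if e: "e \<in> E" for e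
  proof -
    have "(\<Sum>f\<in>E. real (card (e \<inter> f)) * (z e * z f)) = (\<Sum>f\<in>E. \<Sum>a\<in>f. if a \<in> e then z e * z f else 0)"
    proof (rule sum.cong[OF refl])
      fix f assume "f \<in> E"
      then have "finite f" using allowed_sub finite_subset[OF _ finA] by blast
      then have "(\<Sum>a\<in>f. if a \<in> e then z e * z f else 0) = (\<Sum>a\<in>f \<inter> e. z e * z f)"
        by (rule sum.inter_restrict[symmetric])
      also have "\<dots> = real (card (e \<inter> f)) * (z e * z f)" by (simp only: sum_constant Int_commute)
      finally show "real (card (e \<inter> f)) * (z e * z f) = (\<Sum>a\<in>f. if a \<in> e then z e * z f else 0)" by (rule sym)
    qed
    also have "\<dots> = (\<Sum>a\<in>A. \<Sum>f\<in>star a. if a \<in> e then z e * z f else 0)" by (rule sum_over_ends)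
    also have "\<dots> = (\<Sum>a\<in>A. if a \<in> e then z e * (\<Sum>f\<in>star a. z f) else 0)"
    proof (rule sum.cong[OF refl])
      fix a show "(\<Sum>f\<in>star a. if a \<in> e then z e * z f else 0) = (if a \<in> e then z e * (\<Sum>f\<in>star a. z f) else 0)"
        by (cases "a \<in> e") (simp_all only: if_True if_False sum_distrib_left sum.neutral_const)
    qed
    also have "\<dots> = 0"
    proof (rule sum.neutral, rule ballI)
      fix a assume "a \<in> A"
      then show "(if a \<in> e then z e * (\<Sum>f\<in>star a. z f) else 0) = 0" by (simp only: z mult_zero_right if_cancel)
    qed
    finally show ?thesis .
  qed
  have split: "(if e \<inter> f \<noteq> {} then 1 else 0) = real (card (e \<inter> f)) - (if e = f then 1 else 0)"
    if ef: "e \<in> E" "f \<in> E" for e f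
  proof -
    have fin: "finite e" "finite f" using ef allowed_sub finite_subset finA by blast+
    have c: "card e = 2" "card f = 2" using ef allowed_card by auto
    have "card (e \<inter> f) \<le> 2" using card_mono[of e "e \<inter> f"] fin c by simp
    moreover have "card (e \<inter> f) \<noteq> 2" if "e \<noteq> f"
    proof
      assume "card (e \<inter> f) = 2"
      then have "card (e \<inter> f) = card e" "card (e \<inter> f) = card f" using c by simp_all
      then have "e \<inter> f = e" "e \<inter> f = f"
        using card_subset_eq[OF fin(1) Int_lower1] card_subset_eq[OF fin(2) Int_lower2] by blast+
      then show False using that by blast
    qed
    moreover have "card (e \<inter> f) = 0 \<longleftrightarrow> e \<inter> f = {}" using fin by simp
    ultimately have le: "card (e \<inter> f) \<le> 2" and ne: "e \<noteq> f \<Longrightarrow> card (e \<inter> f) \<noteq> 2"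
      and z: "card (e \<inter> f) = 0 \<longleftrightarrow> e \<inter> f = {}" by blast+
    show ?thesis
    proof (cases "e = f")
      case True
      then have "e \<inter> f \<noteq> {}" "card (e \<inter> f) = 2" using c by auto
      then show ?thesis using True by simp
    next
      case False
      have "card (e \<inter> f) = 1" if "e \<inter> f \<noteq> {}" using le ne[OF False] z that by linarith
      then show ?thesis using False by simp
    qed
  qed
  have "(\<Sum>e\<in>E. \<Sum>f\<in>E. (if e \<inter> f \<noteq> {} then 1 else 0) * (z e * z f))
     = (\<Sum>e\<in>E. \<Sum>f\<in>E. real (card (e \<inter> f)) * (z e * z f) - (if e = f then z e * z f else 0))"
  proof (intro sum.cong refl)
    fix e f assume ef: "e \<in> E" "f \<in> E"
    show "(if e \<inter> f \<noteq> {} then 1 else 0) * (z e * z f) = real (card (e \<inter> f)) * (z e * z f) - (if e = f then z e * z f else 0)"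
      unfolding split[OF ef] by (simp add: left_diff_distrib)
  qed
  also have "\<dots> = (\<Sum>e\<in>E. \<Sum>f\<in>E. real (card (e \<inter> f)) * (z e * z f)) - (\<Sum>e\<in>E. z e * z e)"
    by (simp add: sum_subtractf)
  also have "\<dots> = - (\<Sum>e\<in>E. z e * z e)" using * by simp
  also have "\<dots> \<le> 0" by (simp add: sum_nonneg)
  finally show "(\<Sum>e\<in>E. \<Sum>f\<in>E. (if e \<inter> f \<noteq> {} then 1 else 0) * (z e * z f)) \<le> (0::real)" .
qed

section \<open>Comparison with independent edges\<close>

text \<open>This is \<open>pair_value\<close> without its normalising factor, which is the same for
  all pairs.\<close>

definition Y :: "nat set \<Rightarrow> nat set \<Rightarrow> real" where
  "Y e f = (if f \<in> allowed (A - e) (merge_partner e \<rho>) then merged_value e f else 0)"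

definition KY :: "nat set \<Rightarrow> nat set \<Rightarrow> real" where
  "KY e f = 4 / 100 * real (card (e \<inter> f)) + 4 / 100 * real (card (\<rho> ` e \<inter> f))
     + (if e \<inter> f = {} \<and> f \<notin> allowed (A - e) (merge_partner e \<rho>) then 2 else 0)"

lemma sum_card_inter:
  assumes "S \<subseteq> A" "card S \<le> 2"
  shows "(\<Sum>f\<in>E. real (card (S \<inter> f))) \<le> 2 * real (card A)"
proof -
  have fS: "finite S" using assms finite_subset finA by blast
  have "(\<Sum>f\<in>E. real (card (S \<inter> f))) = (\<Sum>f\<in>E. \<Sum>a\<in>f. if a \<in> S then 1 else 0)"
  proof (rule sum.cong[OF refl])
    fix f assume "f \<in> E"
    then have "finite f" using allowed_sub finite_subset[OF _ finA] by blast
    then have "(\<Sum>a\<in>f. if a \<in> S then 1 else 0) = (\<Sum>a\<in>f \<inter> S. 1::real)"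
      by (rule sum.inter_restrict[symmetric])
    also have "\<dots> = real (card (S \<inter> f))" by (simp only: sum_constant Int_commute mult_1_right)
    finally show "real (card (S \<inter> f)) = (\<Sum>a\<in>f. if a \<in> S then 1 else 0)" by (rule sym)
  qed
  also have "\<dots> = (\<Sum>a\<in>A. \<Sum>f\<in>star a. if a \<in> S then 1 else 0)" by (rule sum_over_ends)
  also have "\<dots> = (\<Sum>a\<in>A. if a \<in> S then real (card (star a)) else 0)"
    by (intro sum.cong refl) simp
  also have "\<dots> \<le> (\<Sum>a\<in>A. if a \<in> S then real (card A) else 0)"
    by (intro sum_mono) (use star_card in auto)
  also have "\<dots> = (\<Sum>a\<in>A \<inter> S. real (card A))" by (rule sum.inter_restrict[symmetric]) simp
  also have "A \<inter> S = S" using assms by blast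
  also have "(\<Sum>a\<in>S. real (card A)) = real (card S) * real (card A)" by simp
  also have "\<dots> \<le> 2 * real (card A)" using assms by (intro mult_right_mono) auto
  finally show ?thesis .
qed

text \<open>Such an \<open>f\<close> lives on at most five vertices, two far ends and three exterior
  ends; 32 is the number of subsets.\<close>

lemma incompatible_count:
  assumes e: "e \<in> E"
  shows "card {f\<in>E. e \<inter> f = {} \<and> f \<notin> allowed (A - e) (merge_partner e \<rho>)} \<le> 32"
proof -
  have fin: "finite e" using allowed_sub[OF e] finite_subset finA by blast
  have fx: "finite (exterior_ends A \<rho>)" by (simp add: exterior_ends_def)
  have "{f\<in>E. e \<inter> f = {} \<and> f \<notin> allowed (A - e) (merge_partner e \<rho>)} \<subseteq> Pow (\<rho> ` e \<union> exterior_ends A \<rho>)"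
    using incompat_near(1)[OF e] by blast
  then have "card {f\<in>E. e \<inter> f = {} \<and> f \<notin> allowed (A - e) (merge_partner e \<rho>)} \<le> card (Pow (\<rho> ` e \<union> exterior_ends A \<rho>))"
    using fin fx by (intro card_mono) auto
  also have "\<dots> = 2 ^ card (\<rho> ` e \<union> exterior_ends A \<rho>)" using fin fx by (simp add: card_Pow)
  also have "\<dots> \<le> 2 ^ 5"
  proof (rule power_increasing)
    have "card (\<rho> ` e \<union> exterior_ends A \<rho>) \<le> card (\<rho> ` e) + card (exterior_ends A \<rho>)" by (rule card_Un_le)
    also have "\<dots> \<le> 2 + 3" using card_image_le[OF fin, of \<rho>] allowed_card[OF e] card_ext by simp
    finally show "card (\<rho> ` e \<union> exterior_ends A \<rho>) \<le> 5" by simp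
  qed simp
  finally show ?thesis by simp
qed

lemma KY_row: "e \<in> E \<Longrightarrow> (\<Sum>f\<in>E. KY e f) \<le> 16 / 100 * real (card A) + 64"
proof -
  assume e: "e \<in> E"
  have fin: "finite e" using allowed_sub[OF e] finite_subset finA by blast
  have 1: "(\<Sum>f\<in>E. real (card (e \<inter> f))) \<le> 2 * real (card A)"
    using allowed_sub[OF e] allowed_card[OF e] by (intro sum_card_inter) auto
  have "(\<Sum>f\<in>E. real (card (\<rho> ` e \<inter> f))) = (\<Sum>f\<in>E. real (card ((\<rho> ` e \<inter> A) \<inter> f)))"
  proof (rule sum.cong[OF refl])
    fix f assume "f \<in> E"
    then have "\<rho> ` e \<inter> f = (\<rho> ` e \<inter> A) \<inter> f" using allowed_sub by blast
    then show "real (card (\<rho> ` e \<inter> f)) = real (card ((\<rho> ` e \<inter> A) \<inter> f))" by simp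
  qed
  also have "\<dots> \<le> 2 * real (card A)"
  proof (rule sum_card_inter)
    have "card (\<rho> ` e \<inter> A) \<le> card (\<rho> ` e)" using fin by (intro card_mono) auto
    then show "card (\<rho> ` e \<inter> A) \<le> 2" using card_image_le[OF fin, of \<rho>] allowed_card[OF e] by simp
  qed auto
  finally have 2: "(\<Sum>f\<in>E. real (card (\<rho> ` e \<inter> f))) \<le> 2 * real (card A)" .
  have 3: "(\<Sum>f\<in>E. (if e \<inter> f = {} \<and> f \<notin> allowed (A - e) (merge_partner e \<rho>) then 2 else 0))
     = 2 * real (card {f\<in>E. e \<inter> f = {} \<and> f \<notin> allowed (A - e) (merge_partner e \<rho>)})"
  proof -
    have "(\<Sum>f\<in>E. (if e \<inter> f = {} \<and> f \<notin> allowed (A - e) (merge_partner e \<rho>) then 2 else 0))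
       = (\<Sum>f\<in>{f\<in>E. e \<inter> f = {} \<and> f \<notin> allowed (A - e) (merge_partner e \<rho>)}. 2 :: real)"
      by (rule sum.inter_filter[symmetric]) simp
    then show ?thesis by simp
  qed
  show ?thesis
    unfolding KY_def sum.distrib 3 sum_distrib_left[symmetric]
    using 1 2 incompatible_count[OF e] by linarith
qed

lemma KY_sym:
  assumes "e \<in> E" "f \<in> E"
  shows "KY e f = KY f e"
proof -
  have "card (\<rho> ` e \<inter> f) = card (\<rho> ` f \<inter> e)"
  proof (rule bij_betw_same_card[of \<rho>])
    have eA: "x \<in> A" if "x \<in> e \<or> x \<in> f" for x using that allowed_sub assms by blast
    show "bij_betw \<rho> (\<rho> ` e \<inter> f) (\<rho> ` f \<inter> e)"
      by (rule bij_betw_byWitness[where f' = \<rho>]) (use eA rho_rho in auto)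
  qed
  moreover have "(e \<inter> f = {} \<and> f \<notin> allowed (A - e) (merge_partner e \<rho>)) = (f \<inter> e = {} \<and> e \<notin> allowed (A - f) (merge_partner f \<rho>))"
    using incompat_near(4) assms by blast
  ultimately show ?thesis by (simp add: KY_def Int_commute)
qed

text \<open>If the edges share a vertex, \<open>Y\<close> is 0 while the additive part is about 1,
  and the indicator makes up the difference. If \<open>f\<close> contains a far end of
  \<open>e\<close>, the kernel \<open>KY\<close> pays for the error. In the remaining case
  \<open>merged_poly_far\<close> leaves only the product of two changes, of order
  \<open>1 / M^2\<close>.\<close>

lemma Y_bound:
  assumes e: "e \<in> E" and f: "f \<in> E"
  shows "\<bar>Y e f - (moment_eval (M - 2) (merged_poly e {}) + moment_eval (M - 2) (merged_poly f {}) - moment_eval (M - 2) (weight_poly w (reps A \<rho>)))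
     + (if e \<inter> f \<noteq> {} then 1 else 0)\<bar> \<le> KY e f + 18 / (real M)\<^sup>2 * (edge_weight e * edge_weight f)"
proof -
  let ?L = "\<lambda>p. moment_eval (M - 2) p" and ?P = "weight_poly w (reps A \<rho>)"
  let ?a = "?L (merged_poly e {}) + ?L (merged_poly f {}) - ?L ?P"
  interpret m: gadget "A - e" "merge_partner e \<rho>" "merge_weight e \<rho> w" by (rule allowed_merged_gadget[OF e])
  have LLm: "\<bar>?L (merged_poly g {}) - 1\<bar> \<le> 1 / 100" if "g \<in> E" for g
    unfolding merged_poly_def Diff_empty using merged_weight[OF that] few
    by (intro moment_eval_weight_poly_near_1[where R = "R + 1"]) (auto simp: reps_def)
  have LLP: "\<bar>?L ?P - 1\<bar> \<le> 1 / 100"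
    using weight_le few by (intro moment_eval_weight_poly_near_1[where R = R]) auto
  have a: "\<bar>?a - 1\<bar> \<le> 3 / 100" using LLm[OF e] LLm[OF f] LLP by linarith
  have u0: "0 \<le> 18 / (real M)\<^sup>2 * (edge_weight e * edge_weight f)" using lin_part_be_le(3)[OF e] lin_part_be_le(3)[OF f] by simp
  have fin: "finite e" "finite f" using allowed_sub[OF e] allowed_sub[OF f] finite_subset finA by blast+
  have K0: "0 \<le> KY e f" by (simp add: KY_def)
  consider (share) "e \<inter> f \<noteq> {}" | (far) "e \<inter> f = {}" "\<rho> ` e \<inter> f = {}"
    | (near) "e \<inter> f = {}" "\<rho> ` e \<inter> f \<noteq> {}" by blast
  then show ?thesis
  proof cases
    case share
    then have "f \<notin> allowed (A - e) (merge_partner e \<rho>)" using m.allowed_sub[of f] by blast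
    then have "Y e f = 0" by (simp add: Y_def)
    moreover have "1 \<le> card (e \<inter> f)" using share fin by (simp add: Suc_le_eq card_gt_0_iff)
    then have "4 / 100 \<le> KY e f" by (simp add: KY_def)
    ultimately have "\<bar>Y e f - ?a + 1\<bar> \<le> KY e f + 18 / (real M)\<^sup>2 * (edge_weight e * edge_weight f)" using a u0 by linarith
    then show ?thesis using share by (simp only: if_True simp_thms)
  next
    case near
    then have "1 \<le> card (\<rho> ` e \<inter> f)" using fin by (simp add: Suc_le_eq card_gt_0_iff)
    then have K: "4 / 100 + (if f \<notin> allowed (A - e) (merge_partner e \<rho>) then 2 else 0) \<le> KY e f" using near by (simp add: KY_def)
    show ?thesis
    proof (cases "f \<in> allowed (A - e) (merge_partner e \<rho>)")
      case True
      then have "\<bar>Y e f - 1\<bar> \<le> 1 / 100" using val_near2[OF e] by (simp add: Y_def)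
      moreover have "4 / 100 \<le> KY e f" using K True by simp
      ultimately have "\<bar>Y e f - ?a + 0\<bar> \<le> KY e f + 18 / (real M)\<^sup>2 * (edge_weight e * edge_weight f)" using a u0 by linarith
      then show ?thesis using near(1) by (simp only: if_False simp_thms)
    next
      case False
      then have "Y e f = 0" by (simp add: Y_def)
      moreover have "2 \<le> KY e f" using K False by simp
      ultimately have "\<bar>Y e f - ?a + 0\<bar> \<le> KY e f + 18 / (real M)\<^sup>2 * (edge_weight e * edge_weight f)" using a u0 by linarith
      then show ?thesis using near(1) by (simp only: if_False simp_thms)
    qed
  next
    case far
    have f': "f \<in> allowed (A - e) (merge_partner e \<rho>)" by (rule compat_far'[OF e f far])
    obtain a b where ab: "f = {a, b}" "a \<in> A - e" "b \<in> A - e" "a \<noteq> b" "b \<noteq> merge_partner e \<rho> a" "merge_partner e \<rho> b \<in> A - e"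
      using f' by (rule m.allowE)
    have card2: "card (reps (A - e - f) (merge_partner f (merge_partner e \<rho>))) = M - 2"
      using m.card_reps_merged[OF ab(2-6)] merged_card[OF e] ab(1) by simp
    have "Y e f = ?L (m.merged_poly f {})" using f' by (simp add: Y_def merged_value_def state_value_def m.merged_poly_def card2)
    also have "\<dots> = ?a + ?L ([:0, lin_part A \<rho> w e, quad_part A \<rho> w e:] * [:0, lin_part A \<rho> w f, quad_part A \<rho> w f:]
        * weight_poly w (reps A \<rho> - (f \<union> \<rho> ` f) - (e \<union> \<rho> ` e)))"
      unfolding merged_poly_far[OF e f far] moment_eval_add moment_eval_diff ..
    finally have eq: "Y e f - ?a = ?L ([:0, lin_part A \<rho> w e, quad_part A \<rho> w e:] * [:0, lin_part A \<rho> w f, quad_part A \<rho> w f:]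
        * weight_poly w (reps A \<rho> - (f \<union> \<rho> ` f) - (e \<union> \<rho> ` e)))" by simp
    \<comment> \<open>Moments are taken at \<open>M - 2\<close>, and
      \<open>moment_eval_low_weight_poly_le\<close> demands another \<open>R + 4\<close> below
      that.\<close>
    define K where "K = M - R - 6"
    have "(\<Sum>j\<in>reps A \<rho> - (f \<union> \<rho> ` f) - (e \<union> \<rho> ` e). w j) \<le> (\<Sum>j\<in>reps A \<rho>. w j)"
      by (intro sum_mono2) auto
    then have "\<bar>Y e f - ?a\<bar> \<le> 17 / (real K)\<^sup>2 * (edge_weight e * edge_weight f)"
      unfolding eq using weight_le few large lin_part_be_le[OF e] lin_part_be_le[OF f]
      by (intro moment_eval_low_weight_poly_le(2)[where R = R]) (auto simp: K_def)
    also have "\<dots> \<le> 18 / (real M)\<^sup>2 * (edge_weight e * edge_weight f)"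
    proof (rule mult_right_mono)
      have K: "real K \<ge> 99 / 100 * real M" using few large by (simp add: K_def)
      have M0: "0 < real M" using large by linarith
      have "17 / (real K)\<^sup>2 \<le> 17 / (99 / 100 * real M)\<^sup>2"
        using K M0 by (intro divide_left_mono power_mono mult_pos_pos zero_less_power) auto
      also have "\<dots> = (170000 / 9801) / (real M)\<^sup>2" by (simp add: power2_eq_square)
      also have "\<dots> \<le> 18 / (real M)\<^sup>2" by (intro divide_right_mono) auto
      finally show "17 / (real K)\<^sup>2 \<le> 18 / (real M)\<^sup>2" .
    qed (use lin_part_be_le(3)[OF e] lin_part_be_le(3)[OF f] in simp)
    finally have "\<bar>Y e f - ?a + 0\<bar> \<le> KY e f + 18 / (real M)\<^sup>2 * (edge_weight e * edge_weight f)" using K0 by linarith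
    then show ?thesis using far(1) by (simp only: if_False simp_thms)
  qed
qed

text \<open>The value without the change caused by \<open>e\<close> is the same constant for all
  edges; the change itself is divisible by \<open>X\<close> and gains a factor of order
  \<open>1 / M\<close>. On vectors with sum zero the constant disappears, so the mean is negligible
  there.\<close>

lemma edge_value_deviation:
  assumes e: "e \<in> E"
  shows "\<bar>\<phi> e - moment_eval (M - 1) (weight_poly w (reps A \<rho>)) / (2 * real M * state_value A \<rho> w)\<bar> \<le> 3 / (real M)\<^sup>2 * edge_weight e"
proof -
  define K where "K = M - R - 6"
  let ?h = "[:0, lin_part A \<rho> w e, quad_part A \<rho> w e:] * weight_poly w (reps A \<rho> - (e \<union> \<rho> ` e))"
  have "\<phi> e = moment_eval (M - 1) (merged_poly e {}) / (2 * real M * state_value A \<rho> w)"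
    using e by (simp add: edge_value_def state_value_def merged_poly_def merged_card)
  also have "merged_poly e {} = weight_poly w (reps A \<rho>) + ?h"
    using merged_poly_expand[OF e, of "{}"] by simp
  finally have eq: "\<phi> e - moment_eval (M - 1) (weight_poly w (reps A \<rho>)) / (2 * real M * state_value A \<rho> w)
     = moment_eval (M - 1) ?h / (2 * real M * state_value A \<rho> w)"
    by (simp add: moment_eval_add add_divide_distrib del: mult_pCons_left)
  have "(\<Sum>j\<in>reps A \<rho> - (e \<union> \<rho> ` e). w j) \<le> (\<Sum>j\<in>reps A \<rho>. w j)"
    by (intro sum_mono2) auto
  then have h: "\<bar>moment_eval (M - 1) ?h\<bar> \<le> 5 / real K * edge_weight e"
    using weight_le few large lin_part_be_le[OF e]
    by (intro moment_eval_low_weight_poly_le(1)[where R = R]) (auto simp: K_def)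
  have K: "real K \<ge> 99 / 100 * real M" using few large by (simp add: K_def)
  have M0: "0 < real M" using large by linarith
  have "\<bar>moment_eval (M - 1) ?h / (2 * real M * state_value A \<rho> w)\<bar> = \<bar>moment_eval (M - 1) ?h\<bar> / (2 * real M * state_value A \<rho> w)"
    using M0 val_pos by (simp add: abs_mult)
  also have "\<dots> \<le> (5 / real K * edge_weight e) / (2 * real M * (99 / 100))"
    using h M0 val_pos lin_part_be_le(3)[OF e] by (intro frac_le mult_left_mono mult_pos_pos) auto
  also have "\<dots> \<le> (5 / (99 / 100 * real M) * edge_weight e) / (2 * real M * (99 / 100))"
    using K M0 lin_part_be_le(3)[OF e] by (intro divide_right_mono mult_right_mono divide_left_mono mult_pos_pos) auto
  also have "\<dots> = (5 / (2 * (99 / 100) * (99 / 100))) / (real M)\<^sup>2 * edge_weight e" using M0 by (simp add: power2_eq_square)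
  also have "\<dots> \<le> 3 / (real M)\<^sup>2 * edge_weight e"
    using lin_part_be_le(3)[OF e] by (intro mult_right_mono divide_right_mono) auto
  finally show ?thesis unfolding eq .
qed

text \<open>Let \<open>Z\<close> be the sum of squares of \<open>z\<close>. The diagonal contributes
  at least \<open>49 / (100 * m) * Z\<close>, the second moments of distinct edges at least
  \<open>- 1 / (6 * m) * Z\<close>, and the squared mean is at most
  \<open>1 / (100 * m) * Z\<close>. The first dominates the other two.\<close>

lemma covariance_star_null:
  assumes z: "\<And>a. a \<in> A \<Longrightarrow> (\<Sum>e\<in>star a. z e) = 0"
  shows "(\<Sum>e\<in>E. \<phi> e * z e)\<^sup>2 \<le> (\<Sum>e\<in>E. \<Sum>f\<in>E. B e f * (z e * z f))"
proof -
  define Z where "Z = (\<Sum>e\<in>E. (z e)\<^sup>2)"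
  define U where "U = (\<Sum>e\<in>E. (edge_weight e)\<^sup>2)"
  define m where "m = real M"
  have Z0: "0 \<le> Z" unfolding Z_def by (simp add: sum_nonneg)
  have m6: "1000000 \<le> m" using large by (simp add: m_def)
  have cA: "real (card A) = 2 * m + 3" using card_A by (simp add: m_def)
  have U: "U \<le> 13 * m\<^sup>2 + m ^ 3 / 10000"
  proof -
    have "400 * real R \<le> m" using few by (simp add: m_def)
    then have "(real R)\<^sup>2 \<le> (m / 400)\<^sup>2" by (intro power_mono) auto
    then have R2: "2 * (real R)\<^sup>2 \<le> m\<^sup>2 / 80000" by (simp add: power_divide)
    have A1: "2 * m + 3 \<le> 201 / 100 * m" using m6 by simp
    have "U \<le> 3 * ((2 * m + 3)\<^sup>2 + (2 * m + 3) * (2 * (real R)\<^sup>2))"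
      using sum_edge_weight_sq unfolding U_def cA .
    also have "\<dots> \<le> 3 * ((201 / 100 * m)\<^sup>2 + (201 / 100 * m) * (m\<^sup>2 / 80000))"
      using A1 R2 m6 by (intro mult_left_mono add_mono power_mono mult_mono) auto
    also have "\<dots> = 121203 / 10000 * m\<^sup>2 + 603 / 8000000 * m ^ 3" by (simp add: power2_eq_square power3_eq_cube)
    also have "\<dots> \<le> 13 * m\<^sup>2 + m ^ 3 / 10000"
    proof -
      have "0 \<le> m\<^sup>2" "0 \<le> m ^ 3" using m6 by auto
      then show ?thesis by linarith
    qed
    finally show ?thesis .
  qed
  define T where "T = (\<Sum>e\<in>E. \<Sum>f\<in>E. Y e f * (z e * z f))"
  have T: "- (1 / 2 * m * Z) \<le> T"
  proof -
    have "- ((16 / 100 * real (card A) + 64 + 18 / (real M)\<^sup>2 * U) * Z) \<le> T"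
      unfolding Z_def U_def T_def
    proof (rule quad_form_lower[where K = KY and S = "\<lambda>e f. if e \<inter> f \<noteq> {} then 1 else 0"
            and \<alpha> = "\<lambda>e. moment_eval (M - 2) (merged_poly e {})" and c = "moment_eval (M - 2) (weight_poly w (reps A \<rho>))"])
      show "(\<Sum>e\<in>E. KY e f) \<le> 16 / 100 * real (card A) + 64" if "f \<in> E" for f
      proof -
        have "(\<Sum>e\<in>E. KY e f) = (\<Sum>e\<in>E. KY f e)" by (rule sum.cong[OF refl]) (rule KY_sym[OF _ that])
        then show ?thesis using KY_row[OF that] by simp
      qed
      show "0 \<le> KY e f" for e f by (simp add: KY_def)
      show "(\<Sum>e\<in>E. z e) = 0" by (rule star_shared(1)) (rule z)
      show "(\<Sum>e\<in>E. \<Sum>f\<in>E. (if e \<inter> f \<noteq> {} then 1 else 0) * (z e * z f)) \<le> 0"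
        by (rule star_shared(2)) (rule z)
    qed (use Y_bound KY_row in simp_all)
    moreover
    have "16 / 100 * real (card A) + 64 + 18 / (real M)\<^sup>2 * U \<le> 1 / 2 * m"
    proof -
      have "18 / m\<^sup>2 * U \<le> 18 / m\<^sup>2 * (13 * m\<^sup>2 + m ^ 3 / 10000)" using U by (intro mult_left_mono) auto
      also have "\<dots> = 234 + 18 / 10000 * m" using m6 by (simp add: field_simps power2_eq_square power3_eq_cube)
      finally have "18 / m\<^sup>2 * U \<le> 234 + 18 / 10000 * m" .
      moreover have "16 / 100 * (2 * m + 3) + 64 + x \<le> 1 / 2 * m" if "x \<le> 234 + 18 / 10000 * m" for x
        using that m6 by (simp add: field_simps)
      ultimately show ?thesis unfolding cA m_def[symmetric] by blast
    qed
    then have "(16 / 100 * real (card A) + 64 + 18 / (real M)\<^sup>2 * U) * Z \<le> 1 / 2 * m * Z"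
      using Z0 by (rule mult_right_mono)
    ultimately show ?thesis by linarith
  qed
  define \<kappa> where "\<kappa> = 1 / (2 * m * (2 * real (M - 1)) * state_value A \<rho> w)"
  have M1: "real (M - 1) = m - 1" using large by (simp add: m_def of_nat_diff)
  have \<kappa>: "0 \<le> \<kappa>" "\<kappa> \<le> 1 / (3 * m\<^sup>2)"
  proof -
    have p: "3 * m\<^sup>2 \<le> 2 * m * (2 * (m - 1)) * state_value A \<rho> w"
    proof -
      have "3 * m\<^sup>2 \<le> 2 * m * (2 * (m - 1)) * (99 / 100)" using m6 by (simp add: power2_eq_square algebra_simps)
      also have "\<dots> \<le> 2 * m * (2 * (m - 1)) * state_value A \<rho> w" using m6 val_pos by (intro mult_left_mono) auto
      finally show ?thesis .
    qed
    have "0 < 3 * m\<^sup>2" using m6 by simp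
    then show "\<kappa> \<le> 1 / (3 * m\<^sup>2)" unfolding \<kappa>_def M1 using p m6 val_pos by (intro divide_left_mono mult_pos_pos) auto
    show "0 \<le> \<kappa>" unfolding \<kappa>_def M1 using m6 val_pos by simp
  qed
  have f2: "pair_value e f = \<kappa> * Y e f" if "e \<in> E" for e f
    using pair_value_eq[OF that val_merged_pos[OF that], of f] by (simp add: Y_def \<kappa>_def m_def)
  have "(\<Sum>e\<in>E. \<Sum>f\<in>E. B e f * (z e * z f)) = (\<Sum>e\<in>E. \<Sum>f\<in>E. (if e = f then \<phi> e * (z e * z f) else 0) + \<kappa> * (Y e f * (z e * z f)))"
    by (intro sum.cong refl) (auto simp: B_def f2 algebra_simps)
  also have "\<dots> = (\<Sum>e\<in>E. \<phi> e * (z e * z e)) + \<kappa> * T"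
    by (simp add: sum.distrib T_def sum_distrib_left)
  finally have eq: "(\<Sum>e\<in>E. \<Sum>f\<in>E. B e f * (z e * z f)) = (\<Sum>e\<in>E. \<phi> e * (z e * z e)) + \<kappa> * T" .
  have d: "49 / (100 * m) * Z \<le> (\<Sum>e\<in>E. \<phi> e * (z e * z e))"
    unfolding Z_def sum_distrib_left
  proof (intro sum_mono)
    fix e assume "e \<in> E"
    then have "49 / (100 * m) * (z e * z e) \<le> \<phi> e * (z e * z e)"
      using edge_value_ge[of e] by (intro mult_right_mono) (auto simp: m_def)
    then show "49 / (100 * m) * (z e)\<^sup>2 \<le> \<phi> e * (z e * z e)" by (simp only: power2_eq_square)
  qed
  have kT: "- (1 / (6 * m) * Z) \<le> \<kappa> * T"
  proof -
    have "\<kappa> * (1 / 2 * m * Z) \<le> 1 / (3 * m\<^sup>2) * (1 / 2 * m * Z)"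
      using \<kappa> m6 Z0 by (intro mult_right_mono) auto
    also have "\<dots> = 1 / (6 * m) * Z" using m6 by (simp add: power2_eq_square)
    finally have "\<kappa> * (1 / 2 * m * Z) \<le> 1 / (6 * m) * Z" .
    moreover have "\<kappa> * - (1 / 2 * m * Z) \<le> \<kappa> * T" using T \<kappa> by (intro mult_left_mono) auto
    ultimately show ?thesis by simp
  qed
  have s: "(\<Sum>e\<in>E. \<phi> e * z e)\<^sup>2 \<le> 1 / (100 * m) * Z"
  proof -
    define c where "c = moment_eval (M - 1) (weight_poly w (reps A \<rho>)) / (2 * real M * state_value A \<rho> w)"
    have "(\<Sum>e\<in>E. \<phi> e * z e) = (\<Sum>e\<in>E. (\<phi> e - c) * z e)"
      using star_shared(1)[OF z] by (simp add: left_diff_distrib sum_subtractf sum_distrib_left[symmetric])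
    then have "(\<Sum>e\<in>E. \<phi> e * z e)\<^sup>2 \<le> (\<Sum>e\<in>E. (\<phi> e - c)\<^sup>2) * Z"
      unfolding Z_def by (simp only: square_sum_le)
    also have "\<dots> \<le> (9 / m ^ 4 * U) * Z"
    proof (rule mult_right_mono[OF _ Z0])
      have "(\<Sum>e\<in>E. (\<phi> e - c)\<^sup>2) \<le> (\<Sum>e\<in>E. (3 / m\<^sup>2 * edge_weight e)\<^sup>2)"
      proof (intro sum_mono)
        fix e assume "e \<in> E"
        then have "\<bar>\<phi> e - c\<bar> \<le> 3 / m\<^sup>2 * edge_weight e" using edge_value_deviation[of e] by (simp add: c_def m_def)
        then show "(\<phi> e - c)\<^sup>2 \<le> (3 / m\<^sup>2 * edge_weight e)\<^sup>2" using power_mono[of "\<bar>\<phi> e - c\<bar>" _ 2] by simp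
      qed
      then show "(\<Sum>e\<in>E. (\<phi> e - c)\<^sup>2) \<le> 9 / m ^ 4 * U"
        by (simp add: U_def sum_distrib_left power_mult_distrib power_divide)
    qed
    also have "\<dots> \<le> (1 / (100 * m)) * Z"
    proof (rule mult_right_mono[OF _ Z0])
      have "9 / m ^ 4 * U \<le> 9 / m ^ 4 * (13 * m\<^sup>2 + m ^ 3 / 10000)" using U m6 by (intro mult_left_mono) auto
      also have "\<dots> = (117 / m + 9 / 10000) * (1 / m)"
        using m6 by (simp add: eval_nat_numeral field_simps)
      also have "\<dots> \<le> (1 / 100) * (1 / m)"
      proof (rule mult_right_mono)
        have "117 / m \<le> 117 / 1000000" using m6 by (intro divide_left_mono) auto
        then show "117 / m + 9 / 10000 \<le> 1 / 100" by linarith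
      qed (use m6 in auto)
      finally show "9 / m ^ 4 * U \<le> 1 / (100 * m)" by simp
    qed
    finally show ?thesis .
  qed
  have "1 / (100 * m) * Z + 1 / (6 * m) * Z \<le> 49 / (100 * m) * Z"
  proof -
    have "1 / (100 * m) + 1 / (6 * m) \<le> 49 / (100 * m)" using m6 by (simp add: field_simps)
    then show ?thesis using Z0 by (metis distrib_right mult_right_mono)
  qed
  then show ?thesis unfolding eq using d kT s by linarith
qed

text \<open>By the degree equations and \<open>B_star\<close> the covariance matrix maps the
  indicator of every star to 0. Hence its form does not change if \<open>z\<close> is replaced by
  its component orthogonal to all stars, to which \<open>covariance_star_null\<close>
  applies.\<close>

theorem covariance_psd:
  fixes z :: "nat set \<Rightarrow> real"
  shows "(\<Sum>e\<in>E. \<phi> e * z e)\<^sup>2 \<le> (\<Sum>e\<in>E. \<Sum>f\<in>E. B e f * (z e * z f))"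
proof -
  define k where "k a e = (if a \<in> e then 1 else 0 :: real)" for a and e :: "nat set"
  have kst: "(\<Sum>e\<in>E. g e * k a e) = (\<Sum>e\<in>star a. g e)" for g a
  proof -
    have "(\<Sum>e\<in>E. g e * k a e) = (\<Sum>e\<in>E. if a \<in> e then g e else 0)"
      by (rule sum.cong) (auto simp: k_def)
    also have "\<dots> = (\<Sum>e\<in>star a. g e)" unfolding star_def by (rule sum.inter_filter[symmetric]) simp
    finally show ?thesis .
  qed
  obtain y where y: "\<forall>a\<in>A. (\<Sum>e\<in>E. (z e - (\<Sum>b\<in>A. y b * k b e)) * k a e) = 0"
    using orthogonal_decomposition[of E A z k] by auto
  define z' where "z' e = z e - (\<Sum>b\<in>A. y b * k b e)" for e
  define C where "C e f = B e f - \<phi> e * \<phi> f" for e f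
  have C1: "(\<Sum>f\<in>E. C e f * k a f) = 0" if "e \<in> E" "a \<in> A" for e a
    unfolding kst C_def sum_subtractf sum_distrib_left[symmetric] using B_star that edge_value_star1 by simp
  have C2: "C e f = C f e" for e f using B_sym[of e f] by (simp add: C_def)
  have shift: "(\<Sum>f\<in>E. C e f * z' f) = (\<Sum>f\<in>E. C e f * z f)" if e: "e \<in> E" for e
  proof -
    have "(\<Sum>f\<in>E. C e f * z' f) = (\<Sum>f\<in>E. C e f * z f) - (\<Sum>f\<in>E. \<Sum>b\<in>A. y b * (C e f * k b f))"
      by (simp add: z'_def right_diff_distrib sum_subtractf sum_distrib_left mult_ac)
    also have "(\<Sum>f\<in>E. \<Sum>b\<in>A. y b * (C e f * k b f)) = (\<Sum>b\<in>A. y b * (\<Sum>f\<in>E. C e f * k b f))"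
      by (subst sum.swap) (simp add: sum_distrib_left)
    also have "\<dots> = 0" using C1[OF e] by simp
    finally show ?thesis by simp
  qed
  have form: "(\<Sum>e\<in>E. \<Sum>f\<in>E. C e f * (g e * h f)) = (\<Sum>e\<in>E. g e * (\<Sum>f\<in>E. C e f * h f))" for g h
    by (simp add: sum_distrib_left mult_ac)
  have form2: "(\<Sum>e\<in>E. g e * (\<Sum>f\<in>E. C e f * h f)) = (\<Sum>e\<in>E. h e * (\<Sum>f\<in>E. C e f * g f))" for g h
  proof -
    have "(\<Sum>e\<in>E. g e * (\<Sum>f\<in>E. C e f * h f)) = (\<Sum>e\<in>E. \<Sum>f\<in>E. C e f * (g e * h f))" by (rule form[symmetric])
    also have "\<dots> = (\<Sum>f\<in>E. \<Sum>e\<in>E. C e f * (g e * h f))" by (rule sum.swap)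
    also have "\<dots> = (\<Sum>f\<in>E. \<Sum>e\<in>E. C f e * (h f * g e))" using C2 by (simp add: mult_ac)
    also have "\<dots> = (\<Sum>e\<in>E. h e * (\<Sum>f\<in>E. C e f * g f))" by (rule form)
    finally show ?thesis .
  qed
  have "(\<Sum>e\<in>E. \<Sum>f\<in>E. C e f * (z e * z f)) = (\<Sum>e\<in>E. z e * (\<Sum>f\<in>E. C e f * z' f))"
    unfolding form using shift by simp
  also have "\<dots> = (\<Sum>e\<in>E. z' e * (\<Sum>f\<in>E. C e f * z' f))"
    unfolding form2[of z z'] using shift by simp
  finally have eq: "(\<Sum>e\<in>E. \<Sum>f\<in>E. C e f * (z e * z f)) = (\<Sum>e\<in>E. \<Sum>f\<in>E. C e f * (z' e * z' f))"
    unfolding form .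
  have expand: "(\<Sum>e\<in>E. \<Sum>f\<in>E. C e f * (g e * g f)) = (\<Sum>e\<in>E. \<Sum>f\<in>E. B e f * (g e * g f)) - (\<Sum>e\<in>E. \<phi> e * g e)\<^sup>2" for g
  proof -
    have "(\<Sum>e\<in>E. \<Sum>f\<in>E. \<phi> e * \<phi> f * (g e * g f)) = (\<Sum>e\<in>E. \<phi> e * g e)\<^sup>2"
      by (simp add: power2_eq_square sum_product mult_ac)
    then show ?thesis by (simp add: C_def left_diff_distrib sum_subtractf)
  qed
  have "0 \<le> (\<Sum>e\<in>E. \<Sum>f\<in>E. C e f * (z' e * z' f))"
    unfolding expand using covariance_star_null[of z'] y by (simp add: kst z'_def)
  then show ?thesis using eq expand[of z] by simp
qed

end

section \<open>Cuts and the Lovasz--Schrijver operator\<close>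

definition convex_functions :: "('i \<Rightarrow> real) set \<Rightarrow> bool" where
  "convex_functions R \<longleftrightarrow> (\<forall>x\<in>R. \<forall>y\<in>R. \<forall>u. 0 \<le> u \<and> u \<le> 1 \<longrightarrow> (\<lambda>i. u * x i + (1 - u) * y i) \<in> R)"

lemma cvxD: "convex_functions R \<Longrightarrow> x \<in> R \<Longrightarrow> y \<in> R \<Longrightarrow> 0 \<le> u \<Longrightarrow> u \<le> 1 \<Longrightarrow> (\<lambda>i. u * x i + (1 - u) * y i) \<in> R"
  by (simp add: convex_functions_def)

lemma convex_functions_unit_cube: "convex_functions (I \<rightarrow>\<^sub>E {0..1::real})"
  unfolding convex_functions_def
proof (intro ballI allI impI, elim conjE)
  fix x y :: "'a \<Rightarrow> real" and u :: real
  assume x: "x \<in> I \<rightarrow>\<^sub>E {0..1}" and y: "y \<in> I \<rightarrow>\<^sub>E {0..1}" and u: "0 \<le> u" "u \<le> 1"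
  show "(\<lambda>i. u * x i + (1 - u) * y i) \<in> I \<rightarrow>\<^sub>E {0..1}"
  proof (rule PiE_I)
    fix i assume "i \<in> I"
    then have xy: "0 \<le> x i" "x i \<le> 1" "0 \<le> y i" "y i \<le> 1" using PiE_mem[OF x] PiE_mem[OF y] by simp_all
    have "u * x i + (1 - u) * y i \<le> u * 1 + (1 - u) * 1"
      using u xy by (intro add_mono mult_left_mono) simp_all
    moreover have "0 \<le> u * x i + (1 - u) * y i" using u xy by simp
    ultimately show "u * x i + (1 - u) * y i \<in> {0..1}" by simp
  next
    fix i assume "i \<notin> I"
    then have "x i = undefined" "y i = undefined" using PiE_arb[OF x] PiE_arb[OF y] by blast+
    then show "u * x i + (1 - u) * y i = undefined" by (simp add: algebra_simps)
  qed
qed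

lemma cone_overE:
  assumes "y \<in> cone_over I R"
  obtains l x where "0 \<le> l" "x \<in> R" "y None = l" "\<forall>i\<in>I. y (Some i) = l * x i"
proof -
  have "\<exists>l\<ge>0. \<exists>x\<in>R. y None = l \<and> (\<forall>i\<in>I. y (Some i) = l * x i)"
    using assms unfolding cone_over_def by (rule CollectD)
  then show ?thesis by (elim exE conjE bexE) (rule that)
qed

lemma cone_cong:
  assumes "\<And>j. j \<in> hom_index I \<Longrightarrow> y j = y' j" "y \<in> cone_over I R"
  shows "y' \<in> cone_over I R"
proof -
  obtain l x where x: "0 \<le> l" "x \<in> R" "y None = l" "\<forall>i\<in>I. y (Some i) = l * x i"
    using assms(2) by (rule cone_overE)
  have "y' None = l" "\<forall>i\<in>I. y' (Some i) = l * x i"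
    using x assms(1) by (auto simp: hom_index_def)
  then show ?thesis unfolding cone_over_def using x(1,2) by (intro CollectI exI[of _ l] conjI bexI[of _ x]) auto
qed

lemma cone_scale:
  assumes "x \<in> R" "0 \<le> l" "y None = l" "\<And>i. i \<in> I \<Longrightarrow> y (Some i) = l * x i"
  shows "y \<in> cone_over I R"
  unfolding cone_over_def using assms by (intro CollectI exI[of _ l] conjI bexI[of _ x]) auto

text \<open>The sum of multiples \<open>l\<close> and \<open>k\<close> of two points is the multiple
  \<open>l + k\<close> of a convex combination of them.\<close>

lemma cone_add:
  assumes R: "convex_functions R" and y: "y \<in> cone_over I R" and z: "z \<in> cone_over I R"
  shows "(\<lambda>j. y j + z j) \<in> cone_over I R"
proof -
  obtain l x where x: "0 \<le> l" "x \<in> R" "y None = l" "\<forall>i\<in>I. y (Some i) = l * x i"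
    using y by (rule cone_overE)
  obtain k v where v: "0 \<le> k" "v \<in> R" "z None = k" "\<forall>i\<in>I. z (Some i) = k * v i"
    using z by (rule cone_overE)
  show ?thesis
  proof (cases "l + k = 0")
    case True
    then have "l = 0" "k = 0" using x(1) v(1) by auto
    then show ?thesis using x v by (intro cone_scale[of x R 0]) auto
  next
    case False
    then have lk: "0 < l + k" using x(1) v(1) by simp
    have "(\<lambda>i. l / (l + k) * x i + (1 - l / (l + k)) * v i) \<in> R"
      using lk x v by (intro cvxD[OF R]) auto
    then show ?thesis
    proof (rule cone_scale[where l = "l + k"])
      fix i assume "i \<in> I"
      have "(1 - l / (l + k)) = k / (l + k)" using False by (simp add: field_simps)
      then show "y (Some i) + z (Some i) = (l + k) * (l / (l + k) * x i + (1 - l / (l + k)) * v i)"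
        using x(4) v(4) \<open>i \<in> I\<close> False by (simp add: distrib_left)
    qed (use lk x v in auto)
  qed
qed

lemma cone_mult:
  assumes y: "y \<in> cone_over I R" and c: "0 \<le> c"
  shows "(\<lambda>j. c * y j) \<in> cone_over I R"
proof -
  obtain l x where x: "0 \<le> l" "x \<in> R" "y None = l" "\<forall>i\<in>I. y (Some i) = l * x i"
    using y by (rule cone_overE)
  then show ?thesis using c by (intro cone_scale[of x R "c * l"]) auto
qed

lemma cone_sum:
  assumes R: "convex_functions R" "R \<noteq> {}" and "finite F" and "\<And>f. f \<in> F \<Longrightarrow> y f \<in> cone_over I R"
  shows "(\<lambda>j. \<Sum>f\<in>F. y f j) \<in> cone_over I R"
  using assms(3,4)
proof (induction F rule: finite_induct)
  case empty
  obtain x where "x \<in> R" using R by blast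
  then show ?case by (intro cone_scale[of x R 0]) auto
next
  case (insert f F)
  then show ?case using cone_add[OF R(1), of "y f" I "\<lambda>j. \<Sum>f\<in>F. y f j"] by simp
qed

text \<open>The certifying matrices are averaged as well. Convexity of all iterates is what allows
  rows of a moment matrix to be added within the cone.\<close>

lemma convex_functions_N_plus:
  assumes R: "convex_functions R"
  shows "convex_functions (N_plus I R)"
  unfolding convex_functions_def
proof (intro ballI allI impI, elim conjE)
  fix x y u assume x: "x \<in> N_plus I R" and y: "y \<in> N_plus I R" and u: "0 \<le> (u::real)" "u \<le> 1"
  let ?H = "hom_index I" and ?z = "\<lambda>i. u * x i + (1 - u) * y i"
  obtain X where X: "symmetric_on ?H X" "psd_on ?H X" "X None None = 1"
     "\<forall>i\<in>I. X None (Some i) = x i \<and> X (Some i) (Some i) = x i"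
     "\<forall>i\<in>I. X (Some i) \<in> cone_over I R \<and> (\<lambda>j. X None j - X (Some i) j) \<in> cone_over I R"
    using x unfolding N_plus_def by blast
  obtain Y where Y: "symmetric_on ?H Y" "psd_on ?H Y" "Y None None = 1"
     "\<forall>i\<in>I. Y None (Some i) = y i \<and> Y (Some i) (Some i) = y i"
     "\<forall>i\<in>I. Y (Some i) \<in> cone_over I R \<and> (\<lambda>j. Y None j - Y (Some i) j) \<in> cone_over I R"
    using y unfolding N_plus_def by blast
  define Z where "Z i j = u * X i j + (1 - u) * Y i j" for i j
  have cube: "?z \<in> I \<rightarrow>\<^sub>E {0..1}"
    by (rule cvxD[OF convex_functions_unit_cube]) (use x y u in \<open>simp_all add: N_plus_def\<close>)
  have sym: "symmetric_on ?H Z" using X(1) Y(1) by (simp add: symmetric_on_def Z_def)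
  have psd: "psd_on ?H Z"
    unfolding psd_on_def
  proof
    fix a
    have "(\<Sum>i\<in>?H. \<Sum>j\<in>?H. a i * Z i j * a j)
        = u * (\<Sum>i\<in>?H. \<Sum>j\<in>?H. a i * X i j * a j) + (1 - u) * (\<Sum>i\<in>?H. \<Sum>j\<in>?H. a i * Y i j * a j)"
      unfolding sum_distrib_left sum.distrib[symmetric] Z_def by (intro sum.cong refl) (simp add: algebra_simps)
    then show "0 \<le> (\<Sum>i\<in>?H. \<Sum>j\<in>?H. a i * Z i j * a j)"
      using X(2) Y(2) u by (simp add: psd_on_def)
  qed
  have rows: "Z (Some i) \<in> cone_over I R \<and> (\<lambda>j. Z None j - Z (Some i) j) \<in> cone_over I R" if i: "i \<in> I" for i
  proof
    have "(\<lambda>j. u * X (Some i) j + (1 - u) * Y (Some i) j) \<in> cone_over I R"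
      using X(5) Y(5) i u by (intro cone_add[OF R] cone_mult) auto
    then show "Z (Some i) \<in> cone_over I R" by (rule cone_cong[rotated]) (simp add: Z_def)
    have "(\<lambda>j. u * (X None j - X (Some i) j) + (1 - u) * (Y None j - Y (Some i) j)) \<in> cone_over I R"
      using X(5) Y(5) i u by (intro cone_add[OF R] cone_mult) auto
    then show "(\<lambda>j. Z None j - Z (Some i) j) \<in> cone_over I R"
      by (rule cone_cong[rotated]) (simp add: Z_def algebra_simps)
  qed
  show "?z \<in> N_plus I R"
    unfolding N_plus_def using cube sym psd rows X(3,4) Y(3,4)
    by (intro CollectI conjI exI[of _ Z]) (auto simp: Z_def)
qed

lemma convex_functions_SP: "convex_functions (SP V E s t)"
  unfolding convex_functions_def
proof (intro ballI allI impI, elim conjE)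
  fix x y u assume x: "x \<in> SP V E s t" and y: "y \<in> SP V E s t" and u: "0 \<le> (u::real)" "u \<le> 1"
  let ?z = "\<lambda>i. u * x i + (1 - u) * y i"
  have cube: "?z \<in> E \<rightarrow>\<^sub>E {0..1}"
    by (rule cvxD[OF convex_functions_unit_cube]) (use x y u in \<open>simp_all add: SP_def\<close>)
  have sum: "sum ?z F = u * sum x F + (1 - u) * sum y F" for F
    by (simp add: sum.distrib sum_distrib_left)
  have ge: "c \<le> sum ?z F" if "c \<le> sum x F" "c \<le> sum y F" for c F
  proof -
    have "u * c + (1 - u) * c \<le> u * sum x F + (1 - u) * sum y F"
      using that u by (intro add_mono mult_left_mono) auto
    then show ?thesis unfolding sum by (simp add: algebra_simps)
  qed
  have eq: "sum ?z F = c" if "sum x F = c" "sum y F = c" for c F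
    unfolding sum using that by (simp add: algebra_simps)
  show "?z \<in> SP V E s t"
    using x y cube ge eq unfolding SP_def by simp
qed

lemma convex_functions_N_plus_power: "convex_functions R \<Longrightarrow> convex_functions ((N_plus I ^^ r) R)"
  by (induction r) (auto simp: convex_functions_N_plus)

section \<open>Cuts within one gadget\<close>

context rich_gadget
begin

definition cut_weight :: "nat set \<Rightarrow> real" where
  "cut_weight S = (\<Sum>e | e \<in> E \<and> card (e \<inter> S) = 1. \<phi> e)"

lemma card_complement_inter:
  assumes "e \<in> E"
  shows "card (e \<inter> (A - S)) = 1 \<longleftrightarrow> card (e \<inter> S) = 1"
proof -
  have fin: "finite e" using allowed_sub[OF assms] finite_subset[OF _ finA] by blast
  have "e = (e \<inter> S) \<union> (e \<inter> (A - S))" "(e \<inter> S) \<inter> (e \<inter> (A - S)) = {}" using allowed_sub[OF assms] by auto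
  then have "card e = card (e \<inter> S) + card (e \<inter> (A - S))" using fin by (metis card_Un_disjoint finite_Int)
  then show ?thesis using allowed_card[OF assms] by auto
qed

lemma cut_weight_complement: "cut_weight (A - S) = cut_weight S"
  unfolding cut_weight_def by (rule sum.cong) (use card_complement_inter in auto)

lemma cut_weight_count:
  assumes S: "S \<subseteq> A" and P: "P \<subseteq> S \<times> (A - S)" and lin_part: "\<And>b c. (b, c) \<in> P \<Longrightarrow> {b, c} \<in> E"
  shows "real (card P) * (49 / (100 * real M)) \<le> cut_weight S"
proof -
  have inj: "inj_on (\<lambda>(b, c). {b, c}) P"
  proof (rule inj_onI, clarify)
    fix b c b' c' assume "(b, c) \<in> P" "(b', c') \<in> P" "{b, c} = {b', c'}"
    then show "b = b' \<and> c = c'" using P by (auto simp: doubleton_eq_iff)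
  qed
  have "(\<lambda>(b, c). {b, c}) ` P \<subseteq> {e. e \<in> E \<and> card (e \<inter> S) = 1}"
  proof clarify
    fix b c assume bc: "(b, c) \<in> P"
    then have "{b, c} \<inter> S = {b}" using P by auto
    then show "{b, c} \<in> E \<and> card ({b, c} \<inter> S) = 1" using lin_part[OF bc] by simp
  qed
  then have "(\<Sum>e\<in>(\<lambda>(b, c). {b, c}) ` P. \<phi> e) \<le> cut_weight S"
    unfolding cut_weight_def by (intro sum_mono2) (auto simp: edge_value_nonneg)
  moreover have "(\<Sum>e\<in>(\<lambda>(b, c). {b, c}) ` P. 49 / (100 * real M)) \<le> (\<Sum>e\<in>(\<lambda>(b, c). {b, c}) ` P. \<phi> e)"
    using lin_part by (intro sum_mono edge_value_ge) auto
  ultimately show ?thesis using inj by (simp add: card_image)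
qed

lemma cut_weight_singleton: "a \<in> A \<Longrightarrow> cut_weight {a} = 1"
proof -
  assume a: "a \<in> A"
  have "{e. e \<in> E \<and> card (e \<inter> {a}) = 1} = star a"
    unfolding star_def by (auto simp: Int_insert_right split: if_splits)
  then show ?thesis using edge_value_star1[OF a] by (simp add: cut_weight_def)
qed

text \<open>Counts the allowed pairs across the cut: each vertex of \<open>S\<close> misses at most
  \<open>k\<close> vertices of the other side, and every allowed edge has value at least
  \<open>49 / (100 * M)\<close>.\<close>

lemma cut_weight_lower:
  assumes S: "S \<subseteq> A" and k: "\<And>b. b \<in> S \<Longrightarrow> card {c \<in> A - S. {b, c} \<notin> E} \<le> k"
  shows "real (card S) * (real (card (A - S)) - real k) * (49 / (100 * real M)) \<le> cut_weight S"
proof -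
  have fS: "finite S" using S finite_subset[OF _ finA] by blast
  define P where "P = Sigma S (\<lambda>b. {c \<in> A - S. {b, c} \<in> E})"
  have "real (card P) = (\<Sum>b\<in>S. real (card {c \<in> A - S. {b, c} \<in> E}))"
    unfolding P_def using fS by (simp add: card_SigmaI)
  moreover have "(\<Sum>b\<in>S. real (card (A - S)) - real k) \<le> (\<Sum>b\<in>S. real (card {c \<in> A - S. {b, c} \<in> E}))"
  proof (rule sum_mono)
    fix b assume b: "b \<in> S"
    have "card (A - S) = card ({c \<in> A - S. {b, c} \<in> E} \<union> {c \<in> A - S. {b, c} \<notin> E})"
      by (rule arg_cong[of _ _ card]) blast
    also have "\<dots> \<le> card {c \<in> A - S. {b, c} \<in> E} + card {c \<in> A - S. {b, c} \<notin> E}" by (rule card_Un_le)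
    finally show "real (card (A - S)) - real k \<le> real (card {c \<in> A - S. {b, c} \<in> E})" using k[OF b] by linarith
  qed
  ultimately have "real (card S) * (real (card (A - S)) - real k) \<le> real (card P)" by simp
  then have "real (card S) * (real (card (A - S)) - real k) * (49 / (100 * real M)) \<le> real (card P) * (49 / (100 * real M))"
    by (rule mult_right_mono) simp
  also have "\<dots> \<le> cut_weight S" by (rule cut_weight_count[OF S]) (auto simp: P_def)
  finally show ?thesis .
qed

lemma card_sides:
  assumes S: "S \<subseteq> A" shows "real (card S) + real (card (A - S)) = 2 * real M + 3"
proof -
  have fS: "finite S" using S finite_subset[OF _ finA] by blast
  show ?thesis using card_A card_Diff_subset[OF fS S] card_mono[OF finA S] by simp
qed

text \<open>For a single vertex counting yields only about 0.98, and the degree equation is used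
  instead. From two vertices on, counting suffices, since a vertex has at most two forbidden
  neighbours: its partner, or the two other exterior ends.\<close>

lemma cut_weight_ge_1_small:
  assumes S: "S \<subseteq> A" "S \<noteq> {}" and small: "card S \<le> card (A - S)"
  shows "1 \<le> cut_weight S"
proof (cases "card S = 1")
  case True
  then obtain a where "S = {a}" by (auto simp: card_1_singleton_iff)
  then show ?thesis using cut_weight_singleton[of a] S by simp
next
  case False
  have fS: "finite S" using S finite_subset[OF _ finA] by blast
  then have S2: "2 \<le> card S" using S(2) False by (cases "card S") (auto simp: Suc_le_eq)
  have few2: "card {c \<in> A - S. {b, c} \<notin> E} \<le> 2" if b: "b \<in> S" for b
  proof (cases "\<rho> b \<in> A")
    case True
    have "{c \<in> A - S. {b, c} \<notin> E} \<subseteq> {\<rho> b}" using b S True by (auto simp: pair_allowed)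
    then have "card {c \<in> A - S. {b, c} \<notin> E} \<le> card {\<rho> b}" by (intro card_mono) auto
    then show ?thesis by simp
  next
    case False
    have fe: "finite (exterior_ends A \<rho>)" by (simp add: exterior_ends_def)
    have bA: "b \<in> A" "b \<in> exterior_ends A \<rho>" using b S False by (auto simp: exterior_ends_def)
    have "{c \<in> A - S. {b, c} \<notin> E} \<subseteq> exterior_ends A \<rho> - {b}"
      using b bA(1) False pair_allowed[OF bA(1)] by (auto simp: exterior_ends_def)
    then have "card {c \<in> A - S. {b, c} \<notin> E} \<le> card (exterior_ends A \<rho> - {b})" using fe by (intro card_mono) auto
    then show ?thesis using card_ext bA fe by simp
  qed
  define m where "m = real M"
  have m6: "1000000 \<le> m" using large by (simp add: m_def)
  define n where "n = real (card S)"
  define c where "c = real (card (A - S))"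
  have nc: "n + c = 2 * m + 3" "n \<le> c" "2 \<le> n"
    using card_sides[OF S(1)] small S2 by (simp_all add: n_def c_def m_def)
  have "m \<le> n * (c - 2) * (49 / 100)"
  proof (cases "card S = 2")
    case True
    then show ?thesis using nc(1) m6 by (simp add: n_def)
  next
    case False
    then have "3 \<le> n" using S2 by (simp add: n_def)
    then have "3 * (m - 1 / 2) \<le> n * (c - 2)" using nc m6 by (intro mult_mono) auto
    moreover have "m \<le> p * (49 / 100)" if "3 * (m - 1 / 2) \<le> p" for p using that m6 by simp
    ultimately show ?thesis by blast
  qed
  then have "1 \<le> n * (c - 2) * (49 / 100) / m" using m6 by (simp add: le_divide_eq)
  also have "\<dots> = n * (c - real 2) * (49 / (100 * m))" by simp
  also have "\<dots> \<le> cut_weight S" using cut_weight_lower[OF S(1) few2] by (simp only: n_def c_def m_def)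
  finally show ?thesis .
qed

lemma cut_weight_ge_1:
  assumes S: "S \<subseteq> A" "S \<noteq> {}" "S \<noteq> A"
  shows "1 \<le> cut_weight S"
proof (cases "card S \<le> card (A - S)")
  case True
  then show ?thesis using cut_weight_ge_1_small S by blast
next
  case False
  have "A - (A - S) = S" using S by blast
  moreover have "A - S \<noteq> {}" using S by blast
  ultimately show ?thesis using cut_weight_ge_1_small[of "A - S"] False cut_weight_complement[of S] by simp
qed

text \<open>\<open>S\<close> consists of complete inside paths. For one path the cut is the disjoint
  union of the stars at its two ends, as the edge joining them is not allowed, and has value exactly
  2. For larger \<open>S\<close> all pairs across the cut are allowed, so counting works.\<close>

lemma cut_weight_ge_2:
  assumes S: "S \<subseteq> internal_ends A \<rho>" "S \<noteq> {}" and closed: "\<And>a. a \<in> S \<Longrightarrow> \<rho> a \<in> S"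
  shows "2 \<le> cut_weight S"
proof -
  have SA: "S \<subseteq> A" using S by (auto simp: internal_ends_def)
  then have fS: "finite S" using finite_subset[OF _ finA] by blast
  obtain a where a: "a \<in> S" using S by blast
  have pair: "{a, \<rho> a} \<subseteq> S" using a closed by auto
  have pair2: "a \<noteq> \<rho> a" using rho_ne[of a] a SA by (metis subsetD)
  show ?thesis
  proof (cases "S = {a, \<rho> a}")
    case True
    have aA: "a \<in> A" "\<rho> a \<in> A" using pair SA by auto
    have no: "{a, \<rho> a} \<notin> E" using aA pair_allowed by auto
    have "{e. e \<in> E \<and> card (e \<inter> S) = 1} = star a \<union> star (\<rho> a)"
    proof (intro set_eqI iffI)
      fix e assume e: "e \<in> {e. e \<in> E \<and> card (e \<inter> S) = 1}"
      then have "e \<inter> S \<noteq> {}" by auto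
      then show "e \<in> star a \<union> star (\<rho> a)" using e True by (auto simp: star_def)
    next
      fix e assume e: "e \<in> star a \<union> star (\<rho> a)"
      then have eE: "e \<in> E" by (auto simp: star_def)
      then have fe: "finite e" "card e = 2" using allowed_sub[OF eE] finite_subset[OF _ finA] allowed_card by auto
      have "card (e \<inter> S) \<noteq> 0" using e True fe by (auto simp: star_def)
      moreover have "card (e \<inter> S) \<le> 2" using card_mono[OF fe(1), of "e \<inter> S"] fe by simp
      moreover have "card (e \<inter> S) \<noteq> 2"
      proof
        assume c: "card (e \<inter> S) = 2"
        then have "card (e \<inter> S) = card e" using fe by simp
        then have "e \<inter> S = e" using card_subset_eq[OF fe(1) Int_lower1] by blast
        moreover have "card (e \<inter> S) = card S" using c True pair2 by simp
        then have "e \<inter> S = S" using card_subset_eq[OF fS Int_lower2] by blast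
        ultimately show False using True no eE by simp
      qed
      ultimately show "e \<in> {e. e \<in> E \<and> card (e \<inter> S) = 1}" using eE by simp
    qed
    moreover have "star a \<inter> star (\<rho> a) = {}"
    proof (rule ccontr)
      assume "star a \<inter> star (\<rho> a) \<noteq> {}"
      then obtain e where e: "e \<in> E" "a \<in> e" "\<rho> a \<in> e" by (auto simp: star_def)
      obtain c d where "e = {c, d}" using e(1) by (elim allowE)
      then have "e = {a, \<rho> a}" using e pair2 by auto
      then show False using e(1) no by simp
    qed
    moreover have "finite (star b)" for b by (simp add: star_def)
    ultimately have "cut_weight S = (\<Sum>e\<in>star a. \<phi> e) + (\<Sum>e\<in>star (\<rho> a). \<phi> e)"
      unfolding cut_weight_def by (simp add: sum.union_disjoint)
    then show ?thesis using edge_value_star1[OF aA(1)] edge_value_star1[OF aA(2)] by simp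
  next
    case False
    then have "{a, \<rho> a} \<subset> S" using pair by blast
    then have "card {a, \<rho> a} < card S" by (rule psubset_card_mono[OF fS])
    then have S3: "3 \<le> card S" using pair2 by simp
    have "exterior_ends A \<rho> \<subseteq> A - S" using S by (auto simp: exterior_ends_def internal_ends_def)
    then have "card (exterior_ends A \<rho>) \<le> card (A - S)" by (intro card_mono) auto
    then have C3: "3 \<le> card (A - S)" using card_ext by simp
    have none: "card {c \<in> A - S. {b, c} \<notin> E} \<le> 0" if b: "b \<in> S" for b
    proof -
      have "b \<in> A" "\<rho> b \<in> A" "\<rho> b \<in> S" using b S closed by (auto simp: internal_ends_def)
      then have "{c \<in> A - S. {b, c} \<notin> E} = {}" using b by (auto simp: pair_allowed)
      then show ?thesis by (simp only: card.empty)
    qed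
    define m where "m = real M"
    have m6: "1000000 \<le> m" using large by (simp add: m_def)
    define n where "n = real (card S)"
    define c where "c = real (card (A - S))"
    have nc: "n + c = 2 * m + 3" "3 \<le> c" "3 \<le> n"
      using card_sides[OF SA] S3 C3 by (simp_all add: n_def c_def m_def)
    \<comment> \<open>With \<open>n + c = 2 * m + 3\<close> this says that the number of pairs
      across the cut is smallest when one side has just three vertices, where it is
      \<open>6 * m\<close>.\<close>
    have "0 \<le> (n - 3) * (c - 3)" using nc by simp
    then have "6 * m \<le> n * c" using nc(1) by (simp add: algebra_simps)
    moreover have "2 * m \<le> p * (49 / 100)" if "6 * m \<le> p" for p using that m6 by simp
    ultimately have "2 * m \<le> n * c * (49 / 100)" by blast
    then have "2 \<le> n * c * (49 / 100) / m" using m6 by (simp add: le_divide_eq)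
    also have "\<dots> = n * (c - real 0) * (49 / (100 * m))" by simp
    also have "\<dots> \<le> cut_weight S" using cut_weight_lower[OF SA none] by (simp only: n_def c_def m_def)
    finally show ?thesis .
  qed
qed

end

section \<open>States: paths of value 1 together with two gadgets\<close>

definition state_vector :: "nat \<Rightarrow> nat \<Rightarrow> nat set set \<Rightarrow> (bool \<Rightarrow> nat set) \<Rightarrow> (bool \<Rightarrow> nat \<Rightarrow> nat) \<Rightarrow> (bool \<Rightarrow> nat \<Rightarrow> nat)
    \<Rightarrow> nat set \<Rightarrow> real" where
  "state_vector s t Q U \<rho> w e = (if e \<in> Q \<and> e \<noteq> {s, t} then 1 else 0) + (\<Sum>g\<in>UNIV. edge_value (U g) (\<rho> g) (w g) e)"

lemma sum_bool: "(\<Sum>h\<in>UNIV. F h) = F g + F (\<not> g)" for F :: "bool \<Rightarrow> real"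
  by (cases g) (simp_all add: UNIV_bool)

text \<open>\<open>Q\<close> contains the edges of value 1 and the virtual edge \<open>{s, t}\<close>, which turns the path
  problem into a tour problem, so that all vertices have degree 2. The labelling \<open>\<kappa>\<close> identifies
  the components of \<open>Q\<close>. The two gadgets are indexed by \<open>bool\<close>.\<close>

locale matching_state =
  fixes V :: "nat set" and s t :: nat and Q :: "nat set set" and U :: "bool \<Rightarrow> nat set"
    and \<rho> w :: "bool \<Rightarrow> nat \<Rightarrow> nat" and \<kappa> :: "nat \<Rightarrow> nat" and R :: nat
  assumes finV: "finite V" and QE: "Q \<subseteq> complete_edges V" and stQ: "{s, t} \<in> Q" and st_ne: "s \<noteq> t"
    and rich: "\<And>g. rich_gadget (U g) (\<rho> g) (w g) R"
    and UV: "\<And>g. U g \<subseteq> V" and Udisj: "U True \<inter> U False = {}"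
    and deg: "\<And>v. v \<in> V \<Longrightarrow> card {q \<in> Q. v \<in> q} + (if v \<in> U True \<union> U False then 1 else 0) = 2"
    and k_edge: "\<And>q x y. q \<in> Q \<Longrightarrow> x \<in> q \<Longrightarrow> y \<in> q \<Longrightarrow> \<kappa> x = \<kappa> y"
    and k_rho: "\<And>g a. a \<in> U g \<Longrightarrow> \<rho> g a \<in> U g \<Longrightarrow> \<kappa> (\<rho> g a) = \<kappa> a"
    and k_inj: "\<And>g a b. a \<in> U g \<Longrightarrow> b \<in> U g \<Longrightarrow> \<kappa> a = \<kappa> b \<Longrightarrow> b = a \<or> b = \<rho> g a"
    and cross: "\<And>g a. a \<in> U g \<Longrightarrow> (\<exists>b\<in>U (\<not> g). \<kappa> b = \<kappa> a) \<longleftrightarrow> \<rho> g a \<notin> U g"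
    and k_ex: "\<And>v. v \<in> V \<Longrightarrow> \<exists>g. \<exists>a\<in>U g. \<kappa> v = \<kappa> a"
    and conn: "\<And>S x y. (\<And>q. q \<in> Q \<Longrightarrow> q \<subseteq> S \<or> q \<inter> S = {}) \<Longrightarrow> x \<in> V \<Longrightarrow> y \<in> V \<Longrightarrow> \<kappa> x = \<kappa> y
        \<Longrightarrow> x \<in> S \<Longrightarrow> y \<in> S"
begin

sublocale G: rich_gadget "U g" "\<rho> g" "w g" R for g by (rule rich)

abbreviation "x \<equiv> state_vector s t Q U \<rho> w"
abbreviation "EV \<equiv> complete_edges V"
abbreviation "Al g \<equiv> allowed (U g) (\<rho> g)"
abbreviation "ph g \<equiv> edge_value (U g) (\<rho> g) (w g)"

lemma finE: "finite EV"
  by (rule finite_subset[of _ "Pow V"]) (auto simp: complete_edges_def finV)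

lemma finQ: "finite Q" using finite_subset[OF QE finE] .

lemma Q_card: "q \<in> Q \<Longrightarrow> card q = 2 \<and> q \<subseteq> V \<and> finite q"
  using QE by (auto simp: complete_edges_def card_ge_0_finite)

lemma Al_E: "e \<in> Al g \<Longrightarrow> e \<in> EV"
  using G.allowed_sub[of e g] G.allowed_card[of e g] UV[of g] by (auto simp: complete_edges_def)

lemma Al_notQ: "e \<in> Al g \<Longrightarrow> e \<notin> Q"
proof
  assume e: "e \<in> Al g" "e \<in> Q"
  from e(1) obtain a b where ab: "e = {a, b}" "a \<in> U g" "b \<in> U g" "a \<noteq> b" "b \<noteq> \<rho> g a" by (elim G.allowE)
  then show False using k_edge[OF e(2), of a b] k_inj[of a g b] by auto
qed

lemma Al_disj: "e \<in> Al g \<Longrightarrow> e \<notin> Al (\<not> g)"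
proof
  assume e: "e \<in> Al g" "e \<in> Al (\<not> g)"
  from e(1) obtain a b where ab: "e = {a, b}" "a \<in> U g" by (elim G.allowE)
  then have "a \<in> U g \<inter> U (\<not> g)" using G.allowed_sub[OF e(2)] by auto
  then show False using Udisj by (cases g) auto
qed

lemma ph_Q: "e \<in> Q \<Longrightarrow> ph g e = 0"
  using Al_notQ[of e g] by (intro G.edge_value_nonallow) blast

lemma ph_other: "e \<in> Al g \<Longrightarrow> ph (\<not> g) e = 0"
  using Al_disj[of e g] by (intro G.edge_value_nonallow) blast

lemma B_nonallow: "e \<notin> Al g \<Longrightarrow> G.B g e f = 0"
  by (simp only: G.B_def G.pair_value_def G.edge_value_nonallow if_cancel mult_zero_left add_0_right simp_thms)

lemma ph_nonneg: "0 \<le> ph g e" by (rule G.edge_value_nonneg)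

lemma ph_le_1: "ph g e \<le> 1"
proof (cases "e \<in> Al g")
  case True
  then obtain a b where ab: "e = {a, b}" "a \<in> U g" by (elim G.allowE)
  have "ph g e \<le> (\<Sum>f\<in>G.star g a. ph g f)"
    using True ab by (intro member_le_sum) (auto simp: G.star_def ph_nonneg)
  then show ?thesis using G.edge_value_star1[OF ab(2)] by simp
qed (simp add: G.edge_value_nonallow)

lemma x_bounds: "0 \<le> x e" "x e \<le> 1"
proof -
  show "0 \<le> x e" unfolding state_vector_def by (intro add_nonneg_nonneg sum_nonneg) (auto simp: ph_nonneg)
  show "x e \<le> 1"
  proof (cases "\<exists>g. e \<in> Al g")
    case True
    then obtain g where g: "e \<in> Al g" by blast
    then have "x e = ph g e" using Al_notQ[OF g] Al_disj[OF g]
      by (simp add: state_vector_def sum_bool[of _ g] G.edge_value_nonallow)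
    then show ?thesis using ph_le_1 by simp
  next
    case False
    then show ?thesis by (simp add: state_vector_def G.edge_value_nonallow)
  qed
qed

text \<open>The virtual edge belongs to \<open>Q\<close> but carries no value, so it is subtracted
  again. In this way the bounds 2 and 1 for the two kinds of cuts become the same bound 2 for
  \<open>Q\<close> together with the gadgets.\<close>

lemma cut_value:
  "sum x (edge_cut EV S) = real (card {q \<in> Q. card (q \<inter> S) = 1}) - (if card (S \<inter> {s, t}) = 1 then 1 else 0)
     + (\<Sum>g\<in>UNIV. G.cut_weight g (S \<inter> U g))"
proof -
  have fin: "finite (edge_cut EV S)" using finE by (simp add: edge_cut_def)
  have "sum x (edge_cut EV S) = (\<Sum>e\<in>edge_cut EV S. if e \<in> Q \<and> e \<noteq> {s, t} then 1 else 0)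
      + (\<Sum>e\<in>edge_cut EV S. \<Sum>g\<in>UNIV. ph g e)"
    by (simp add: state_vector_def sum.distrib)
  also have "(\<Sum>e\<in>edge_cut EV S. if e \<in> Q \<and> e \<noteq> {s, t} then 1 else 0)
     = (\<Sum>e\<in>{e \<in> edge_cut EV S. e \<in> Q \<and> e \<noteq> {s, t}}. 1::real)"
    by (rule sum.inter_filter[symmetric]) (rule fin)
  also have "\<dots> = real (card ({q \<in> Q. card (q \<inter> S) = 1} - {{s, t}}))"
  proof -
    have "{e \<in> edge_cut EV S. e \<in> Q \<and> e \<noteq> {s, t}} = {q \<in> Q. card (q \<inter> S) = 1} - {{s, t}}"
      using QE by (auto simp: edge_cut_def)
    then show ?thesis by simp
  qed
  also have "\<dots> = real (card {q \<in> Q. card (q \<inter> S) = 1}) - (if card (S \<inter> {s, t}) = 1 then 1 else 0)"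
  proof (cases "card (S \<inter> {s, t}) = 1")
    case True
    then have m: "{s, t} \<in> {q \<in> Q. card (q \<inter> S) = 1}" using stQ by (simp add: Int_commute)
    moreover have f: "finite {q \<in> Q. card (q \<inter> S) = 1}" using finQ by simp
    ultimately have "0 < card {q \<in> Q. card (q \<inter> S) = 1}" by (metis card_gt_0_iff empty_iff)
    then show ?thesis using True m f by (simp add: of_nat_diff)
  next
    case False
    then have "{q \<in> Q. card (q \<inter> S) = 1} - {{s, t}} = {q \<in> Q. card (q \<inter> S) = 1}"
      by (auto simp: Int_commute)
    then show ?thesis using False by simp
  qed
  also have "(\<Sum>e\<in>edge_cut EV S. \<Sum>g\<in>UNIV. ph g e) = (\<Sum>g\<in>UNIV. \<Sum>e\<in>edge_cut EV S. ph g e)"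
    by (rule sum.swap)
  also have "\<dots> = (\<Sum>g\<in>UNIV. G.cut_weight g (S \<inter> U g))"
  proof (rule sum.cong[OF refl])
    fix g
    have eq: "e \<inter> (S \<inter> U g) = e \<inter> S" if "e \<in> Al g" for e
      using G.allowed_sub[OF that] by blast
    have "(\<Sum>e\<in>edge_cut EV S. ph g e) = (\<Sum>e\<in>{e. e \<in> Al g \<and> card (e \<inter> (S \<inter> U g)) = 1}. ph g e)"
    proof (rule sum.mono_neutral_right[OF fin])
      show "{e. e \<in> Al g \<and> card (e \<inter> (S \<inter> U g)) = 1} \<subseteq> edge_cut EV S"
        using eq Al_E by (auto simp: edge_cut_def)
      show "\<forall>i\<in>edge_cut EV S - {e. e \<in> Al g \<and> card (e \<inter> (S \<inter> U g)) = 1}. ph g i = 0"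
      proof
        fix i assume i: "i \<in> edge_cut EV S - {e. e \<in> Al g \<and> card (e \<inter> (S \<inter> U g)) = 1}"
        then have "i \<notin> Al g" using eq[of i] by (auto simp: edge_cut_def)
        then show "ph g i = 0" by (rule G.edge_value_nonallow)
      qed
    qed
    then show "(\<Sum>e\<in>edge_cut EV S. ph g e) = G.cut_weight g (S \<inter> U g)" by (simp add: G.cut_weight_def)
  qed
  finally show ?thesis .
qed

lemma cut_weight_nonneg: "0 \<le> G.cut_weight g S"
  unfolding G.cut_weight_def by (intro sum_nonneg) (simp add: ph_nonneg)

text \<open>Handshake argument: with the missing units included every vertex has degree 2, so the
  incidences at \<open>S\<close> are even in number, and an edge of \<open>Q\<close> within
  \<open>S\<close> counts twice.\<close>

lemma cut_parity:
  assumes S: "S \<subseteq> V"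
  shows "even (card {q \<in> Q. card (q \<inter> S) = 1} + card (S \<inter> (U True \<union> U False)))"
proof -
  have fS: "finite S" using S finV finite_subset by blast
  let ?W = "U True \<union> U False"
  have "(\<Sum>v\<in>S. card {q \<in> Q. v \<in> q}) + card (S \<inter> ?W) = (\<Sum>v\<in>S. card {q \<in> Q. v \<in> q} + (if v \<in> ?W then 1 else 0))"
  proof -
    have "card (S \<inter> ?W) = (\<Sum>v\<in>S. if v \<in> ?W then 1 else 0)"
      unfolding card_eq_sum by (rule sum.inter_restrict[OF fS])
    then show ?thesis by (simp only: sum.distrib)
  qed
  also have "\<dots> = (\<Sum>v\<in>S. 2)"
  proof (rule sum.cong[OF refl])
    fix v assume "v \<in> S"
    then have "v \<in> V" using S by blast
    then show "card {q \<in> Q. v \<in> q} + (if v \<in> ?W then 1 else 0) = 2" by (rule deg)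
  qed
  finally have 1: "(\<Sum>v\<in>S. card {q \<in> Q. v \<in> q}) + card (S \<inter> ?W) = 2 * card S" by simp
  have "(\<Sum>v\<in>S. card {q \<in> Q. v \<in> q}) = (\<Sum>v\<in>S. \<Sum>q\<in>{q \<in> Q. v \<in> q}. 1)" by simp
  also have "\<dots> = (\<Sum>q\<in>Q. \<Sum>v\<in>{v \<in> S. v \<in> q}. 1)" by (rule sum.swap_restrict[OF fS finQ])
  also have "\<dots> = (\<Sum>q\<in>Q. card (q \<inter> S))"
    by (intro sum.cong refl) (simp add: Int_def conj_commute)
  finally have 2: "(\<Sum>v\<in>S. card {q \<in> Q. v \<in> q}) = (\<Sum>q\<in>Q. card (q \<inter> S))" .
  have le2: "card (q \<inter> S) \<le> 2" if "q \<in> Q" for q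
    using Q_card[OF that] card_mono[of q "q \<inter> S"] by simp
  have "(\<Sum>q\<in>Q. card (q \<inter> S)) = (\<Sum>q\<in>Q. (if card (q \<inter> S) = 1 then 1 else 0) + 2 * (if card (q \<inter> S) = 2 then 1 else 0))"
  proof (rule sum.cong[OF refl])
    fix q assume "q \<in> Q"
    then have "card (q \<inter> S) = 0 \<or> card (q \<inter> S) = 1 \<or> card (q \<inter> S) = 2" using le2 by fastforce
    then show "card (q \<inter> S) = (if card (q \<inter> S) = 1 then 1 else 0) + 2 * (if card (q \<inter> S) = 2 then 1 else 0)" by auto
  qed
  also have "\<dots> = (\<Sum>q\<in>Q. if card (q \<inter> S) = 1 then 1 else 0) + 2 * (\<Sum>q\<in>Q. if card (q \<inter> S) = 2 then 1 else 0)"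
    by (simp only: sum.distrib sum_distrib_left)
  also have "(\<Sum>q\<in>Q. if card (q \<inter> S) = 1 then 1 else 0) = card {q \<in> Q. card (q \<inter> S) = 1}"
    using sum.inter_filter[OF finQ, of "\<lambda>_. 1::nat" "\<lambda>q. card (q \<inter> S) = 1"] by simp
  finally have "card {q \<in> Q. card (q \<inter> S) = 1} + 2 * (\<Sum>q\<in>Q. if card (q \<inter> S) = 2 then 1 else 0) + card (S \<inter> ?W) = 2 * card S"
    using 1 2 by simp
  then show ?thesis by presburger
qed

lemma card_crossing:
  assumes q: "q \<in> Q" and S: "q \<inter> S \<noteq> {}" "\<not> q \<subseteq> S"
  shows "card (q \<inter> S) = 1"
proof -
  have "q \<inter> S \<subset> q" using S by blast
  then have "card (q \<inter> S) < card q" using Q_card[OF q] by (intro psubset_card_mono) auto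
  moreover have "0 < card (q \<inter> S)" using Q_card[OF q] S by (simp add: card_gt_0_iff)
  ultimately show ?thesis using Q_card[OF q] by linarith
qed

text \<open>\<open>conn\<close> is applied to the part of \<open>S\<close> inside the class of
  \<open>a\<close>. The crossed edge therefore lies in that class, and different classes give
  different edges.\<close>

lemma crossing_edge:
  assumes a: "a \<in> V" "a \<in> S" and b: "b \<in> V" "b \<notin> S" and ab: "\<kappa> a = \<kappa> b"
  shows "\<exists>q\<in>Q. card (q \<inter> S) = 1 \<and> (\<forall>y\<in>q. \<kappa> y = \<kappa> a)"
proof -
  let ?T = "{y \<in> S. \<kappa> y = \<kappa> a}"
  have "\<exists>q\<in>Q. \<not> (q \<subseteq> ?T \<or> q \<inter> ?T = {})"
  proof (rule ccontr)
    assume "\<not> ?thesis"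
    then have "q \<subseteq> ?T \<or> q \<inter> ?T = {}" if "q \<in> Q" for q using that by blast
    then have "b \<in> ?T" by (rule conn[of ?T a b]) (use a b ab in auto)
    then show False using b by simp
  qed
  then obtain q where q: "q \<in> Q" "\<not> q \<subseteq> ?T" "q \<inter> ?T \<noteq> {}" by blast
  obtain y0 where y0: "y0 \<in> q" "\<kappa> y0 = \<kappa> a" using q(3) by blast
  have kq: "\<kappa> y = \<kappa> a" if "y \<in> q" for y using k_edge[OF q(1) that y0(1)] y0(2) by simp
  have "q \<inter> S \<noteq> {}" "\<not> q \<subseteq> S" using q kq by auto
  then have "card (q \<inter> S) = 1" by (rule card_crossing[OF q(1)])
  then show ?thesis using q(1) kq by blast
qed

text \<open>The cases are the numbers of edges of \<open>Q\<close> in the cut. With one such edge a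
  single unit from the gadgets is lacking; with none, \<open>S\<close> is a union of whole paths and
  the gadgets have to provide both units.\<close>

lemma cut_at_least_2:
  assumes S: "S \<noteq> {}" "S \<subset> V"
  shows "2 \<le> real (card {q \<in> Q. card (q \<inter> S) = 1}) + (\<Sum>g\<in>UNIV. G.cut_weight g (S \<inter> U g))"
proof -
  let ?k = "card {q \<in> Q. card (q \<inter> S) = 1}"
  have SV: "S \<subseteq> V" using S by blast
  have c1: "1 \<le> G.cut_weight g (S \<inter> U g)" if "S \<inter> U g \<noteq> {}" "S \<inter> U g \<noteq> U g" for g
    by (rule G.cut_weight_ge_1) (use that in auto)
  have UVs: "a \<in> V" if "a \<in> U g" for a g using that UV by blast
  consider "2 \<le> ?k" | "?k = 1" | "?k = 0" by linarith
  then show ?thesis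
  proof cases
    case 1
    have "0 \<le> (\<Sum>g\<in>UNIV. G.cut_weight g (S \<inter> U g))" by (intro sum_nonneg cut_weight_nonneg)
    then show ?thesis using 1 by linarith
  next
    case 2
    show ?thesis
    proof (cases "\<exists>g. S \<inter> U g \<noteq> {} \<and> S \<inter> U g \<noteq> U g")
      case True
      then obtain g where "1 \<le> G.cut_weight g (S \<inter> U g)" using c1 by blast
      moreover have "0 \<le> G.cut_weight (\<not> g) (S \<inter> U (\<not> g))" by (rule cut_weight_nonneg)
      ultimately show ?thesis using 2 unfolding sum_bool[of _ g] by simp
    next
      case False
      \<comment> \<open>Neither gadget is split. Both have odd size and exactly one edge of
        \<open>Q\<close> is cut, so by parity one gadget lies inside \<open>S\<close> and the other
        outside. Then each exterior path crosses the cut, and already two of them contradict the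
        single edge.\<close>
      have odd: "odd (card (U g))" for g using G.card_A[of g] by simp
      have dj: "card (S \<inter> (U True \<union> U False)) = card (S \<inter> U True) + card (S \<inter> U False)"
        unfolding Int_Un_distrib using Udisj by (intro card_Un_disjoint) auto
      have "odd (card (S \<inter> (U True \<union> U False)))" using cut_parity[OF SV] 2 by simp
      then have "\<exists>g. S \<inter> U g = U g \<and> S \<inter> U (\<not> g) = {}"
        proof -
        have triv: "S \<inter> U g = {} \<or> S \<inter> U g = U g" for g using False by blast
        assume o: "odd (card (S \<inter> (U True \<union> U False)))"
        show ?thesis
          using triv[of True]
        proof
          assume T: "S \<inter> U True = {}"
          have "S \<inter> U False \<noteq> {}"
          proof
            assume "S \<inter> U False = {}"
            then show False using o T unfolding dj by simp
          qed
          then have "S \<inter> U False = U False" using triv[of False] by blast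
          then show ?thesis using T by (intro exI[of _ False]) simp
        next
          assume T: "S \<inter> U True = U True"
          have "S \<inter> U False \<noteq> U False"
          proof
            assume "S \<inter> U False = U False"
            then show False using o T odd[of True] odd[of False] unfolding dj by simp
          qed
          then have "S \<inter> U False = {}" using triv[of False] by blast
          then show ?thesis using T by (intro exI[of _ True]) simp
        qed
      qed
      then obtain g where g: "U g \<subseteq> S" "S \<inter> U (\<not> g) = {}" by blast
      have "card (exterior_ends (U g) (\<rho> g)) = 3" by (rule G.card_ext)
      then obtain a1 a2 a3 where "exterior_ends (U g) (\<rho> g) = {a1, a2, a3}" "a1 \<noteq> a2" unfolding card_3_iff by blast
      then have a: "a1 \<in> exterior_ends (U g) (\<rho> g)" "a2 \<in> exterior_ends (U g) (\<rho> g)" "a1 \<noteq> a2" by auto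
      have q: "\<exists>q\<in>Q. card (q \<inter> S) = 1 \<and> (\<forall>y\<in>q. \<kappa> y = \<kappa> a)" if "a \<in> exterior_ends (U g) (\<rho> g)" for a
      proof -
        have aU: "a \<in> U g" "\<rho> g a \<notin> U g" using that by (auto simp: exterior_ends_def)
        then obtain b where b: "b \<in> U (\<not> g)" "\<kappa> b = \<kappa> a" using cross[of a g] by auto
        have "b \<notin> S" using b(1) g(2) by blast
        moreover have "a \<in> S" using aU(1) g(1) by blast
        ultimately show ?thesis using crossing_edge[OF UVs[OF aU(1)] _ UVs[OF b(1)] _ b(2)[symmetric]] by blast
      qed
      obtain q1 q2 where q1: "q1 \<in> Q" "card (q1 \<inter> S) = 1" "\<forall>y\<in>q1. \<kappa> y = \<kappa> a1"
        and q2: "q2 \<in> Q" "card (q2 \<inter> S) = 1" "\<forall>y\<in>q2. \<kappa> y = \<kappa> a2"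
        using q[OF a(1)] q[OF a(2)] by blast
      have "\<kappa> a1 \<noteq> \<kappa> a2" using k_inj[of a1 g a2] a by (auto simp: exterior_ends_def)
      moreover obtain y where "y \<in> q1" using Q_card[OF q1(1)] by fastforce
      ultimately have "q1 \<noteq> q2" using q1(3) q2(3) by auto
      then have "card {q1, q2} = 2" by simp
      moreover have "card {q1, q2} \<le> ?k" using q1 q2 finQ by (intro card_mono) auto
      ultimately show ?thesis using 2 by simp
    qed
  next
    case 3
    then have no: "card (q \<inter> S) \<noteq> 1" if "q \<in> Q" for q using finQ that by auto
    have nocross: "q \<subseteq> S \<or> q \<inter> S = {}" if "q \<in> Q" for q
      using card_crossing[OF that] no[OF that] by blast
    have closed: "a \<in> S \<longleftrightarrow> b \<in> S" if "a \<in> V" "b \<in> V" "\<kappa> a = \<kappa> b" for a b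
    proof
      assume "a \<in> S"
      show "b \<in> S"
      proof (rule conn[of S a b])
        show "q \<subseteq> S \<or> q \<inter> S = {}" if "q \<in> Q" for q by (rule nocross[OF that])
      qed (fact that \<open>a \<in> S\<close>)+
    next
      assume "b \<in> S"
      show "a \<in> S"
      proof (rule conn[of S b a])
        show "q \<subseteq> S \<or> q \<inter> S = {}" if "q \<in> Q" for q by (rule nocross[OF that])
      qed (fact that(1,2) that(3)[symmetric] \<open>b \<in> S\<close>)+
    qed
    show ?thesis
    proof (cases "\<forall>g. S \<inter> U g \<noteq> {} \<and> S \<inter> U g \<noteq> U g")
      case True
      then show ?thesis using c1[of True] c1[of False] by (simp add: sum_bool[of _ True])
    next
      case False
      then obtain g where "S \<inter> U g = {} \<or> S \<inter> U g = U g" by blast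
      then obtain h where h: "S \<inter> U (\<not> h) = {} \<or> S \<inter> U (\<not> h) = U (\<not> h)" by (intro that[of "\<not> g"]) simp
      \<comment> \<open>The other gadget is not split. Exterior paths lie entirely on its side, so
        the vertices of gadget \<open>h\<close> on the opposite side belong to inside paths, and
        \<open>cut_weight_ge_2\<close> applies to them. They exist because by \<open>k_ex\<close>
        every component has an end in some gadget.\<close>
      have two: "2 \<le> G.cut_weight h (S \<inter> U h)"
      proof (cases "S \<inter> U (\<not> h) = {}")
        case True
        show ?thesis
        proof (rule G.cut_weight_ge_2)
          show "S \<inter> U h \<subseteq> internal_ends (U h) (\<rho> h)"
          proof
            fix a assume a: "a \<in> S \<inter> U h"
            have "\<rho> h a \<in> U h"
            proof (rule ccontr)
              assume "\<rho> h a \<notin> U h"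
              then obtain b where b: "b \<in> U (\<not> h)" "\<kappa> b = \<kappa> a" using a cross[of a h] by auto
              have "a \<in> U h" "a \<in> S" using a by auto
              then have "b \<in> S" using closed[OF UVs[OF b(1)] UVs b(2)] by blast
              then show False using b(1) True by blast
            qed
            then show "a \<in> internal_ends (U h) (\<rho> h)" using a by (simp add: internal_ends_def)
          qed
          obtain v where v: "v \<in> S" "v \<in> V" using S by blast
          obtain g a where ga: "a \<in> U g" "\<kappa> v = \<kappa> a" using k_ex[OF v(2)] by blast
          then have "a \<in> S" using closed[OF v(2) UVs[OF ga(1)] ga(2)] v(1) by simp
          then have "g = h" using ga True by (cases "g = h") auto
          then show "S \<inter> U h \<noteq> {}" using ga \<open>a \<in> S\<close> by blast
          fix a assume a: "a \<in> S \<inter> U h"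
          have "a \<in> internal_ends (U h) (\<rho> h)" using \<open>S \<inter> U h \<subseteq> internal_ends (U h) (\<rho> h)\<close> a by blast
          then have r: "\<rho> h a \<in> U h" by (simp add: internal_ends_def)
          have aU: "a \<in> U h" "a \<in> S" using a by auto
          show "\<rho> h a \<in> S \<inter> U h" using closed[OF UVs[OF aU(1)] UVs[OF r] k_rho[OF aU(1) r, symmetric]] aU r by simp
        qed
      next
        case False
        then have full: "U (\<not> h) \<subseteq> S" using h by blast
        have "2 \<le> G.cut_weight h (U h - S \<inter> U h)"
        proof (rule G.cut_weight_ge_2)
          show "U h - S \<inter> U h \<subseteq> internal_ends (U h) (\<rho> h)"
          proof
            fix a assume a: "a \<in> U h - S \<inter> U h"
            have "\<rho> h a \<in> U h"
            proof (rule ccontr)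
              assume "\<rho> h a \<notin> U h"
              then obtain b where b: "b \<in> U (\<not> h)" "\<kappa> b = \<kappa> a" using a cross[of a h] by auto
              have "a \<in> U h" "a \<notin> S" using a by auto
              then have "b \<notin> S" using closed[OF UVs[OF b(1)] UVs b(2)] by blast
              then show False using b(1) full by blast
            qed
            then show "a \<in> internal_ends (U h) (\<rho> h)" using a by (simp add: internal_ends_def)
          qed
          obtain v where v: "v \<notin> S" "v \<in> V" using S by blast
          obtain g a where ga: "a \<in> U g" "\<kappa> v = \<kappa> a" using k_ex[OF v(2)] by blast
          then have "a \<notin> S" using closed[OF v(2) UVs[OF ga(1)] ga(2)] v(1) by simp
          then have "g = h" using ga full by (cases "g = h") auto
          then show "U h - S \<inter> U h \<noteq> {}" using ga \<open>a \<notin> S\<close> by blast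
          fix a assume a: "a \<in> U h - S \<inter> U h"
          have "a \<in> internal_ends (U h) (\<rho> h)" using \<open>U h - S \<inter> U h \<subseteq> internal_ends (U h) (\<rho> h)\<close> a by blast
          then have r: "\<rho> h a \<in> U h" by (simp add: internal_ends_def)
          have aU: "a \<in> U h" "a \<notin> S" using a by auto
          show "\<rho> h a \<in> U h - S \<inter> U h" using closed[OF UVs[OF aU(1)] UVs[OF r] k_rho[OF aU(1) r, symmetric]] aU r by simp
        qed
        then show ?thesis unfolding G.cut_weight_complement .
      qed
      have "0 \<le> G.cut_weight (\<not> h) (S \<inter> U (\<not> h))" by (rule cut_weight_nonneg)
      then show ?thesis using two 3 unfolding sum_bool[of _ h] by linarith
    qed
  qed
qed

definition state_point :: "nat set \<Rightarrow> real" where "state_point = restrict x EV"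

lemma s_t_V: "s \<in> V" "t \<in> V" using stQ QE by (auto simp: complete_edges_def)

lemma state_point_in_SP: "state_point \<in> SP V EV s t"
proof -
  have sum: "sum state_point (edge_cut EV S) = sum x (edge_cut EV S)" for S
    by (rule sum.cong) (auto simp: state_point_def edge_cut_def)
  have cut: "2 - (if card (S \<inter> {s, t}) = 1 then 1 else 0) \<le> sum state_point (edge_cut EV S)" if "S \<noteq> {}" "S \<subset> V" for S
    using cut_at_least_2[OF that] unfolding sum cut_value by linarith
  have single: "sum state_point (edge_cut EV {v}) = (if v \<in> {s, t} then 1 else 2)" if v: "v \<in> V" for v
  proof -
    have e1: "{q \<in> Q. card (q \<inter> {v}) = 1} = {q \<in> Q. v \<in> q}" by (auto simp: Int_insert_right split: if_splits)
    have e2: "card ({v} \<inter> {s, t}) = 1 \<longleftrightarrow> v \<in> {s, t}"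
    proof (cases "v \<in> {s, t}")
      case True
      then have "{v} \<inter> {s, t} = {v}" by blast
      then show ?thesis using True by simp
    next
      case False
      then have "{v} \<inter> {s, t} = {}" by blast
      then show ?thesis using False by simp
    qed
    have e3: "(\<Sum>g\<in>UNIV. G.cut_weight g ({v} \<inter> U g)) = (if v \<in> U True \<union> U False then 1 else 0)"
    proof -
      have c: "G.cut_weight g ({v} \<inter> U g) = (if v \<in> U g then 1 else 0)" for g
      proof (cases "v \<in> U g")
        case True
        then have "{v} \<inter> U g = {v}" by blast
        then show ?thesis using G.cut_weight_singleton[of v g] True by simp
      qed (simp add: G.cut_weight_def)
      show ?thesis using Udisj by (auto simp: c sum_bool[of _ True])
    qed
    have "sum state_point (edge_cut EV {v}) = real (card {q \<in> Q. v \<in> q}) - (if v \<in> {s, t} then 1 else 0)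
       + (if v \<in> U True \<union> U False then 1 else 0)"
      unfolding sum cut_value by (simp only: e1 e2 e3)
    moreover have "real (card {q \<in> Q. v \<in> q}) + (if v \<in> U True \<union> U False then 1 else 0) = 2"
      using arg_cong[OF deg[OF v], of real] by (simp split: if_splits)
    ultimately show ?thesis by simp
  qed
  have "state_point \<in> EV \<rightarrow>\<^sub>E {0..1}" by (auto simp: state_point_def x_bounds)
  then show ?thesis
    unfolding SP_def
  proof (intro CollectI conjI allI ballI impI)
    fix S assume "S \<noteq> {} \<and> S \<subset> V \<and> card (S \<inter> {s, t}) \<noteq> 1"
    then show "2 \<le> sum state_point (edge_cut EV S)" using cut[of S] by simp
  next
    fix S assume "S \<noteq> {} \<and> S \<subset> V \<and> card (S \<inter> {s, t}) = 1"
    then show "1 \<le> sum state_point (edge_cut EV S)" using cut[of S] by simp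
  next
    fix v assume "v \<in> V - {s, t}"
    then show "sum state_point (edge_cut EV {v}) = 2" using single[of v] by simp
  next
    fix v assume v: "v \<in> {s, t}"
    then have "v \<in> V" using s_t_V by blast
    then show "sum state_point (edge_cut EV {v}) = 1" using single[of v] v by simp
  qed
qed

section \<open>Moment matrix of a state\<close>

text \<open>The solution conditioned on \<open>e\<close>; it is the vector of the merged state
  (\<open>state_vector_merged\<close>).\<close>

definition merged_vector :: "bool \<Rightarrow> nat set \<Rightarrow> nat set \<Rightarrow> real" where
  "merged_vector g e f = (if f \<in> Q \<and> f \<noteq> {s, t} then 1 else 0) + (if f = e then 1 else 0)
     + edge_value (U g - e) (merge_partner e (\<rho> g)) (merge_weight e (\<rho> g) (w g)) f + ph (\<not> g) f"

definition moment_matrix :: "nat set \<Rightarrow> nat set \<Rightarrow> real" where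
  "moment_matrix e f = (if e \<in> Q \<and> e \<noteq> {s, t} then 1 else 0) * x f + (\<Sum>g\<in>UNIV. ph g e * merged_vector g e f)"

lemma x_expand: "x e = (if e \<in> Q \<and> e \<noteq> {s, t} then 1 else 0) + ph True e + ph False e"
  by (simp add: state_vector_def sum_bool[of _ True])

text \<open>The two gadgets are treated as independent, so mixed moments are products, and only
  moments within one gadget need \<open>B\<close>. In this form the symmetry of the matrix is
  apparent.\<close>

lemma moment_matrix_expand:
  "moment_matrix e f = (if e \<in> Q \<and> e \<noteq> {s, t} then 1 else 0) * (if f \<in> Q \<and> f \<noteq> {s, t} then 1 else 0)
     + (if e \<in> Q \<and> e \<noteq> {s, t} then 1 else 0) * (ph True f + ph False f)
     + (if f \<in> Q \<and> f \<noteq> {s, t} then 1 else 0) * (ph True e + ph False e)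
     + (ph True e * ph False f + ph True f * ph False e)
     + (G.B True e f + G.B False e f)"
  unfolding moment_matrix_def x_expand merged_vector_def sum_bool[of _ True] G.B_def G.pair_value_def
  by (simp add: algebra_simps)

lemma moment_matrix_sym: "moment_matrix e f = moment_matrix f e"
  unfolding moment_matrix_expand G.B_sym[of True e f] G.B_sym[of False e f] by (simp add: algebra_simps)

lemma moment_matrix_diag:
  assumes "e \<in> EV" shows "moment_matrix e e = x e"
proof -
  have B: "G.B g e e = ph g e" for g
  proof (cases "e \<in> Al g")
    case True
    then obtain a b where "e = {a, b}" by (elim G.allowE)
    then have "e \<noteq> {}" by simp
    interpret m: gadget "U g - e" "merge_partner e (\<rho> g)" "merge_weight e (\<rho> g) (w g)" by (rule G.allowed_merged_gadget[OF True])
    have "e \<notin> allowed (U g - e) (merge_partner e (\<rho> g))" using m.allowed_sub[of e] \<open>e \<noteq> {}\<close> by blast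
    then show ?thesis by (simp add: G.B_def G.pair_value_def m.edge_value_nonallow)
  qed (simp add: G.B_def G.pair_value_def G.edge_value_nonallow)
  consider "e \<in> Q" | g where "e \<in> Al g" | "e \<notin> Q" "\<And>g. e \<notin> Al g" by blast
  then show ?thesis
  proof cases
    case 1
    then have "ph g e = 0" for g by (simp add: ph_Q)
    then show ?thesis using B by (simp add: moment_matrix_expand x_expand)
  next
    case 2
    then have "e \<notin> Q" "ph (\<not> g) e = 0" using Al_notQ[of e g] ph_other[of e g] by auto
    then show ?thesis using B by (cases g) (simp_all add: moment_matrix_expand x_expand)
  next
    case 3
    then have "ph g e = 0" for g by (simp add: G.edge_value_nonallow)
    then show ?thesis using B 3 by (simp add: moment_matrix_expand x_expand)
  qed
qed

lemma moment_matrix_Q: "e \<in> Q \<Longrightarrow> e \<noteq> {s, t} \<Longrightarrow> moment_matrix e f = x f"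
  by (simp add: moment_matrix_def ph_Q)

lemma moment_matrix_Al: "e \<in> Al g \<Longrightarrow> moment_matrix e f = ph g e * merged_vector g e f"
  using Al_notQ[of e g] ph_other[of e g] by (simp add: moment_matrix_def sum_bool[of _ g])

lemma moment_matrix_zero: "\<not> (e \<in> Q \<and> e \<noteq> {s, t}) \<Longrightarrow> (\<And>g. e \<notin> Al g) \<Longrightarrow> moment_matrix e f = 0"
  by (simp only: moment_matrix_def G.edge_value_nonallow if_False mult_zero_left sum.neutral_const add_0_right simp_thms)

text \<open>The rows belonging to the edges at one gadget vertex add up to row 0, since exactly one
  of them is chosen, in the sense of the degree equations.\<close>

lemma moment_matrix_star:
  assumes e: "e \<in> EV" and a: "a \<in> U g"
  shows "(\<Sum>f\<in>G.star g a. moment_matrix f e) = x e"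
proof -
  have fs: "f \<in> Al g" if "f \<in> G.star g a" for f using that by (simp add: G.star_def)
  have B: "(\<Sum>f\<in>G.star g a. G.B g e f) = ph g e"
  proof (cases "e \<in> Al g")
    case True
    then show ?thesis using G.B_star a by blast
  next
    case False
    then have "G.B g e f = 0" for f by (rule B_nonallow)
    then show ?thesis using False by (simp add: G.edge_value_nonallow)
  qed
  have B': "G.B (\<not> g) e f = 0" if "f \<in> G.star g a" for f
    using B_nonallow[OF Al_disj[OF fs[OF that]], of e] G.B_sym[of "\<not> g" e f] by simp
  have p: "moment_matrix e f = (if e \<in> Q \<and> e \<noteq> {s, t} then 1 else 0) * ph g f + ph g f * ph (\<not> g) e + G.B g e f"
    if f: "f \<in> G.star g a" for f
  proof -
    have z: "f \<notin> Q" "ph (\<not> g) f = 0" using Al_notQ[OF fs[OF f]] ph_other[OF fs[OF f]] by auto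
    show ?thesis using z B'[OF f] by (cases g) (simp_all add: moment_matrix_expand)
  qed
  have "(\<Sum>f\<in>G.star g a. moment_matrix f e) = (\<Sum>f\<in>G.star g a. (if e \<in> Q \<and> e \<noteq> {s, t} then 1 else 0) * ph g f + ph g f * ph (\<not> g) e + G.B g e f)"
    by (rule sum.cong[OF refl]) (simp only: p moment_matrix_sym[of _ e])
  also have "\<dots> = (if e \<in> Q \<and> e \<noteq> {s, t} then 1 else 0) * (\<Sum>f\<in>G.star g a. ph g f) + (\<Sum>f\<in>G.star g a. ph g f) * ph (\<not> g) e + ph g e"
    by (simp only: sum.distrib sum_distrib_left sum_distrib_right B)
  also have "\<dots> = x e" using G.edge_value_star1[OF a] by (cases g) (simp_all add: x_expand)
  finally show ?thesis .
qed

text \<open>Completing the square: the form is the square of the mean of the affine function given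
  by \<open>z0\<close> and \<open>z\<close>, plus the covariance forms of the two gadgets, which are
  nonnegative by \<open>covariance_psd\<close>.\<close>

lemma moment_matrix_psd:
  fixes z :: "nat set \<Rightarrow> real"
  shows "0 \<le> z0 * z0 + 2 * z0 * (\<Sum>e\<in>EV. z e * x e) + (\<Sum>e\<in>EV. \<Sum>f\<in>EV. z e * moment_matrix e f * z f)"
proof -
  let ?o = "\<lambda>e. if e \<in> Q \<and> e \<noteq> {s, t} then 1 else 0 :: real"
  define q where "q = (\<Sum>e\<in>EV. z e * ?o e)"
  define m where "m g = (\<Sum>e\<in>EV. z e * ph g e)" for g
  define b where "b g = (\<Sum>e\<in>EV. \<Sum>f\<in>EV. z e * G.B g e f * z f)" for g
  have mb: "(m g)\<^sup>2 \<le> b g" for g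
  proof -
    have sub: "Al g \<subseteq> EV" using Al_E by blast
    have "m g = (\<Sum>e\<in>Al g. ph g e * z e)"
      unfolding m_def using sub finE by (intro sum.mono_neutral_cong_right) (auto simp: G.edge_value_nonallow)
    moreover have "b g = (\<Sum>e\<in>Al g. \<Sum>f\<in>Al g. G.B g e f * (z e * z f))"
    proof -
      have z1: "G.B g e f = 0" if "e \<notin> Al g \<or> f \<notin> Al g" for e f
        using that B_nonallow[of e g f] B_nonallow[of f g e] G.B_sym[of g e f] by auto
      have "b g = (\<Sum>e\<in>Al g. \<Sum>f\<in>EV. z e * G.B g e f * z f)"
        unfolding b_def using sub finE z1 by (intro sum.mono_neutral_right) auto
      also have "\<dots> = (\<Sum>e\<in>Al g. \<Sum>f\<in>Al g. z e * G.B g e f * z f)"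
        using sub finE z1 by (intro sum.cong[OF refl] sum.mono_neutral_right) auto
      finally show ?thesis by (simp add: mult_ac)
    qed
    ultimately show ?thesis using G.covariance_psd[of g z] by simp
  qed
  have x1: "(\<Sum>e\<in>EV. z e * x e) = q + m True + m False"
    by (simp only: x_expand q_def m_def distrib_left sum.distrib)
  have "(\<Sum>e\<in>EV. \<Sum>f\<in>EV. z e * moment_matrix e f * z f)
     = (\<Sum>e\<in>EV. \<Sum>f\<in>EV. (z e * ?o e) * (z f * ?o f)) + (\<Sum>e\<in>EV. \<Sum>f\<in>EV. (z e * ?o e) * (z f * ph True f))
      + (\<Sum>e\<in>EV. \<Sum>f\<in>EV. (z e * ?o e) * (z f * ph False f)) + (\<Sum>e\<in>EV. \<Sum>f\<in>EV. (z e * ph True e) * (z f * ?o f))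
      + (\<Sum>e\<in>EV. \<Sum>f\<in>EV. (z e * ph False e) * (z f * ?o f)) + (\<Sum>e\<in>EV. \<Sum>f\<in>EV. (z e * ph True e) * (z f * ph False f))
      + (\<Sum>e\<in>EV. \<Sum>f\<in>EV. (z e * ph False e) * (z f * ph True f)) + b True + b False"
    unfolding b_def sum.distrib[symmetric] moment_matrix_expand by (intro sum.cong refl) (simp add: algebra_simps)
  also have "\<dots> = q * q + q * m True + q * m False + m True * q + m False * q + m True * m False + m False * m True + b True + b False"
    by (simp only: sum_product[symmetric] q_def m_def)
  finally have "z0 * z0 + 2 * z0 * (\<Sum>e\<in>EV. z e * x e) + (\<Sum>e\<in>EV. \<Sum>f\<in>EV. z e * moment_matrix e f * z f)
    = (z0 + q + m True + m False)\<^sup>2 + (b True - (m True)\<^sup>2) + (b False - (m False)\<^sup>2)"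
    unfolding x1 by (simp add: power2_eq_square algebra_simps)
  then show ?thesis using mb[of True] mb[of False] by simp
qed

text \<open>Row \<open>e\<close> of a gadget edge is a multiple of the vector conditioned on
  \<open>e\<close>. The complementary row would mean conditioning on the absence of
  \<open>e\<close>, but by the star equation it is the sum of the rows of the other edges at one end
  of \<open>e\<close>, hence in the convex cone. For an edge of value 1 or 0 one of the two rows is
  zero and the other is row 0.\<close>

lemma N_plus_step:
  assumes cv: "convex_functions T" and self: "state_point \<in> T"
    and merged: "\<And>g e. e \<in> Al g \<Longrightarrow> restrict (merged_vector g e) EV \<in> T"
  shows "state_point \<in> N_plus EV T"
proof -
  let ?H = "hom_index EV"
  define X where "X i j = (case i of None \<Rightarrow> (case j of None \<Rightarrow> 1 | Some f \<Rightarrow> x f)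
     | Some e \<Rightarrow> (case j of None \<Rightarrow> x e | Some f \<Rightarrow> moment_matrix e f))" for i j
  have Xs [simp]: "X None None = 1" "X None (Some f) = x f" "X (Some e) None = x e" "X (Some e) (Some f) = moment_matrix e f" for e f
    by (simp_all add: X_def)
  have Hsum: "(\<Sum>i\<in>?H. F i) = F None + (\<Sum>e\<in>EV. F (Some e))" for F :: "nat set option \<Rightarrow> real"
    unfolding hom_index_def using finE by (simp add: sum.reindex)
  have sym: "symmetric_on ?H X"
    unfolding symmetric_on_def hom_index_def by (auto simp: moment_matrix_sym)
  have psd: "psd_on ?H X"
    unfolding psd_on_def
  proof
    fix a
    have "(\<Sum>i\<in>?H. \<Sum>j\<in>?H. a i * X i j * a j)
       = a None * a None + (\<Sum>e\<in>EV. a None * x e * a (Some e))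
        + ((\<Sum>e\<in>EV. a (Some e) * x e * a None) + (\<Sum>e\<in>EV. \<Sum>f\<in>EV. a (Some e) * moment_matrix e f * a (Some f)))"
      unfolding Hsum by (simp add: sum.distrib)
    also have "\<dots> = a None * a None + 2 * a None * (\<Sum>e\<in>EV. a (Some e) * x e)
        + (\<Sum>e\<in>EV. \<Sum>f\<in>EV. a (Some e) * moment_matrix e f * a (Some f))"
      by (simp add: sum_distrib_left mult_ac)
    also have "0 \<le> \<dots>" by (rule moment_matrix_psd)
    finally show "0 \<le> (\<Sum>i\<in>?H. \<Sum>j\<in>?H. a i * X i j * a j)" .
  qed
  have zero_cone: "y \<in> cone_over EV T" if "\<And>j. j \<in> ?H \<Longrightarrow> y j = 0" for y
    using self that by (intro cone_scale[of state_point T 0]) (auto simp: hom_index_def)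
  have X0: "X None \<in> cone_over EV T"
    using self by (intro cone_scale[of state_point T 1]) (auto simp: state_point_def)
  have row_Al: "X (Some e) \<in> cone_over EV T" if e: "e \<in> Al g" for e g
  proof (rule cone_scale[OF merged[OF e], of "ph g e"])
    have "e \<notin> Q" "ph (\<not> g) e = 0" using Al_notQ[OF e] ph_other[OF e] by auto
    then show "X (Some e) None = ph g e" by (cases g) (simp_all add: x_expand)
  qed (simp_all add: ph_nonneg moment_matrix_Al[OF e])
  have rows: "X (Some e) \<in> cone_over EV T \<and> (\<lambda>j. X None j - X (Some e) j) \<in> cone_over EV T" if e: "e \<in> EV" for e
  proof -
    consider "e \<in> Q" "e \<noteq> {s, t}" | g where "e \<in> Al g" | "\<not> (e \<in> Q \<and> e \<noteq> {s, t})" "\<And>g. e \<notin> Al g" by blast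
    then show ?thesis
    proof cases
      case 1
      then have "ph g e = 0" for g by (simp add: ph_Q)
      then have x1: "x e = 1" using 1 by (simp add: x_expand)
      have eq: "X (Some e) j = X None j" if "j \<in> ?H" for j
        using that x1 moment_matrix_Q[OF 1] by (auto simp: hom_index_def)
      have "X (Some e) \<in> cone_over EV T" by (rule cone_cong[OF _ X0]) (simp add: eq)
      moreover have "(\<lambda>j. X None j - X (Some e) j) \<in> cone_over EV T" by (rule zero_cone) (simp add: eq)
      ultimately show ?thesis ..
    next
      case 2
      then obtain a b where a: "e = {a, b}" "a \<in> U g" by (elim G.allowE)
      have st: "e \<in> G.star g a" using 2 a by (simp add: G.star_def)
      have fs: "finite (G.star g a)" by (simp add: G.star_def)
      have tot: "X None j = (\<Sum>f\<in>G.star g a. X (Some f) j)" if "j \<in> ?H" for j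
      proof -
        have "(\<Sum>f\<in>G.star g a. x f) = (\<Sum>f\<in>G.star g a. ph g f)"
        proof (rule sum.cong[OF refl])
          fix f assume "f \<in> G.star g a"
          then have f: "f \<in> Al g" by (simp add: G.star_def)
          have "f \<notin> Q" "ph (\<not> g) f = 0" using Al_notQ[OF f] ph_other[OF f] by auto
          then show "x f = ph g f" by (cases g) (simp_all add: x_expand)
        qed
        then show ?thesis using that G.edge_value_star1[OF a(2)] moment_matrix_star[OF _ a(2)] by (auto simp: hom_index_def)
      qed
      have "(\<lambda>j. \<Sum>f\<in>G.star g a - {e}. X (Some f) j) \<in> cone_over EV T"
        using fs self by (intro cone_sum[OF cv] row_Al) (auto simp: G.star_def)
      then have "(\<lambda>j. X None j - X (Some e) j) \<in> cone_over EV T"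
        by (rule cone_cong[rotated]) (simp add: tot sum.remove[OF fs st])
      then show ?thesis using row_Al[OF 2] by blast
    next
      case 3
      then have "ph g e = 0" for g by (simp add: G.edge_value_nonallow)
      then have x0: "x e = 0" using 3 by (simp add: x_expand)
      have eq: "X (Some e) j = 0" if "j \<in> ?H" for j
        using that x0 moment_matrix_zero[OF 3] by (auto simp: hom_index_def)
      have "(\<lambda>j. X None j - X (Some e) j) \<in> cone_over EV T" by (rule cone_cong[OF _ X0]) (simp add: eq)
      moreover have "X (Some e) \<in> cone_over EV T" by (rule zero_cone) (simp add: eq)
      ultimately show ?thesis by blast
    qed
  qed
  have cube: "state_point \<in> EV \<rightarrow>\<^sub>E {0..1}" by (auto simp: state_point_def x_bounds)
  show ?thesis
    unfolding N_plus_def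
    by (intro CollectI conjI exI[of _ X] cube sym psd) (use rows moment_matrix_diag in \<open>auto simp: state_point_def\<close>)
qed

section \<open>Merging within a state\<close>

lemma U_other: "v \<in> U g \<Longrightarrow> v \<notin> U (\<not> g)"
  using Udisj by (cases g) auto

lemma in_ends: "v \<in> U True \<union> U False \<longleftrightarrow> v \<in> U g \<or> v \<in> U (\<not> g)"
  by (cases g) auto

text \<open>Both gadgets need slack, although only one loses a path, because the bound
  \<open>R\<close> is common to both and grows by one.\<close>

context
  fixes g a b assumes ab: "a \<in> U g" "b \<in> U g" "a \<noteq> b" "b \<noteq> \<rho> g a" "\<rho> g b \<in> U g"
    and slack: "\<And>h. 400 * (R + 4) + 1 \<le> card (reps (U h) (\<rho> h))" "\<And>h. 1000001 \<le> card (reps (U h) (\<rho> h))"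
begin

lemma ab_Al: "{a, b} \<in> Al g"
  using ab by (simp add: G.pair_allowed)

definition "U' = U(g := U g - {a, b})"
definition "\<rho>' = \<rho>(g := merge_partner {a, b} (\<rho> g))"
definition "w' = w(g := merge_weight {a, b} (\<rho> g) (w g))"
text \<open>The class of \<open>b\<close> takes the label of \<open>a\<close>, not conversely:
  \<open>b\<close> ends an inside path, so its label does not occur in the other gadget and the
  labels there stay as they are.\<close>

definition "\<kappa>' = (\<lambda>x. if \<kappa> x = \<kappa> b then \<kappa> a else \<kappa> x)"

lemma U'_at: "U' g = U g - {a, b}" "U' (\<not> g) = U (\<not> g)"
  by (simp_all add: U'_def)

lemma \<rho>'_at: "\<rho>' g = merge_partner {a, b} (\<rho> g)" "\<rho>' (\<not> g) = \<rho> (\<not> g)"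
  by (simp_all add: \<rho>'_def)

lemma k_ab: "\<kappa> a \<noteq> \<kappa> b"
  using k_inj[OF ab(1,2)] ab by auto

lemma k_rb: "\<kappa> (\<rho> g b) = \<kappa> b" by (rule k_rho[OF ab(2,5)])

lemma k_a_cases: "c \<in> U g \<Longrightarrow> \<kappa> c = \<kappa> a \<Longrightarrow> c = a \<or> c = \<rho> g a"
  using k_inj[OF ab(1), of c] by metis

lemma k_b_cases: "c \<in> U g \<Longrightarrow> \<kappa> c = \<kappa> b \<Longrightarrow> c = b \<or> c = \<rho> g b"
  using k_inj[OF ab(2), of c] by metis

lemma no_b_partner: "d \<in> U (\<not> g) \<Longrightarrow> \<kappa> d \<noteq> \<kappa> b"
  using cross[OF ab(2)] ab(5) by auto

lemma rp: "\<rho> g b \<noteq> a" "\<rho> g b \<noteq> b" "\<rho> g a \<noteq> a" "\<rho> g a \<noteq> b" "\<rho> g a \<noteq> \<rho> g b"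
  using G.rho_b_ne[OF ab] G.rho_ab[OF ab] by auto

lemma rich': "rich_gadget (U' h) (\<rho>' h) (w' h) (R + 1)"
proof (cases "h = g")
  case True
  interpret m: gadget "U g - {a, b}" "merge_partner {a, b} (\<rho> g)" "merge_weight {a, b} (\<rho> g) (w g)"
    by (rule G.merged_gadget[OF ab])
  have c: "card (reps (U g - {a, b}) (merge_partner {a, b} (\<rho> g))) = card (reps (U g) (\<rho> g)) - 1"
    by (rule G.merged_card[OF ab_Al])
  show ?thesis
    unfolding True U'_def \<rho>'_def w'_def fun_upd_same
    by unfold_locales (use G.merged_weight[OF ab_Al] c slack[of g] in auto)
next
  case False
  have "(\<Sum>j\<in>reps (U h) (\<rho> h). w h j) \<le> R" by (rule G.weight_le)
  then show ?thesis
    unfolding U'_def \<rho>'_def w'_def fun_upd_other[OF False]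
    by unfold_locales (use slack[of h] in auto)
qed

lemma deg': "v \<in> V \<Longrightarrow> card {q \<in> insert {a, b} Q. v \<in> q} + (if v \<in> U' True \<union> U' False then 1 else 0) = 2"
proof -
  assume v: "v \<in> V"
  have nQ: "{a, b} \<notin> Q" by (rule Al_notQ[OF ab_Al])
  have ends: "v \<in> U' True \<union> U' False \<longleftrightarrow> v \<in> U' g \<or> v \<in> U' (\<not> g)" by (cases g) auto
  show ?thesis
  proof (cases "v \<in> {a, b}")
    case True
    then have vU: "v \<in> U g" using ab by auto
    have "{q \<in> insert {a, b} Q. v \<in> q} = insert {a, b} {q \<in> Q. v \<in> q}" using True by auto
    then have "card {q \<in> insert {a, b} Q. v \<in> q} = Suc (card {q \<in> Q. v \<in> q})" using finQ nQ by simp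
    moreover have "v \<notin> U' True \<union> U' False" using ends U'_at U_other[OF vU] True by auto
    moreover have "v \<in> U True \<union> U False" using in_ends[of v g] vU by blast
    ultimately show ?thesis using deg[OF v] by simp
  next
    case False
    then have "{q \<in> insert {a, b} Q. v \<in> q} = {q \<in> Q. v \<in> q}" by auto
    moreover have "v \<in> U' True \<union> U' False \<longleftrightarrow> v \<in> U True \<union> U False"
      unfolding ends in_ends[of v g] U'_at using False by blast
    ultimately show ?thesis using deg[OF v] by simp
  qed
qed

lemma rho'_in: "c \<in> U' g \<Longrightarrow> \<rho>' g c \<in> U' g \<longleftrightarrow> (if c = \<rho> g b then \<rho> g a \<in> U g else if c = \<rho> g a then True else \<rho> g c \<in> U g)"
proof -
  assume c: "c \<in> U' g"
  then have cU: "c \<in> U g" "c \<noteq> a" "c \<noteq> b" by (auto simp: U'_at)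
  consider "c = \<rho> g b" | "c = \<rho> g a" | "c \<noteq> \<rho> g b" "c \<noteq> \<rho> g a" by blast
  then show ?thesis
  proof cases
    case 1
    then show ?thesis using rp G.merge_partner_at[OF ab] by (simp add: U'_at \<rho>'_at)
  next
    case 2
    then show ?thesis using rp ab G.merge_partner_at[OF ab] by (simp add: U'_at \<rho>'_at)
  next
    case 3
    have "\<rho> g c \<noteq> a" "\<rho> g c \<noteq> b" using 3 G.rho_rho[OF cU(1)] by auto
    then show ?thesis using 3 G.merge_partner_at(3)[OF ab, of c] by (simp add: U'_at \<rho>'_at)
  qed
qed

lemma k_rho': "c \<in> U' h \<Longrightarrow> \<rho>' h c \<in> U' h \<Longrightarrow> \<kappa>' (\<rho>' h c) = \<kappa>' c"
proof (cases "h = g")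
  case True
  assume c: "c \<in> U' h" "\<rho>' h c \<in> U' h"
  then have cU: "c \<in> U g" "c \<noteq> a" "c \<noteq> b" using True by (auto simp: U'_at)
  consider "c = \<rho> g b" | "c = \<rho> g a" | "c \<noteq> \<rho> g b" "c \<noteq> \<rho> g a" by blast
  then show ?thesis
  proof cases
    case 1
    then have "\<rho> g a \<in> U g" using rho'_in[of c] c True by simp
    then have "\<kappa> (\<rho> g a) = \<kappa> a" by (rule k_rho[OF ab(1)])
    then show ?thesis using 1 True k_rb k_ab G.merge_partner_at[OF ab] by (simp add: \<rho>'_at \<kappa>'_def)
  next
    case 2
    then have "\<kappa> c = \<kappa> a" using k_rho[OF ab(1)] cU by simp
    then show ?thesis using 2 True k_rb k_ab G.merge_partner_at[OF ab] by (simp add: \<rho>'_at \<kappa>'_def)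
  next
    case 3
    then have "\<rho> g c \<in> U g" using rho'_in[of c] c True by simp
    then have "\<kappa> (\<rho> g c) = \<kappa> c" by (rule k_rho[OF cU(1)])
    then show ?thesis using 3 True G.merge_partner_at(3)[OF ab, of c] by (simp add: \<rho>'_at \<kappa>'_def)
  qed
next
  case False
  assume c: "c \<in> U' h" "\<rho>' h c \<in> U' h"
  have h: "h = (\<not> g)" using False by simp
  show ?thesis using c k_rho[of c "\<not> g"] unfolding h by (simp add: U'_at \<rho>'_at \<kappa>'_def)
qed

lemma k_inj': "c \<in> U' h \<Longrightarrow> d \<in> U' h \<Longrightarrow> \<kappa>' c = \<kappa>' d \<Longrightarrow> d = c \<or> d = \<rho>' h c"
proof (cases "h = g")
  case True
  assume cd: "c \<in> U' h" "d \<in> U' h" "\<kappa>' c = \<kappa>' d"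
  then have cU: "c \<in> U g" "c \<noteq> a" "c \<noteq> b" "d \<in> U g" "d \<noteq> a" "d \<noteq> b" using True by (auto simp: U'_at)
  have "\<kappa> c = \<kappa> d \<or> (\<kappa> c = \<kappa> b \<and> \<kappa> d = \<kappa> a) \<or> (\<kappa> c = \<kappa> a \<and> \<kappa> d = \<kappa> b)"
    using cd(3) unfolding \<kappa>'_def by (auto split: if_splits)
  then show ?thesis
  proof (elim disjE conjE)
    assume "\<kappa> c = \<kappa> d"
    then have *: "d = c \<or> d = \<rho> g c" by (rule k_inj[OF cU(1,4)])
    show ?thesis
    proof (cases "c = \<rho> g a \<or> c = \<rho> g b")
      case True
      then have "\<rho> g c = a \<or> \<rho> g c = b" using G.rho_rho ab by auto
      then show ?thesis using * cU by auto
    next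
      case False
      then show ?thesis using * \<open>h = g\<close> G.merge_partner_at(3)[OF ab, of c] by (simp add: \<rho>'_at)
    qed
  next
    assume "\<kappa> c = \<kappa> b" "\<kappa> d = \<kappa> a"
    then have "c = \<rho> g b" "d = \<rho> g a" using k_b_cases[of c] k_a_cases[of d] cU by auto
    then show ?thesis using True G.merge_partner_at[OF ab] by (simp add: \<rho>'_at)
  next
    assume "\<kappa> c = \<kappa> a" "\<kappa> d = \<kappa> b"
    then have "c = \<rho> g a" "d = \<rho> g b" using k_a_cases[of c] k_b_cases[of d] cU by auto
    then show ?thesis using True G.merge_partner_at[OF ab] by (simp add: \<rho>'_at)
  qed
next
  case False
  assume cd: "c \<in> U' h" "d \<in> U' h" "\<kappa>' c = \<kappa>' d"
  have h: "h = (\<not> g)" using False by simp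
  have U: "c \<in> U (\<not> g)" "d \<in> U (\<not> g)" using cd unfolding h by (simp_all add: U'_at)
  then have "\<kappa> c = \<kappa> d" using cd(3) no_b_partner[of c] no_b_partner[of d] by (simp add: \<kappa>'_def)
  then show ?thesis using k_inj[OF U] unfolding h by (simp add: \<rho>'_at)
qed

lemma cross': "c \<in> U' h \<Longrightarrow> (\<exists>d\<in>U' (\<not> h). \<kappa>' d = \<kappa>' c) \<longleftrightarrow> \<rho>' h c \<notin> U' h"
proof (cases "h = g")
  case True
  assume c: "c \<in> U' h"
  then have cU: "c \<in> U g" "c \<noteq> a" "c \<noteq> b" using True by (auto simp: U'_at)
  have kd: "\<kappa>' d = \<kappa> d" if "d \<in> U (\<not> g)" for d using no_b_partner[OF that] by (simp add: \<kappa>'_def)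
  then have L: "(\<exists>d\<in>U' (\<not> h). \<kappa>' d = \<kappa>' c) \<longleftrightarrow> (\<exists>d\<in>U (\<not> g). \<kappa> d = \<kappa>' c)"
    using True by (auto simp: U'_at)
  have Rr: "\<rho>' h c \<notin> U' h \<longleftrightarrow> \<not> (if c = \<rho> g b then \<rho> g a \<in> U g else if c = \<rho> g a then True else \<rho> g c \<in> U g)"
    using rho'_in[of c] c True by simp
  consider "c = \<rho> g b" | "c = \<rho> g a" "c \<noteq> \<rho> g b" | "c \<noteq> \<rho> g b" "c \<noteq> \<rho> g a" by blast
  then show ?thesis
  proof cases
    case 1
    then have "\<kappa>' c = \<kappa> a" using k_rb by (simp add: \<kappa>'_def)
    then show ?thesis unfolding L Rr using cross[OF ab(1)] 1 by simp
  next
    case 2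
    then have ka: "\<kappa> c = \<kappa> a" using k_rho[OF ab(1)] cU by simp
    then have "\<kappa>' c = \<kappa> a" using k_ab by (simp add: \<kappa>'_def)
    moreover have "\<rho> g a \<in> U g" using 2 cU by simp
    ultimately show ?thesis unfolding L Rr using cross[OF ab(1)] 2 by simp
  next
    case 3
    have "\<kappa> c \<noteq> \<kappa> b" using k_b_cases[of c] 3 cU by auto
    then have "\<kappa>' c = \<kappa> c" by (simp add: \<kappa>'_def)
    then show ?thesis unfolding L Rr using cross[OF cU(1)] 3 by simp
  qed
next
  case False
  assume c: "c \<in> U' h"
  have h: "h = (\<not> g)" using False by simp
  have cU: "c \<in> U (\<not> g)" using c unfolding h by (simp add: U'_at)
  have kc: "\<kappa>' c = \<kappa> c" using no_b_partner[OF cU] by (simp add: \<kappa>'_def)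
  have "(\<exists>d\<in>U g - {a, b}. \<kappa>' d = \<kappa> c) \<longleftrightarrow> (\<exists>d\<in>U g. \<kappa> d = \<kappa> c)"
  proof
    assume "\<exists>d\<in>U g - {a, b}. \<kappa>' d = \<kappa> c"
    then obtain d where d: "d \<in> U g" "\<kappa>' d = \<kappa> c" by auto
    show "\<exists>d\<in>U g. \<kappa> d = \<kappa> c"
    proof (cases "\<kappa> d = \<kappa> b")
      case True
      then show ?thesis using d ab(1) by (auto simp: \<kappa>'_def)
    next
      case False
      then show ?thesis using d by (auto simp: \<kappa>'_def)
    qed
  next
    assume "\<exists>d\<in>U g. \<kappa> d = \<kappa> c"
    then obtain d where d: "d \<in> U g" "\<kappa> d = \<kappa> c" by auto
    have db: "\<kappa> d \<noteq> \<kappa> b" using d(2) no_b_partner[OF cU] by simp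
    then have k: "\<kappa>' d = \<kappa> c" using d by (simp add: \<kappa>'_def)
    show "\<exists>d\<in>U g - {a, b}. \<kappa>' d = \<kappa> c"
    proof (cases "d = a")
      \<comment> \<open>The path leaving at \<open>a\<close> has been extended; its end in this
        gadget is now \<open>\<rho> g b\<close>, which carries the same new label.\<close>
      case True
      then have "\<kappa>' (\<rho> g b) = \<kappa> c" using k_rb d by (simp add: \<kappa>'_def)
      then show ?thesis using rp ab(5) by blast
    next
      case False
      moreover have "d \<noteq> b" using db by auto
      ultimately show ?thesis using d k by blast
    qed
  qed
  then show ?thesis using cross[OF cU] kc unfolding h by (simp add: U'_at \<rho>'_at)
qed

lemma k_ex': "v \<in> V \<Longrightarrow> \<exists>h. \<exists>c\<in>U' h. \<kappa>' v = \<kappa>' c"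
proof -
  assume v: "v \<in> V"
  obtain h c where c: "c \<in> U h" "\<kappa> v = \<kappa> c" using k_ex[OF v] by auto
  show ?thesis
  proof (cases "c \<in> U' h")
    case True
    have "\<kappa>' v = \<kappa>' c" using c(2) by (simp add: \<kappa>'_def)
    then show ?thesis using True by blast
  next
    case False
    then have "h = g" "c = a \<or> c = b" using c(1) by (auto simp: U'_def split: if_splits)
    then have "\<kappa>' v = \<kappa>' (\<rho> g b)" using c(2) k_rb k_ab by (auto simp: \<kappa>'_def)
    moreover have "\<rho> g b \<in> U' g" using rp ab(5) by (auto simp: U'_at)
    ultimately show ?thesis by blast
  qed
qed

lemma conn':
  assumes nc: "\<And>q. q \<in> insert {a, b} Q \<Longrightarrow> q \<subseteq> S \<or> q \<inter> S = {}" and xy: "y \<in> V" "z \<in> V" "\<kappa>' y = \<kappa>' z" "y \<in> S"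
  shows "z \<in> S"
proof -
  have cl: "v \<in> S" if "u \<in> V" "v \<in> V" "\<kappa> u = \<kappa> v" "u \<in> S" for u v
  proof (rule conn[of S u v])
    show "q \<subseteq> S \<or> q \<inter> S = {}" if "q \<in> Q" for q using nc[of q] that by simp
  qed (fact that)+
  have iff: "a \<in> S \<longleftrightarrow> b \<in> S" using nc[of "{a, b}"] by auto
  have abV: "a \<in> V" "b \<in> V" using ab UV by auto
  consider "\<kappa> y = \<kappa> z" | "\<kappa> y = \<kappa> b" "\<kappa> z = \<kappa> a" | "\<kappa> y = \<kappa> a" "\<kappa> z = \<kappa> b"
    using xy(3) unfolding \<kappa>'_def by (auto split: if_splits)
  then show ?thesis
  proof cases
    case 1 then show ?thesis using cl[OF xy(1,2)] xy(4) by simp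
  next
    case 2
    then have "b \<in> S" using cl[OF xy(1) abV(2)] xy(4) by simp
    then show ?thesis using cl[OF abV(1) xy(2)] 2 iff by simp
  next
    case 3
    then have "a \<in> S" using cl[OF xy(1) abV(1)] xy(4) by simp
    then show ?thesis using cl[OF abV(2) xy(2)] 3 iff by simp
  qed
qed

lemma merged_state_ab: "matching_state V s t (insert {a, b} Q) U' \<rho>' w' \<kappa>' (R + 1)"
proof (rule matching_state.intro)
  show "insert {a, b} Q \<subseteq> EV" using QE Al_E[OF ab_Al] by simp
  show "{s, t} \<in> insert {a, b} Q" using stQ by simp
  show "rich_gadget (U' h) (\<rho>' h) (w' h) (R + 1)" for h by (rule rich')
  show "U' h \<subseteq> V" for h using UV[of h] UV[of g] by (auto simp: U'_def)
  show "U' True \<inter> U' False = {}" using Udisj by (auto simp: U'_def)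
  show "card {q \<in> insert {a, b} Q. v \<in> q} + (if v \<in> U' True \<union> U' False then 1 else 0) = 2" if "v \<in> V" for v
    by (rule deg'[OF that])
  show "\<kappa>' y = \<kappa>' z" if "q \<in> insert {a, b} Q" "y \<in> q" "z \<in> q" for q y z
  proof (cases "q = {a, b}")
    case True
    then show ?thesis using that by (auto simp: \<kappa>'_def)
  next
    case False
    then have "\<kappa> y = \<kappa> z" using k_edge[of q y z] that by simp
    then show ?thesis by (simp add: \<kappa>'_def)
  qed
qed (fact finV st_ne k_rho' k_inj' cross' k_ex' conn')+

end

lemma merged_state:
  assumes e: "e \<in> Al g"
    and slack: "\<And>h. 400 * (R + 4) + 1 \<le> card (reps (U h) (\<rho> h))" "\<And>h. 1000001 \<le> card (reps (U h) (\<rho> h))"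
  shows "\<exists>\<kappa>'. matching_state V s t (insert e Q) (U(g := U g - e)) (\<rho>(g := merge_partner e (\<rho> g))) (w(g := merge_weight e (\<rho> g) (w g))) \<kappa>' (R + 1)"
proof -
  obtain a b where ab: "e = {a, b}" "a \<in> U g" "b \<in> U g" "a \<noteq> b" "b \<noteq> \<rho> g a" "\<rho> g b \<in> U g"
    using e by (rule G.allowE)
  show ?thesis
    using merged_state_ab[OF ab(2-6) slack] unfolding U'_def[OF ab(2-6) slack] \<rho>'_def[OF ab(2-6) slack] w'_def[OF ab(2-6) slack] ab(1) by blast
qed

lemma state_vector_merged:
  assumes e: "e \<in> Al g"
  shows "state_vector s t (insert e Q) (U(g := U g - e)) (\<rho>(g := merge_partner e (\<rho> g))) (w(g := merge_weight e (\<rho> g) (w g))) f = merged_vector g e f"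
proof -
  have "e \<notin> Q" "e \<noteq> {s, t}" using Al_notQ[OF e] stQ by auto
  then show ?thesis by (auto simp: state_vector_def merged_vector_def sum_bool[of _ g])
qed

end

text \<open>The induction covers all states at once. A round raises \<open>R\<close> by one, lowers
  \<open>r\<close> by one and costs one path; the hypothesis is arranged to reproduce itself under
  this exchange.\<close>

theorem state_vector_in_N_plus_power:
  assumes "matching_state V s t Q U \<rho> w \<kappa> R"
    and "\<And>h. 400 * (R + r + 3) + r \<le> card (reps (U h) (\<rho> h))" "\<And>h. 1000000 + r \<le> card (reps (U h) (\<rho> h))"
  shows "restrict (state_vector s t Q U \<rho> w) (complete_edges V) \<in> (N_plus (complete_edges V) ^^ r) (SP V (complete_edges V) s t)"
  using assms
proof (induction r arbitrary: Q U \<rho> w \<kappa> R)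
  case 0
  interpret matching_state V s t Q U \<rho> w \<kappa> R by (rule 0(1))
  show ?case using state_point_in_SP by (simp only: state_point_def funpow.simps(1) id_apply)
next
  case (Suc r)
  interpret matching_state V s t Q U \<rho> w \<kappa> R by (rule Suc.prems(1))
  let ?T = "(N_plus EV ^^ r) (SP V EV s t)"
  have "state_point \<in> N_plus EV ?T"
  proof (rule N_plus_step)
    show "convex_functions ?T" by (intro convex_functions_N_plus_power convex_functions_SP)
    show "state_point \<in> ?T" unfolding state_point_def
    proof (rule Suc.IH[OF Suc.prems(1)])
      show "400 * (R + r + 3) + r \<le> card (reps (U h) (\<rho> h))" "1000000 + r \<le> card (reps (U h) (\<rho> h))" for h
        using Suc.prems(2,3)[of h] by simp_all
    qed
    fix g e assume e: "e \<in> Al g"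
    let ?U = "U(g := U g - e)" and ?\<rho> = "\<rho>(g := merge_partner e (\<rho> g))" and ?w = "w(g := merge_weight e (\<rho> g) (w g))"
    have sl: "400 * (R + 4) + 1 \<le> card (reps (U h) (\<rho> h))" "1000001 \<le> card (reps (U h) (\<rho> h))" for h
      using Suc.prems(2,3)[of h] by simp_all
    obtain \<kappa>' where k: "matching_state V s t (insert e Q) ?U ?\<rho> ?w \<kappa>' (R + 1)"
      using merged_state[OF e sl] by blast
    have c: "card (reps (U g) (\<rho> g)) - 1 \<le> card (reps (?U h) (?\<rho> h)) \<or> h \<noteq> g" for h
      using G.merged_card[OF e] by simp
    have "restrict (state_vector s t (insert e Q) ?U ?\<rho> ?w) EV \<in> ?T"
    proof (rule Suc.IH[OF k])
      fix h
      show "400 * (R + 1 + r + 3) + r \<le> card (reps (?U h) (?\<rho> h))" "1000000 + r \<le> card (reps (?U h) (?\<rho> h))"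
        using Suc.prems(2,3)[of h] Suc.prems(2,3)[of g] G.merged_card[OF e] by (cases "h = g"; simp)+
    qed
    then show "restrict (merged_vector g e) EV \<in> ?T" by (simp only: state_vector_merged[OF e] restrict_def)
  qed
  then show ?case by (simp only: state_point_def funpow.simps(2) o_apply)
qed

section \<open>The instances\<close>

text \<open>With \<open>s = 0\<close>, the two chains are the odd numbers from \<open>1\<close> to \<open>2 * L + 1\<close> and the even
  numbers from \<open>2\<close> to \<open>2 * L + 2\<close>, and \<open>T\<close> is the vertex \<open>t\<close>. The matched clique vertices are
  \<open>{bl..<br}\<close> on the side of \<open>s\<close> and \<open>{br..<n}\<close> on the side of \<open>t\<close>, where consecutive numbers
  \<open>2 * k\<close> and \<open>2 * k + 1\<close> are matched. The three unpaired vertices of a clique are the first,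
  respectively last, vertices of the chains and \<open>s\<close>, respectively \<open>t\<close>.\<close>

locale instance_data =
  fixes L m :: nat
  assumes L1: "1 \<le> L" and m_large: "1000000 \<le> m"
begin

definition "bl = 2 * L + 4"
definition "br = bl + 2 * m"
definition "n = br + 2 * m"
definition "V = {..<n}"
definition "T = 2 * L + 3"
definition "side_ends g = (if g then {2 * L + 1, 2 * L + 2, T} \<union> {br..<n} else {0, 1, 2} \<union> {bl..<br})" for g :: bool
text \<open>The three pairs of small numbers are the ends of the paths from one clique to the other.
  One of these paths is the virtual edge between \<open>0\<close> and \<open>T\<close>.\<close>

definition "partner x = (if x \<ge> bl then (if even x then x + 1 else x - 1) else if x = 0 then T else if x = T then 0
   else if x \<le> 2 then x + 2 * L else x - 2 * L)" for x :: nat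
definition "fixed_edges = insert {0, T} ({{x, x + 2} |x. 1 \<le> x \<and> x \<le> 2 * L} \<union> {{x, x + 1} |x. even x \<and> bl \<le> x \<and> x < n})"
text \<open>A matched pair is labelled by its even member, which is at least 4, so that 0, 1 and 2
  remain for the virtual edge and the two chains.\<close>

definition "label x = (if x \<ge> bl then x - x mod 2 else if x = 0 \<or> x = T then 0 else if odd x then 1 else 2)" for x :: nat

lemmas bds = bl_def br_def n_def T_def

lemma even_bl: "even bl" "even br" "even n" by (simp_all add: bds)

lemma partner_big: "x \<ge> bl \<Longrightarrow> partner x = (if even x then x + 1 else x - 1)" by (simp add: partner_def)

lemma partner_big_range:
  assumes "even lo" "even hi" "bl \<le> lo" "lo \<le> x" "x < hi"
  shows "lo \<le> partner x" "partner x < hi" "partner (partner x) = x" "partner x \<noteq> x"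
proof -
  have x: "bl \<le> x" using assms by simp
  have "lo \<le> partner x \<and> partner x < hi \<and> partner (partner x) = x \<and> partner x \<noteq> x"
  proof (cases "even x")
    case True
    have "x + 1 < hi"
    proof (rule ccontr)
      assume "\<not> x + 1 < hi"
      then have "hi = Suc x" using assms by simp
      then show False using True assms(2) by simp
    qed
    moreover have "partner x = x + 1" using partner_big[OF x] True by simp
    moreover have "partner (x + 1) = x" using partner_big[of "x + 1"] x True by simp
    ultimately show ?thesis using assms by simp
  next
    case False
    have "lo \<noteq> x" using False assms(1) by blast
    then have x1: "lo \<le> x - 1" "0 < x" "even (x - 1)" "bl \<le> x - 1" using assms False by simp_all
    have "partner x = x - 1" using partner_big[OF x] False by simp
    moreover have "partner (x - 1) = x" using partner_big[OF x1(4)] x1 by simp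
    moreover have "x - 1 < hi" "x - 1 \<noteq> x" using x1(2) assms(5) by linarith+
    ultimately show ?thesis using x1(1) by simp
  qed
  then show "lo \<le> partner x" "partner x < hi" "partner (partner x) = x" "partner x \<noteq> x" by auto
qed

lemma partner_small: "partner 0 = T" "partner T = 0" "partner 1 = 2 * L + 1" "partner 2 = 2 * L + 2" "partner (2 * L + 1) = 1" "partner (2 * L + 2) = 2"
  using L1 by (auto simp: partner_def bds)

lemma small_in: "T < bl" "2 * L + 1 < bl" "2 * L + 2 < bl" "2 < bl" "bl \<le> br" "br \<le> n" "2 < 2 * L + 1"
  using L1 by (auto simp: bds)

lemma side_ends_small:
  "0 \<in> side_ends False" "1 \<in> side_ends False" "2 \<in> side_ends False" "T \<notin> side_ends False" "2 * L + 1 \<notin> side_ends False" "2 * L + 2 \<notin> side_ends False"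
  "0 \<notin> side_ends True" "1 \<notin> side_ends True" "2 \<notin> side_ends True" "T \<in> side_ends True" "2 * L + 1 \<in> side_ends True" "2 * L + 2 \<in> side_ends True"
  using L1 by (auto simp: side_ends_def bds)

lemma side_ends_cases:
  assumes "x \<in> side_ends g"
  obtains "\<not> g" "x \<in> {0, 1, 2}" | "g" "x \<in> {2 * L + 1, 2 * L + 2, T}"
    | lo hi where "even lo" "even hi" "bl \<le> lo" "lo \<le> x" "x < hi" "{lo..<hi} \<subseteq> side_ends g" "{lo..<hi} \<inter> side_ends (\<not> g) = {}"
proof (cases g)
  case True
  show ?thesis
  proof (cases "x \<in> {2 * L + 1, 2 * L + 2, T}")
    case True
    then show ?thesis using that(2) \<open>g\<close> by blast
  next
    case False
    then have "br \<le> x" "x < n" using assms True by (auto simp: side_ends_def)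
    then show ?thesis using that(3)[of br n] True even_bl small_in by (auto simp: side_ends_def)
  qed
next
  case False
  show ?thesis
  proof (cases "x \<in> {0, 1, 2}")
    case True
    then show ?thesis using that(1) \<open>\<not> g\<close> by blast
  next
    case F: False
    then have "bl \<le> x" "x < br" using assms False by (auto simp: side_ends_def)
    then show ?thesis using that(3)[of bl br] False even_bl small_in by (auto simp: side_ends_def)
  qed
qed

lemma partner_props:
  assumes x: "x \<in> side_ends g"
  shows "partner (partner x) = x" "partner x \<noteq> x" "partner x \<in> side_ends g \<longleftrightarrow> bl \<le> x"
proof -
  have "partner (partner x) = x \<and> partner x \<noteq> x \<and> (partner x \<in> side_ends g \<longleftrightarrow> bl \<le> x)"
    using x
  proof (cases rule: side_ends_cases)
    case 1
    then have g: "g = False" and x: "x = 0 \<or> x = 1 \<or> x = 2" by auto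
    show ?thesis
      using x
    proof (elim disjE)
      assume "x = 0"
      then show ?thesis unfolding g using partner_small(1,2) side_ends_small(4) by (simp add: T_def bl_def)
    next
      assume "x = 1"
      then show ?thesis unfolding g using partner_small(3,5) side_ends_small(5) L1 by (simp add: bl_def)
    next
      assume "x = 2"
      then show ?thesis unfolding g using partner_small(4,6) side_ends_small(6) L1 by (simp add: bl_def)
    qed
  next
    case 2
    then have g: "g = True" and x: "x = 2 * L + 1 \<or> x = 2 * L + 2 \<or> x = T" by auto
    show ?thesis
      using x
    proof (elim disjE)
      assume "x = 2 * L + 1"
      then show ?thesis unfolding g using partner_small(3,5) side_ends_small(8) L1 by (simp add: bl_def)
    next
      assume "x = 2 * L + 2"
      then show ?thesis unfolding g using partner_small(4,6) side_ends_small(9) L1 by (simp add: bl_def)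
    next
      assume "x = T"
      then show ?thesis unfolding g using partner_small(1,2) side_ends_small(7) by (simp add: T_def bl_def)
    qed
  next
    case (3 lo hi)
    note r = partner_big_range[OF 3(1-5)]
    then have "partner x \<in> {lo..<hi}" by simp
    then have "partner x \<in> side_ends g" "bl \<le> x" using 3 by auto
    then show ?thesis using r by simp
  qed
  then show "partner (partner x) = x" "partner x \<noteq> x" "partner x \<in> side_ends g \<longleftrightarrow> bl \<le> x" by blast+
qed

lemma side_ends_V: "side_ends g \<subseteq> V"
  by (auto simp: side_ends_def V_def bds)

lemma side_ends_disj: "side_ends True \<inter> side_ends False = {}"
proof (rule equals0I)
  fix x assume "x \<in> side_ends True \<inter> side_ends False"
  then have x: "x \<in> side_ends True" "x \<in> side_ends False" by simp_all
  have "x \<in> {2 * L + 1, 2 * L + 2, T} \<or> br \<le> x" using x(1) by (auto simp: side_ends_def)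
  moreover have "x \<le> 2 \<or> bl \<le> x \<and> x < br" using x(2) by (auto simp: side_ends_def)
  ultimately have "x = 2 * L + 1 \<or> x = 2 * L + 2 \<or> x = T \<or> br \<le> x" "x \<le> 2 \<or> bl \<le> x \<and> x < br"
    by blast+
  then show False using small_in L1 T_def by linarith
qed

lemma exterior_ends_side_ends: "exterior_ends (side_ends g) partner = (if g then {2 * L + 1, 2 * L + 2, T} else {0, 1, 2})"
proof -
  have "x \<in> exterior_ends (side_ends g) partner \<longleftrightarrow> x \<in> side_ends g \<and> \<not> bl \<le> x" for x
    using partner_props(3)[of x g] by (auto simp: exterior_ends_def)
  then have "exterior_ends (side_ends g) partner = {x \<in> side_ends g. \<not> bl \<le> x}" by blast
  also have "\<dots> = (if g then {2 * L + 1, 2 * L + 2, T} else {0, 1, 2})"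
  proof (cases g)
    case True
    have "x \<in> side_ends True \<and> \<not> bl \<le> x \<longleftrightarrow> x \<in> {2 * L + 1, 2 * L + 2, T}" for x
    proof
      assume "x \<in> side_ends True \<and> \<not> bl \<le> x"
      then show "x \<in> {2 * L + 1, 2 * L + 2, T}" using small_in(5) by (auto simp: side_ends_def)
    next
      assume "x \<in> {2 * L + 1, 2 * L + 2, T}"
      then show "x \<in> side_ends True \<and> \<not> bl \<le> x" using side_ends_small(10-12) small_in(1-3) by auto
    qed
    then show ?thesis using True by (intro set_eqI) simp
  next
    case False
    have "x \<in> side_ends False \<and> \<not> bl \<le> x \<longleftrightarrow> x \<in> {0, 1, 2}" for x
    proof
      assume "x \<in> side_ends False \<and> \<not> bl \<le> x"
      then show "x \<in> {0, 1, 2}" by (auto simp: side_ends_def)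
    next
      assume "x \<in> {0, 1, 2}"
      then show "x \<in> side_ends False \<and> \<not> bl \<le> x" using side_ends_small(1-3) by (auto simp: bl_def)
    qed
    then show ?thesis using False by (intro set_eqI) simp
  qed
  finally show ?thesis .
qed

lemma gadget_side_ends: "gadget (side_ends g) partner (\<lambda>_. 0)"
proof (rule gadget.intro)
  show "finite (side_ends g)" by (simp add: side_ends_def)
  show "card (exterior_ends (side_ends g) partner) = 3" unfolding exterior_ends_side_ends by (cases g) (simp_all add: T_def)
  show "partner (partner x) = x" if "x \<in> side_ends g" for x by (rule partner_props(1)[OF that])
  show "partner x \<noteq> x" if "x \<in> side_ends g" for x by (rule partner_props(2)[OF that])
qed (rule refl)

lemma card_side_ends: "card (side_ends g) = 2 * m + 3"
proof (cases g)
  case True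
  have "card ({2 * L + 1, 2 * L + 2, T} \<union> {br..<n}) = card {2 * L + 1, 2 * L + 2, T} + card {br..<n}"
    using small_in by (intro card_Un_disjoint) auto
  then show ?thesis using True by (simp add: side_ends_def T_def n_def)
next
  case False
  have "card ({0, 1, 2} \<union> {bl..<br}) = card {0, 1, 2::nat} + card {bl..<br}"
    using small_in by (intro card_Un_disjoint) auto
  then show ?thesis using False by (simp add: side_ends_def br_def)
qed

lemma card_reps_side_ends: "card (reps (side_ends g) partner) = m"
  using gadget.card_A[OF gadget_side_ends, of g] card_side_ends[of g] by simp

lemma rich_side_ends: "rich_gadget (side_ends g) partner (\<lambda>_. 0) 0"
proof (intro rich_gadget.intro gadget_side_ends rich_gadget_axioms.intro)
  show "400 * (0 + 3) \<le> card (reps (side_ends g) partner)" "1000000 \<le> card (reps (side_ends g) partner)"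
    unfolding card_reps_side_ends using m_large by auto
qed simp

lemma label_big: "bl \<le> z \<Longrightarrow> label z = z - z mod 2" by (simp add: label_def)

lemma label_big_ge: "bl \<le> z \<Longrightarrow> 4 \<le> label z"
proof -
  assume z: "bl \<le> z"
  then have "4 \<le> z" by (simp add: bl_def)
  then have "4 \<le> z - z mod 2" by presburger
  then show ?thesis using label_big[OF z] by simp
qed

lemma label_small_le: "z < bl \<Longrightarrow> label z \<le> 2" by (auto simp: label_def)

lemma label_same_side: "label x = label y \<Longrightarrow> bl \<le> x \<longleftrightarrow> bl \<le> y"
  using label_big_ge[of x] label_big_ge[of y] label_small_le[of x] label_small_le[of y] by linarith

lemma label_big_eq:
  assumes "bl \<le> x" "bl \<le> y" "label x = label y" shows "y = x \<or> y = partner x"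
proof -
  have e: "x - x mod 2 = y - y mod 2" using assms label_big by simp
  show ?thesis
  proof (cases "even x")
    case True
    then have "y = x \<or> y = x + 1" using e by presburger
    then show ?thesis using partner_big[OF assms(1)] True by simp
  next
    case False
    then have "y = x \<or> y = x - 1" using e by presburger
    then show ?thesis using partner_big[OF assms(1)] False by simp
  qed
qed

lemma label_small: "label 0 = 0" "label T = 0" "label 1 = 1" "label 2 = 2" "label (2 * L + 1) = 1" "label (2 * L + 2) = 2"
  using L1 by (auto simp: label_def bds)

lemma label_side_ends:
  assumes x: "x \<in> side_ends g" and y: "y \<in> side_ends g" and k: "label x = label y"
  shows "y = x \<or> y = partner x"
proof (cases "bl \<le> x")
  case True
  then show ?thesis using label_big_eq label_same_side[OF k] k by simp
next
  case False
  then have ny: "\<not> bl \<le> y" using label_same_side[OF k] by simp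
  have U: "z \<in> exterior_ends (side_ends g) partner" if "z \<in> side_ends g" "\<not> bl \<le> z" for z
    using that partner_props(3)[OF that(1)] by (simp add: exterior_ends_def)
  have "y = x" if "x \<in> {u, v, z}" "y \<in> {u, v, z}" "label u = 1" "label v = 2" "label z = 0" for u v z
    using that k by (elim insertE emptyE) simp_all
  note key = this
  have "x \<in> (if g then {2 * L + 1, 2 * L + 2, T} else {0, 1, 2})" "y \<in> (if g then {2 * L + 1, 2 * L + 2, T} else {0, 1, 2})"
    using U[OF x False] U[OF y ny] unfolding exterior_ends_side_ends .
  then show ?thesis
    using key[OF _ _ label_small(5,6,2)] key[of 1 2 0, OF _ _ label_small(3,4,1)] by (cases g) (simp_all add: insert_commute)
qed

lemma label_partner:
  assumes "x \<in> side_ends g" shows "label (partner x) = label x"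
proof (cases "bl \<le> x")
  case True
  have b: "bl \<le> partner x"
  proof (cases "even x")
    case False
    then have "bl \<noteq> x" using even_bl(1) by blast
    then have "bl \<le> x - 1" using True by linarith
    then show ?thesis unfolding partner_big[OF True] using False by (simp only: if_False)
  next
    case e: True
    show ?thesis unfolding partner_big[OF True] using True e by simp
  qed
  show ?thesis
  proof (cases "even x")
    case e: True
    have "partner x = x + 1" unfolding partner_big[OF True] using e by (simp only: if_True)
    moreover have "x + 1 - (x + 1) mod 2 = x - x mod 2" using e by (elim evenE) simp
    ultimately show ?thesis unfolding label_big[OF True] label_big[OF b] by (simp only:)
  next
    case e: False
    have "partner x = x - 1" unfolding partner_big[OF True] using e by (simp only: if_False)
    moreover have "x - 1 - (x - 1) mod 2 = x - x mod 2" using e by (elim oddE) simp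
    ultimately show ?thesis unfolding label_big[OF True] label_big[OF b] by (simp only:)
  qed
next
  case False
  then have "x \<in> {0, 1, 2} \<union> {2 * L + 1, 2 * L + 2, T}" using assms small_in(5) by (auto simp: side_ends_def split: if_splits)
  moreover have "label (partner 0) = label 0" "label (partner 1) = label 1" "label (partner 2) = label 2" "label (partner (2 * L + 1)) = label (2 * L + 1)"
    "label (partner (2 * L + 2)) = label (2 * L + 2)" "label (partner T) = label T"
    unfolding partner_small label_small by (rule refl)+
  ultimately show ?thesis by blast
qed

lemma fixed_edges_cases:
  assumes "q \<in> fixed_edges" "v \<in> q"
  shows "((v = 0 \<or> v = T) \<and> q = {0, T}) \<or> (1 \<le> v \<and> v \<le> 2 * L \<and> q = {v, v + 2})
     \<or> (3 \<le> v \<and> v \<le> 2 * L + 2 \<and> q = {v - 2, v}) \<or> (bl \<le> v \<and> q = {v, partner v})"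
proof -
  consider "q = {0, T}" | x where "q = {x, x + 2}" "1 \<le> x" "x \<le> 2 * L" | x where "q = {x, x + 1}" "even x" "bl \<le> x" "x < n"
    using assms(1) unfolding fixed_edges_def by blast
  then show ?thesis
  proof cases
    case 1
    then show ?thesis using assms(2) by blast
  next
    case 2
    then have "v = x \<or> v = x + 2" using assms(2) by blast
    then show ?thesis using 2 by auto
  next
    case 3
    then have "v = x \<or> v = x + 1" using assms(2) by blast
    then show ?thesis
    proof
      assume "v = x" then show ?thesis using 3 partner_big[of v] by simp
    next
      assume v: "v = x + 1"
      then have "partner v = x" using 3 partner_big[of v] by simp
      then show ?thesis using 3 v by (auto simp: insert_commute)
    qed
  qed
qed

lemma fixed_edges_intros:
  "{0, T} \<in> fixed_edges" "1 \<le> v \<Longrightarrow> v \<le> 2 * L \<Longrightarrow> {v, v + 2} \<in> fixed_edges" "3 \<le> v \<Longrightarrow> v \<le> 2 * L + 2 \<Longrightarrow> {v - 2, v} \<in> fixed_edges"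
  "bl \<le> v \<Longrightarrow> v < n \<Longrightarrow> {v, partner v} \<in> fixed_edges"
proof -
  show "{0, T} \<in> fixed_edges" by (simp add: fixed_edges_def)
  show up: "{v, v + 2} \<in> fixed_edges" if "1 \<le> v" "v \<le> 2 * L" for v using that by (auto simp: fixed_edges_def)
  show "{v - 2, v} \<in> fixed_edges" if "3 \<le> v" "v \<le> 2 * L + 2"
  proof -
    have "v - 2 + 2 = v" using that by simp
    then show ?thesis using up[of "v - 2"] that by simp
  qed
  show "{v, partner v} \<in> fixed_edges" if v: "bl \<le> v" "v < n"
  proof (cases "even v")
    case True
    then show ?thesis using v partner_big[OF v(1)] by (auto simp: fixed_edges_def)
  next
    case False
    then have "v \<noteq> bl" using even_bl by auto
    then have w: "bl \<le> v - 1" "v - 1 < n" "even (v - 1)" "v - 1 + 1 = v" using v False by auto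
    then have "{v - 1, v - 1 + 1} \<in> fixed_edges" unfolding fixed_edges_def by blast
    then have "{v - 1, v} \<in> fixed_edges" unfolding w(4) .
    then show ?thesis using partner_big[OF v(1)] False by (simp add: insert_commute)
  qed
qed

lemma fixed_edges_edges: "fixed_edges \<subseteq> complete_edges V"
proof
  fix q assume q: "q \<in> fixed_edges"
  then consider "q = {0, T}" | x where "q = {x, x + 2}" "1 \<le> x" "x \<le> 2 * L" | x where "q = {x, x + 1}" "even x" "bl \<le> x" "x < n"
    unfolding fixed_edges_def by blast
  then show "q \<in> complete_edges V"
  proof cases
    case 1
    then show ?thesis using small_in by (simp add: complete_edges_def V_def T_def)
  next
    case 2
    then show ?thesis using small_in by (simp add: complete_edges_def V_def bds)
  next
    case 3
    have "x + 1 \<noteq> n"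
    proof
      assume "x + 1 = n"
      then have "even (x + 1)" using even_bl(3) by simp
      then show False using 3(2) by simp
    qed
    then show ?thesis using 3 by (simp add: complete_edges_def V_def)
  qed
qed

lemma fixed_edges_degree:
  assumes v: "v \<in> V"
  shows "card {q \<in> fixed_edges. v \<in> q} + (if v \<in> side_ends True \<union> side_ends False then 1 else 0) = 2"
proof -
  have nv: "v < n" using v by (simp add: V_def)
  have "3 \<le> v" if "v \<noteq> 0" "v \<noteq> 1" "v \<noteq> 2" using that by linarith
  moreover have "v \<le> 2 * L" if "\<not> bl \<le> v" "v \<noteq> T" "v \<noteq> 2 * L + 1" "v \<noteq> 2 * L + 2"
    using that unfolding bds by linarith
  ultimately consider "v = 0 \<or> v = T" | "v = 1 \<or> v = 2" | "v = 2 * L + 1 \<or> v = 2 * L + 2" | "3 \<le> v" "v \<le> 2 * L" | "bl \<le> v"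
    by blast
  then show ?thesis
  proof cases
    case 1
    have "{q \<in> fixed_edges. v \<in> q} = {{0, T}}"
    proof (intro set_eqI iffI)
      fix q assume "q \<in> {q \<in> fixed_edges. v \<in> q}"
      then show "q \<in> {{0, T}}" using fixed_edges_cases[of q v] 1 by (auto simp: bds)
    qed (use 1 fixed_edges_intros in auto)
    then show ?thesis using 1 side_ends_small by auto
  next
    case 2
    have "{q \<in> fixed_edges. v \<in> q} = {{v, v + 2}}"
    proof (intro set_eqI iffI)
      fix q assume "q \<in> {q \<in> fixed_edges. v \<in> q}"
      then show "q \<in> {{v, v + 2}}" using fixed_edges_cases[of q v] 2 by (auto simp: bds)
    next
      fix q assume "q \<in> {{v, v + 2}}"
      then show "q \<in> {q \<in> fixed_edges. v \<in> q}" using fixed_edges_intros(2)[of v] 2 L1 by auto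
    qed
    then show ?thesis using 2 side_ends_small by auto
  next
    case 3
    have "{q \<in> fixed_edges. v \<in> q} = {{v - 2, v}}"
    proof (intro set_eqI iffI)
      fix q assume "q \<in> {q \<in> fixed_edges. v \<in> q}"
      then show "q \<in> {{v - 2, v}}" using fixed_edges_cases[of q v] 3 by (auto simp: bds)
    next
      fix q assume "q \<in> {{v - 2, v}}"
      then show "q \<in> {q \<in> fixed_edges. v \<in> q}" using fixed_edges_intros(3)[of v] 3 L1 by auto
    qed
    then show ?thesis using 3 side_ends_small by auto
  next
    case 4
    have "{q \<in> fixed_edges. v \<in> q} = {{v - 2, v}, {v, v + 2}}"
    proof (intro set_eqI iffI)
      fix q assume "q \<in> {q \<in> fixed_edges. v \<in> q}"
      then show "q \<in> {{v - 2, v}, {v, v + 2}}" using fixed_edges_cases[of q v] 4 by (auto simp: bds)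
    next
      fix q assume "q \<in> {{v - 2, v}, {v, v + 2}}"
      then show "q \<in> {q \<in> fixed_edges. v \<in> q}" using fixed_edges_intros(2,3)[of v] 4 by auto
    qed
    moreover have "{v - 2, v} \<noteq> {v, v + 2}" using 4 by (auto simp: doubleton_eq_iff)
    moreover have "v \<notin> side_ends True \<union> side_ends False" using 4 by (auto simp: side_ends_def bds)
    ultimately show ?thesis by simp
  next
    case 5
    have "{q \<in> fixed_edges. v \<in> q} = {{v, partner v}}"
    proof (intro set_eqI iffI)
      fix q assume "q \<in> {q \<in> fixed_edges. v \<in> q}"
      then show "q \<in> {{v, partner v}}" using fixed_edges_cases[of q v] 5 by (auto simp: bds)
    next
      fix q assume "q \<in> {{v, partner v}}"
      then show "q \<in> {q \<in> fixed_edges. v \<in> q}" using fixed_edges_intros(4)[of v] 5 nv by auto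
    qed
    moreover have "v \<in> side_ends True \<union> side_ends False" using 5 nv by (auto simp: side_ends_def)
    ultimately show ?thesis by simp
  qed
qed

lemma label_fixed_edges:
  assumes q: "q \<in> fixed_edges" and xy: "x \<in> q" "y \<in> q"
  shows "label x = label y"
proof -
  from q consider "q = {0, T}" | z where "q = {z, z + 2}" "1 \<le> z" "z \<le> 2 * L" | z where "q = {z, z + 1}" "even z" "bl \<le> z"
    unfolding fixed_edges_def by blast
  then show ?thesis
  proof cases
    case 1
    then show ?thesis using xy label_small by auto
  next
    case 2
    have "label (z + 2) = label z" using 2 by (auto simp: label_def bds)
    then show ?thesis using xy 2 by auto
  next
    case 3
    have "z + 1 - (z + 1) mod 2 = z - z mod 2" using 3(2) by presburger
    then have "label (z + 1) = label z" using label_big[of z] label_big[of "z + 1"] 3(3) by simp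
    then show ?thesis using xy 3 by auto
  qed
qed

lemma label_cross:
  assumes a: "a \<in> side_ends g"
  shows "(\<exists>b\<in>side_ends (\<not> g). label b = label a) \<longleftrightarrow> partner a \<notin> side_ends g"
proof (cases "bl \<le> a")
  case True
  have "label b \<noteq> label a" if b: "b \<in> side_ends (\<not> g)" for b
  proof
    assume k: "label b = label a"
    then have "b = a \<or> b = partner a" using label_big_eq[of a b] label_same_side[OF k] True by simp
    moreover have "partner a \<in> side_ends g" using partner_props(3)[OF a] True by simp
    ultimately have "b \<in> side_ends g" using a by auto
    then show False using b side_ends_disj by (cases g) auto
  qed
  then show ?thesis using partner_props(3)[OF a] True by auto
next
  case False
  then have "a \<in> (if g then {2 * L + 1, 2 * L + 2, T} else {0, 1, 2})"
    using a small_in by (auto simp: side_ends_def)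
  then have "partner a \<in> side_ends (\<not> g)" using partner_small side_ends_small by (cases g) auto
  then show ?thesis using label_partner[OF a] partner_props(3)[OF a] False by auto
qed

lemma label_ex:
  assumes v: "v \<in> V"
  shows "\<exists>g. \<exists>a\<in>side_ends g. label v = label a"
proof (cases "v \<in> side_ends True \<union> side_ends False")
  case True
  then obtain g where "v \<in> side_ends g" by (elim UnE) simp_all
  then show ?thesis by (intro exI[of _ g] bexI[of _ v]) simp_all
next
  case False
  then have "3 \<le> v" "v \<le> 2 * L" using v by (auto simp: side_ends_def V_def bds)
  then have "label v = label 1 \<or> label v = label 2" unfolding label_small by (auto simp: label_def bds)
  then show ?thesis
  proof
    assume "label v = label 1"
    then show ?thesis using side_ends_small(2) by (intro exI[of _ False] bexI[of _ 1])
  next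
    assume "label v = label 2"
    then show ?thesis using side_ends_small(3) by (intro exI[of _ False] bexI[of _ 2])
  qed
qed

text \<open>The labels 0, 1, 2 of the long paths are themselves vertices of their classes. Every
  small vertex is compared with this representative, in steps of two along its chain.\<close>

lemma label_connected:
  assumes nc: "\<And>q. q \<in> fixed_edges \<Longrightarrow> q \<subseteq> S \<or> q \<inter> S = {}" and xy: "x \<in> V" "y \<in> V" "label x = label y" "x \<in> S"
  shows "y \<in> S"
proof -
  have pair: "c \<in> S \<longleftrightarrow> d \<in> S" if "{c, d} \<in> fixed_edges" for c d
    using nc[OF that] by auto
  have chain: "z + 2 * i \<in> S \<longleftrightarrow> z \<in> S" if z: "1 \<le> z" and zi: "z + 2 * i \<le> 2 * L + 2" for z i
    using zi
  proof (induction i)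
    case (Suc i)
    have "{z + 2 * i, z + 2 * i + 2} \<in> fixed_edges" using Suc.prems z by (intro fixed_edges_intros(2)) auto
    then show ?case using pair[of "z + 2 * i" "z + 2 * i + 2"] Suc by simp
  qed simp
  have small: "z \<in> S \<longleftrightarrow> label z \<in> S" if z: "z < bl" for z
  proof -
    have "1 \<le> z" if "z \<noteq> 0" using that by simp
    moreover have "z \<le> 2 * L + 2" if "z \<noteq> T" using that z unfolding bds by linarith
    ultimately consider "z = 0" | "z = T" | "1 \<le> z" "z \<le> 2 * L + 2" by blast
    then show ?thesis
    proof cases
      case 2
      then show ?thesis using pair[OF fixed_edges_intros(1)] label_small by simp
    next
      case 3
      define r where "r = (if odd z then 1 else 2 :: nat)"
      have zr: "z = r + 2 * ((z - r) div 2)" using 3(1) unfolding r_def by presburger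
      have kz: "label z = r" using 3 by (auto simp: label_def r_def bds)
      have "1 \<le> r" by (simp add: r_def)
      then have "r + 2 * ((z - r) div 2) \<in> S \<longleftrightarrow> r \<in> S" using zr 3 by (intro chain) simp_all
      then show ?thesis using kz zr by simp
    qed (simp add: label_small)
  qed
  show ?thesis
  proof (cases "bl \<le> x")
    case True
    then have "y = x \<or> y = partner x" using label_big_eq label_same_side[OF xy(3)] xy(3) by simp
    moreover have "{x, partner x} \<in> fixed_edges" using fixed_edges_intros(4)[OF True] xy(1) by (simp add: V_def)
    ultimately show ?thesis using pair[of x "partner x"] xy(4) by auto
  next
    case False
    then show ?thesis using small[of x] small[of y] label_same_side[OF xy(3)] xy(3,4) by simp
  qed
qed

lemma instance_state: "matching_state V 0 T fixed_edges side_ends (\<lambda>_. partner) (\<lambda>_ _. 0) label 0"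
proof (rule matching_state.intro)
  show "finite V" by (simp add: V_def)
  show "fixed_edges \<subseteq> complete_edges V" by (rule fixed_edges_edges)
  show "{0, T} \<in> fixed_edges" by (rule fixed_edges_intros)
  show "0 \<noteq> T" by (simp add: T_def)
  show "rich_gadget (side_ends g) partner (\<lambda>_. 0) 0" for g by (rule rich_side_ends)
  show "side_ends g \<subseteq> V" for g by (rule side_ends_V)
  show "side_ends True \<inter> side_ends False = {}" by (rule side_ends_disj)
  show "card {q \<in> fixed_edges. v \<in> q} + (if v \<in> side_ends True \<union> side_ends False then 1 else 0) = 2" if "v \<in> V" for v
    by (rule fixed_edges_degree[OF that])
  show "label x = label y" if "q \<in> fixed_edges" "x \<in> q" "y \<in> q" for q x y by (rule label_fixed_edges[OF that])
  show "label (partner a) = label a" if "a \<in> side_ends g" for g a by (rule label_partner[OF that])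
  show "b = a \<or> b = partner a" if "a \<in> side_ends g" "b \<in> side_ends g" "label a = label b" for g a b by (rule label_side_ends[OF that])
  show "(\<exists>b\<in>side_ends (\<not> g). label b = label a) \<longleftrightarrow> partner a \<notin> side_ends g" if "a \<in> side_ends g" for g a by (rule label_cross[OF that])
  show "\<exists>g. \<exists>a\<in>side_ends g. label v = label a" if "v \<in> V" for v by (rule label_ex[OF that])
  show "y \<in> S" if "\<And>q. q \<in> fixed_edges \<Longrightarrow> q \<subseteq> S \<or> q \<inter> S = {}" "x \<in> V" "y \<in> V" "label x = label y" "x \<in> S" for S x y
    using that by (rule label_connected)
qed

end

section \<open>Hamiltonian paths and shortest paths\<close>

fun uses :: "'a set set \<Rightarrow> 'a list \<Rightarrow> nat" where
  "uses F (a # b # p) = (if {a, b} \<in> F then 1 else 0) + uses F (b # p)"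
| "uses F p = 0"

lemma uses_Un: "F \<inter> G = {} \<Longrightarrow> uses (F \<union> G) p = uses F p + uses G p"
  by (induction p rule: induct_list012) auto

lemma uses_empty: "uses {} p = 0"
  by (induction p rule: induct_list012) auto

lemma sum_uses: "finite F \<Longrightarrow> (\<Sum>h\<in>F. uses {h} p) = uses F p"
proof (induction F rule: finite_induct)
  case (insert h F)
  then show ?case using uses_Un[of "{h}" F p] by simp
qed (simp add: uses_empty)

lemma uses_le: "uses F p \<le> length p - 1"
proof (induction p rule: induct_list012)
  case (3 a b p)
  then show ?case by (cases "{a, b} \<in> F") auto
qed auto

lemma card_inter_doubleton: "a \<noteq> b \<Longrightarrow> card ({a, b} \<inter> S) = 1 \<longleftrightarrow> (a \<in> S) \<noteq> (b \<in> S)"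
  by (cases "a \<in> S"; cases "b \<in> S") auto

lemma complete_edgesE:
  assumes "e \<in> complete_edges V" obtains a b where "e = {a, b}" "a \<noteq> b" "a \<in> V" "b \<in> V"
proof -
  have "card e = 2" "e \<subseteq> V" using assms by (auto simp: complete_edges_def)
  then obtain a b where ab: "e = {a, b}" "a \<noteq> b" unfolding card_2_iff by blast
  then show ?thesis using \<open>e \<subseteq> V\<close> by (intro that[OF ab]) simp_all
qed

lemma doubleton_complete: "{a, b} \<in> complete_edges V \<longleftrightarrow> a \<in> V \<and> b \<in> V \<and> a \<noteq> b"
  by (cases "a = b") (simp_all add: complete_edges_def)

text \<open>Each use of a cut edge changes the side. This is needed for Hamiltonian paths in the
  complete graph and for shortest paths in the instance graph, whence the general
  \<open>H\<close>.\<close>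

lemma uses_cut_parity:
  assumes H: "H \<subseteq> complete_edges V" and p: "p \<noteq> []" "successively (\<lambda>u v. {u, v} \<in> H) p"
  shows "odd (uses (edge_cut H S) p) \<longleftrightarrow> (hd p \<in> S) \<noteq> (last p \<in> S)"
  using p
proof (induction p rule: induct_list012)
  case (3 a b p)
  have ab: "{a, b} \<in> H" using 3 by simp
  then have "a \<noteq> b" using subsetD[OF H ab] by (simp add: doubleton_complete)
  then have "{a, b} \<in> edge_cut H S \<longleftrightarrow> (a \<in> S) \<noteq> (b \<in> S)" using ab card_inter_doubleton[of a b S]
    by (simp add: edge_cut_def)
  moreover have "odd (uses (edge_cut H S) (b # p)) \<longleftrightarrow> (b \<in> S) \<noteq> (last (b # p) \<in> S)"
    using 3(2) 3(4) by simp
  ultimately show ?case by (cases "a \<in> S"; cases "b \<in> S") simp_all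
qed simp_all

lemma uses_cut_zero:
  assumes H: "H \<subseteq> complete_edges V" and p: "p \<noteq> []" "successively (\<lambda>u v. {u, v} \<in> H) p"
    and z: "uses (edge_cut H S) p = 0"
  shows "\<forall>v\<in>set p. v \<in> S \<longleftrightarrow> hd p \<in> S"
  using p z
proof (induction p rule: induct_list012)
  case (3 a b p)
  have ab: "{a, b} \<in> H" using 3 by simp
  then have "a \<noteq> b" using subsetD[OF H ab] by (simp add: doubleton_complete)
  then have "{a, b} \<in> edge_cut H S \<longleftrightarrow> (a \<in> S) \<noteq> (b \<in> S)" using ab card_inter_doubleton[of a b S]
    by (simp add: edge_cut_def)
  moreover have z: "{a, b} \<notin> edge_cut H S" "uses (edge_cut H S) (b # p) = 0" using 3(5) by (auto split: if_splits)
  ultimately have "a \<in> S \<longleftrightarrow> b \<in> S" by simp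
  moreover have "\<forall>v\<in>set (b # p). v \<in> S \<longleftrightarrow> hd (b # p) \<in> S"
    using 3(4) by (intro 3(2) z(2)) simp_all
  ultimately show ?case unfolding list.sel list.set(2) by blast
qed simp_all

lemma uses_not_subset: "\<not> e \<subseteq> set p \<Longrightarrow> uses {e} p = 0"
proof (induction p rule: induct_list012)
  case (3 a b p)
  then have "{a, b} \<noteq> e" "\<not> e \<subseteq> set (b # p)" by auto
  then show ?case using 3(2) by simp
qed auto

lemma uses_single_le_1: "distinct p \<Longrightarrow> uses {e} p \<le> 1"
proof (induction p rule: induct_list012)
  case (3 a b p)
  show ?case
  proof (cases "{a, b} = e")
    case True
    then have "\<not> e \<subseteq> set (b # p)" using 3(3) by auto
    then show ?thesis using uses_not_subset[of e "b # p"] by simp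
  qed (use 3 in auto)
qed auto

lemma successively_complete:
  "distinct p \<Longrightarrow> set p \<subseteq> V \<Longrightarrow> successively (\<lambda>u v. {u, v} \<in> complete_edges V) p"
  by (induction p rule: induct_list012) (auto simp: doubleton_complete)

lemma edge_cut_singleton: "edge_cut E {v} = {e \<in> E. v \<in> e}"
proof -
  have "card (e \<inter> {v}) = 1 \<longleftrightarrow> v \<in> e" for e by (cases "v \<in> e") auto
  then show ?thesis by (simp add: edge_cut_def)
qed

lemma uses_star_zero: "v \<notin> set p \<Longrightarrow> uses (edge_cut E {v}) p = 0"
proof (induction p rule: induct_list012)
  case (3 a b p)
  then have "{a, b} \<notin> edge_cut E {v}" by (simp add: edge_cut_singleton)
  then show ?case using 3 by simp
qed simp_all

lemma uses_star:
  assumes "distinct p" "set p \<subseteq> V" "v \<in> set p"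
  shows "uses (edge_cut (complete_edges V) {v}) p = (if v = hd p then 0 else 1) + (if v = last p then 0 else 1)"
  using assms
proof (induction p rule: induct_list012)
  case (3 a b p)
  have d: "a \<noteq> b" "a \<in> V" "b \<in> V" "a \<notin> set (b # p)" using 3(3,4) by simp_all
  then have ab: "{a, b} \<in> edge_cut (complete_edges V) {v} \<longleftrightarrow> v = a \<or> v = b"
    by (simp add: edge_cut_singleton doubleton_complete)
  have la: "a \<noteq> last (b # p)" using d(4) last_in_set[of "b # p"] by blast
  show ?case
  proof (cases "v = a")
    case True
    have "uses (edge_cut (complete_edges V) {v}) (b # p) = 0" using True d(4) by (intro uses_star_zero) simp
    then show ?thesis using ab True la by simp
  next
    case False
    then have "uses (edge_cut (complete_edges V) {v}) (b # p) = (if v = b then 0 else 1) + (if v = last (b # p) then 0 else 1)"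
      using 3(2) 3(3-5) by simp
    then show ?thesis using ab False by (cases "v = b") simp_all
  qed
qed simp_all

text \<open>Supplies a feasible point, so that the integral minimum is attained. A cut is used with
  the parity given by the ends of \<open>p\<close>, and at least once because \<open>p\<close>
  visits all vertices.\<close>

lemma path_in_SP_int:
  assumes fin: "finite V" and p: "distinct p" "set p = V" "p \<noteq> []" "hd p \<noteq> last p"
  shows "restrict (\<lambda>e. real (uses {e} p)) (complete_edges V) \<in> SP_int V (complete_edges V) (hd p) (last p)"
proof -
  let ?E = "complete_edges V" and ?x = "restrict (\<lambda>e. real (uses {e} p)) (complete_edges V)"
  have finE: "finite ?E" by (rule finite_subset[of _ "Pow V"]) (auto simp: complete_edges_def fin)
  have suc: "successively (\<lambda>u v. {u, v} \<in> ?E) p" using p by (intro successively_complete) auto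
  have x01: "?x \<in> ?E \<rightarrow>\<^sub>E {0, 1}"
  proof (rule PiE_I)
    fix e assume "e \<in> ?E"
    moreover have "uses {e} p = 0 \<or> uses {e} p = 1" using uses_single_le_1[OF p(1), of e] by linarith
    ultimately show "?x e \<in> {0, 1}" by auto
  qed simp
  have cut: "sum ?x (edge_cut ?E S) = real (uses (edge_cut ?E S) p)" for S
  proof -
    have "sum ?x (edge_cut ?E S) = (\<Sum>e\<in>edge_cut ?E S. real (uses {e} p))"
      by (rule sum.cong) (auto simp: edge_cut_def)
    also have "\<dots> = real (\<Sum>e\<in>edge_cut ?E S. uses {e} p)" by simp
    also have "(\<Sum>e\<in>edge_cut ?E S. uses {e} p) = uses (edge_cut ?E S) p"
      using finE by (intro sum_uses) (simp add: edge_cut_def)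
    finally show ?thesis .
  qed
  have pos: "uses (edge_cut ?E S) p \<noteq> 0" if "S \<noteq> {}" "S \<subset> V" for S
  proof
    assume z: "uses (edge_cut ?E S) p = 0"
    have "v \<in> S \<longleftrightarrow> hd p \<in> S" if "v \<in> V" for v
      using uses_cut_zero[OF order_refl p(3) suc z] that p(2) by blast
    then show False using that by blast
  qed
  have ends: "card (S \<inter> {hd p, last p}) = 1 \<longleftrightarrow> (hd p \<in> S) \<noteq> (last p \<in> S)" for S
    using card_inter_doubleton[OF p(4), of S] by (simp add: Int_commute)
  have two: "2 \<le> sum ?x (edge_cut ?E S)" if S: "S \<noteq> {}" "S \<subset> V" "card (S \<inter> {hd p, last p}) \<noteq> 1" for S
  proof -
    have "even (uses (edge_cut ?E S) p)" using uses_cut_parity[OF order_refl p(3) suc, of S] S(3) ends by blast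
    then have "2 \<le> uses (edge_cut ?E S) p" using pos[OF S(1,2)] by (elim evenE) simp
    then show ?thesis unfolding cut by simp
  qed
  have one: "1 \<le> sum ?x (edge_cut ?E S)" if S: "S \<noteq> {}" "S \<subset> V" for S
    using pos[OF S] unfolding cut by simp
  have deg: "sum ?x (edge_cut ?E {v}) = (if v = hd p then 0 else 1) + (if v = last p then 0 else 1)" if "v \<in> V" for v
    unfolding cut using uses_star[OF p(1), of V v] p(2) that by simp
  have pV: "hd p \<in> V" "last p \<in> V" using p by auto
  have "?x \<in> ?E \<rightarrow>\<^sub>E {0..1}"
    by (rule subsetD[OF PiE_mono x01]) simp
  then have "?x \<in> SP V ?E (hd p) (last p)"
    unfolding SP_def mem_Collect_eq
  proof (intro conjI allI impI ballI)
    fix S assume "S \<noteq> {} \<and> S \<subset> V \<and> card (S \<inter> {hd p, last p}) \<noteq> 1"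
    then show "2 \<le> sum ?x (edge_cut ?E S)" by (elim conjE) (rule two)
  next
    fix S assume "S \<noteq> {} \<and> S \<subset> V \<and> card (S \<inter> {hd p, last p}) = 1"
    then show "1 \<le> sum ?x (edge_cut ?E S)" by (elim conjE) (rule one)
  next
    fix v assume v: "v \<in> V - {hd p, last p}"
    then have "v \<noteq> hd p" "v \<noteq> last p" "v \<in> V" by simp_all
    then show "sum ?x (edge_cut ?E {v}) = 2" unfolding deg[OF \<open>v \<in> V\<close>] by (simp only: if_False one_add_one)
  next
    fix v assume "v \<in> {hd p, last p}"
    then show "sum ?x (edge_cut ?E {v}) = 1"
    proof (elim insertE emptyE)
      assume "v = hd p"
      then show ?thesis using deg[OF pV(1)] p(4) by (simp only: if_False if_True add_0_left simp_thms)
    next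
      assume "v = last p"
      then show ?thesis using deg[OF pV(2)] p(4)[symmetric] by (simp only: if_False if_True add_0_right simp_thms)
    qed
  qed
  then show ?thesis using x01 unfolding SP_int_def by (rule IntI)
qed

lemma SP_int_arg_min:
  fixes f :: "('a set \<Rightarrow> real) \<Rightarrow> real"
  assumes fin: "finite V" and st: "s \<in> V" "t \<in> V" "s \<noteq> t"
  shows "\<exists>x. is_arg_min f (\<lambda>z. z \<in> SP_int V (complete_edges V) s t) x"
proof -
  have finE: "finite (complete_edges V)" by (rule finite_subset[of _ "Pow V"]) (auto simp: complete_edges_def fin)
  obtain q where q: "set q = V - {s, t}" "distinct q" using finite_distinct_list[of "V - {s, t}"] fin by auto
  let ?p = "s # q @ [t]"
  have "distinct ?p" "set ?p = V" using q st by auto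
  then have "SP_int V (complete_edges V) s t \<noteq> {}"
    using path_in_SP_int[OF fin, of ?p] st(3) by auto
  moreover have "finite (SP_int V (complete_edges V) s t)"
    unfolding SP_int_def using finE by (intro finite_Int disjI2 finite_PiE) auto
  ultimately show ?thesis by (intro ex_is_arg_min_if_finite)
qed

section \<open>Connectedness and shortest-path distances\<close>

text \<open>Paths must not repeat vertices: if \<open>u\<close> already occurs, the part of
  \<open>p\<close> before it is dropped.\<close>

lemma path_extend:
  assumes p: "is_path V F p" and u: "u \<in> V" "{u, hd p} \<in> F"
  shows "\<exists>q. is_path V F q \<and> hd q = u \<and> last q = last p"
proof (cases "u \<in> set p")
  case False
  then have "is_path V F (u # p)" using p u by (cases p) (simp_all add: is_path_def)
  then show ?thesis using p by (intro exI[of _ "u # p"]) (simp add: is_path_def)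
next
  case True
  then obtain xs ys where "p = xs @ u # ys" by (auto simp: in_set_conv_decomp)
  then have "is_path V F (u # ys)" "last (u # ys) = last p"
    using p by (simp_all add: is_path_def successively_append_iff)
  then show ?thesis by (intro exI[of _ "u # ys"]) (simp only: list.sel simp_thms)
qed

lemma rtrancl_imp_path:
  assumes "(u, v) \<in> {(a, b). a \<in> V \<and> b \<in> V \<and> {a, b} \<in> F}\<^sup>*" "v \<in> V"
  shows "\<exists>p. is_path V F p \<and> hd p = u \<and> last p = v"
  using assms(1)
proof (induction rule: converse_rtrancl_induct)
  case base
  show ?case using assms(2) by (intro exI[of _ "[v]"]) (simp add: is_path_def)
next
  case (step a b)
  then obtain p where p: "is_path V F p" "hd p = b" "last p = v" by blast
  have "a \<in> V" "{a, hd p} \<in> F" using step(1) p(2) by simp_all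
  then show ?case using path_extend[OF p(1)] p(3) by simp
qed

lemma graph_connectedI:
  assumes "\<And>v. v \<in> V \<Longrightarrow> (r, v) \<in> {(a, b). a \<in> V \<and> b \<in> V \<and> {a, b} \<in> F}\<^sup>*"
  shows "graph_connected V F"
  unfolding graph_connected_def
proof (intro ballI)
  fix u v assume uv: "u \<in> V" "v \<in> V"
  let ?R = "{(a, b). a \<in> V \<and> b \<in> V \<and> {a, b} \<in> F}"
  have "sym ?R" by (rule symI) (simp add: insert_commute)
  then have "(u, r) \<in> ?R\<^sup>*" using assms[OF uv(1)] by (rule symD[OF sym_rtrancl])
  then have "(u, v) \<in> ?R\<^sup>*" using assms[OF uv(2)] by (rule rtrancl_trans)
  then show "\<exists>p. is_path V F p \<and> hd p = u \<and> last p = v" using uv(2) by (rule rtrancl_imp_path)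
qed

text \<open>Connectedness makes the set under \<open>LEAST\<close> nonempty, so that the distance is
  attained by a path, though possibly with its ends in either order.\<close>

lemma path_metric_path:
  assumes con: "graph_connected V H" and e: "e \<in> complete_edges V"
  obtains p where "is_path V H p" "{hd p, last p} = e" "path_metric V H e = real (length p - 1)"
proof -
  obtain a b where ab: "e = {a, b}" "a \<in> V" "b \<in> V" using e by (rule complete_edgesE)
  then obtain p where p: "is_path V H p" "hd p = a" "last p = b" using con by (auto simp: graph_connected_def)
  let ?P = "\<lambda>k. \<exists>p. is_path V H p \<and> {hd p, last p} = e \<and> length p = Suc k"
  have "?P (length p - 1)" using p ab by (intro exI[of _ p]) (auto simp: is_path_def)
  then have "?P (LEAST k. ?P k)" by (rule LeastI)
  then obtain q where "is_path V H q" "{hd q, last q} = e" "length q = Suc (LEAST k. ?P k)" by blast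
  then show ?thesis using that[of q] by (simp add: path_metric_def)
qed

lemma path_metric_ge_1:
  assumes "graph_connected V H" "e \<in> complete_edges V"
  shows "1 \<le> path_metric V H e"
proof -
  obtain p where p: "is_path V H p" "{hd p, last p} = e" "path_metric V H e = real (length p - 1)"
    using assms by (rule path_metric_path)
  have "length p \<noteq> 1"
  proof
    assume "length p = 1"
    then obtain a where "p = [a]" by (auto simp: length_Suc_conv)
    then have "e = {a}" using p(2) by simp
    then show False using assms(2) by (simp add: complete_edges_def)
  qed
  moreover have "length p \<noteq> 0" using p(1) by (simp add: is_path_def)
  ultimately have "1 \<le> length p - 1" by linarith
  then show ?thesis unfolding p(3) by simp
qed

lemma path_metric_edge:
  assumes con: "graph_connected V H" and H: "H \<subseteq> complete_edges V" and e: "e \<in> H"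
  shows "path_metric V H e = 1"
proof (rule antisym)
  obtain a b where ab: "e = {a, b}" "a \<noteq> b" "a \<in> V" "b \<in> V" using subsetD[OF H e] by (rule complete_edgesE)
  have "is_path V H [a, b] \<and> {hd [a, b], last [a, b]} = e \<and> length [a, b] = Suc 1"
    using ab e by (simp add: is_path_def)
  then have "(LEAST k. \<exists>p. is_path V H p \<and> {hd p, last p} = e \<and> length p = Suc k) \<le> 1"
    by (intro Least_le) blast
  then show "path_metric V H e \<le> 1" unfolding path_metric_def by simp
  show "1 \<le> path_metric V H e" using path_metric_ge_1[OF con] H e by blast
qed

section \<open>Consequences of the degree equations\<close>

text \<open>Summing all degrees counts each edge twice and gives
  \<open>2 * (card V - 2) + 2\<close>. As distances are at least 1, this also bounds the fractional
  cost from below.\<close>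

lemma sum_SP:
  assumes fin: "finite V" and st: "s \<in> V" "t \<in> V" "s \<noteq> t" and z: "z \<in> SP V (complete_edges V) s t"
  shows "sum z (complete_edges V) = real (card V) - 1"
proof -
  let ?E = "complete_edges V"
  have finE: "finite ?E" by (rule finite_subset[of _ "Pow V"]) (auto simp: complete_edges_def fin)
  have "(\<Sum>v\<in>V. sum z (edge_cut ?E {v})) = (\<Sum>v\<in>V. \<Sum>e | e \<in> ?E \<and> v \<in> e. z e)"
    by (simp add: edge_cut_singleton)
  also have "\<dots> = (\<Sum>e\<in>?E. \<Sum>v | v \<in> V \<and> v \<in> e. z e)"
    using fin finE by (rule sum.swap_restrict)
  also have "\<dots> = (\<Sum>e\<in>?E. 2 * z e)"
  proof (rule sum.cong)
    fix e assume e: "e \<in> ?E"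
    then have "{v. v \<in> V \<and> v \<in> e} = e" "card e = 2" by (auto simp: complete_edges_def)
    then show "(\<Sum>v | v \<in> V \<and> v \<in> e. z e) = 2 * z e" by simp
  qed simp
  finally have a: "(\<Sum>v\<in>V. sum z (edge_cut ?E {v})) = 2 * sum z ?E" by (simp add: sum_distrib_left)
  have "(\<Sum>v\<in>V. sum z (edge_cut ?E {v})) = (\<Sum>v\<in>V - {s, t}. sum z (edge_cut ?E {v})) + (\<Sum>v\<in>{s, t}. sum z (edge_cut ?E {v}))"
    using st fin by (intro sum.subset_diff) auto
  also have "(\<Sum>v\<in>V - {s, t}. sum z (edge_cut ?E {v})) = (\<Sum>v\<in>V - {s, t}. 2)"
    using z by (intro sum.cong) (simp_all add: SP_def)
  also have "(\<Sum>v\<in>{s, t}. sum z (edge_cut ?E {v})) = (\<Sum>v\<in>{s, t}. 1)"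
    using z by (intro sum.cong) (auto simp: SP_def)
  also have "(\<Sum>v\<in>V - {s, t}. 2) + (\<Sum>v\<in>{s, t}. 1) = 2 * real (card (V - {s, t})) + 2" using st by simp
  also have "real (card (V - {s, t})) = real (card V) - 2"
  proof -
    have "card {s, t} \<le> card V" using st fin by (intro card_mono) auto
    then show ?thesis using st fin by (simp add: card_Diff_subset of_nat_diff)
  qed
  finally show ?thesis using a by simp
qed

text \<open>A linear equation valid on \<open>R\<close> holds in homogeneous form on the cone, and
  row 0 is the sum of the two cone elements \<open>X i\<close> and \<open>X 0 - X i\<close> for any
  index \<open>i\<close>.\<close>

lemma sum_N_plus:
  assumes R: "\<And>z. z \<in> R \<Longrightarrow> sum z I = c" and I: "I \<noteq> {}" and z: "z \<in> N_plus I R"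
  shows "sum z I = c"
proof -
  obtain i where i: "i \<in> I" using I by blast
  obtain X where X: "X None None = 1" "\<And>j. j \<in> I \<Longrightarrow> X None (Some j) = z j"
    "X (Some i) \<in> cone_over I R" "(\<lambda>j. X None j - X (Some i) j) \<in> cone_over I R"
    using z i unfolding N_plus_def by blast
  have con: "(\<Sum>j\<in>I. y (Some j)) = y None * c" if "y \<in> cone_over I R" for y
  proof -
    obtain x where x: "x \<in> R" "\<And>j. j \<in> I \<Longrightarrow> y (Some j) = y None * x j" using \<open>y \<in> cone_over I R\<close> by (auto simp: cone_over_def)
    then have "(\<Sum>j\<in>I. y (Some j)) = (\<Sum>j\<in>I. y None * x j)" by simp
    also have "\<dots> = y None * c" using R[OF x(1)] by (simp add: sum_distrib_left[symmetric])
    finally show ?thesis .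
  qed
  have "sum z I = (\<Sum>j\<in>I. X None (Some j))" using X(2) by simp
  also have "\<dots> = (\<Sum>j\<in>I. X (Some i) (Some j)) + (\<Sum>j\<in>I. X None (Some j) - X (Some i) (Some j))"
    by (simp add: sum_subtractf)
  also have "\<dots> = X (Some i) None * c + (X None None - X (Some i) None) * c"
    using con[OF X(3)] con[OF X(4)] by simp
  also have "\<dots> = c" using X(1) by (simp add: algebra_simps)
  finally show ?thesis .
qed

lemma sum_N_plus_power:
  assumes R: "\<And>z. z \<in> R \<Longrightarrow> sum z I = c" and I: "I \<noteq> {}"
  shows "z \<in> (N_plus I ^^ r) R \<Longrightarrow> sum z I = c"
proof (induction r arbitrary: z)
  case (Suc r)
  then show ?case using sum_N_plus[of "(N_plus I ^^ r) R" I c] I by simp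
qed (simp add: R)

lemma N_plus_power_nonneg:
  assumes "R \<subseteq> I \<rightarrow>\<^sub>E {0..1}" "z \<in> (N_plus I ^^ r) R"
  shows "z \<in> I \<rightarrow>\<^sub>E {0..1}"
  using assms by (cases r) (auto simp: N_plus_def)

lemma SP_int_sum:
  assumes z: "z \<in> SP_int V E s t" and F: "finite F" "F \<subseteq> E"
  shows "sum z F = real (card {e \<in> F. z e = 1})"
proof -
  have "z e = (if z e = 1 then 1 else 0)" if "e \<in> F" for e
  proof -
    have "z \<in> E \<rightarrow>\<^sub>E {0, 1}" using z by (simp add: SP_int_def)
    then have "z e \<in> {0, 1}" using subsetD[OF F(2) that] by (rule PiE_mem)
    then show ?thesis by auto
  qed
  then have "sum z F = (\<Sum>e\<in>F. if z e = 1 then 1 else 0)" by (rule sum.cong[OF refl])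
  also have "\<dots> = (\<Sum>e | e \<in> F \<and> z e = 1. 1)" by (rule sum.inter_filter[OF F(1), symmetric])
  also have "\<dots> = real (card {e \<in> F. z e = 1})" by simp
  finally show ?thesis .
qed

text \<open>Handshake argument: modulo 2 the degrees of the vertices in \<open>S\<close> count how
  many of \<open>s\<close> and \<open>t\<close> lie in \<open>S\<close>, while chosen edges within
  \<open>S\<close> contribute 2.\<close>

lemma SP_int_cut_parity:
  assumes fin: "finite V" and st: "s \<noteq> t" and z: "z \<in> SP_int V (complete_edges V) s t" and S: "S \<subseteq> V"
  shows "odd (card {e \<in> edge_cut (complete_edges V) S. z e = 1}) \<longleftrightarrow> (s \<in> S) \<noteq> (t \<in> S)"
proof -
  let ?E = "complete_edges V"
  define A where "A = {e \<in> ?E. z e = 1}"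
  have finE: "finite ?E" by (rule finite_subset[of _ "Pow V"]) (auto simp: complete_edges_def fin)
  have finA: "finite A" using finE by (simp add: A_def)
  have finS: "finite S" using finite_subset[OF S fin] .
  have deg: "card {e \<in> A. v \<in> e} = (if v = s \<or> v = t then 1 else 2)" if "v \<in> S" for v
  proof -
    have "v \<in> V" using that S by blast
    then have "sum z (edge_cut ?E {v}) = (if v = s \<or> v = t then 1 else 2)"
      using z by (simp add: SP_int_def SP_def)
    moreover have "sum z (edge_cut ?E {v}) = real (card {e \<in> edge_cut ?E {v}. z e = 1})"
      using finE by (intro SP_int_sum[OF z]) (auto simp: edge_cut_def)
    moreover have "{e \<in> edge_cut ?E {v}. z e = 1} = {e \<in> A. v \<in> e}"
      by (auto simp: A_def edge_cut_singleton)
    ultimately have "real (card {e \<in> A. v \<in> e}) = (if v = s \<or> v = t then 1 else 2)" by (simp only:)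
    then show ?thesis by (cases "v = s"; cases "v = t") simp_all
  qed
  have "(\<Sum>v\<in>S. card {e \<in> A. v \<in> e}) = (\<Sum>v\<in>S. \<Sum>e | e \<in> A \<and> v \<in> e. 1)" by simp
  also have "\<dots> = (\<Sum>e\<in>A. \<Sum>v | v \<in> S \<and> v \<in> e. 1)"
    using finS finA by (rule sum.swap_restrict)
  also have "\<dots> = (\<Sum>e\<in>A. card (e \<inter> S))"
    by (intro sum.cong) (auto intro: arg_cong[of _ _ card])
  finally have eq: "(\<Sum>v\<in>S. card {e \<in> A. v \<in> e}) = (\<Sum>e\<in>A. card (e \<inter> S))" .
  have "odd (card (e \<inter> S)) \<longleftrightarrow> card (e \<inter> S) = 1" if "e \<in> A" for e
  proof -
    have "e \<in> ?E" using that by (simp add: A_def)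
    then obtain a b where "e = {a, b}" "a \<noteq> b" by (rule complete_edgesE)
    then show ?thesis by (cases "a \<in> S"; cases "b \<in> S") auto
  qed
  then have "{e \<in> A. odd (card (e \<inter> S))} = {e \<in> edge_cut ?E S. z e = 1}"
    by (auto simp: A_def edge_cut_def)
  then have "odd (\<Sum>e\<in>A. card (e \<inter> S)) \<longleftrightarrow> odd (card {e \<in> edge_cut ?E S. z e = 1})"
    using finA by (simp add: even_sum_iff)
  moreover have "odd (\<Sum>v\<in>S. card {e \<in> A. v \<in> e}) \<longleftrightarrow> (s \<in> S) \<noteq> (t \<in> S)"
  proof -
    have "odd (card {e \<in> A. v \<in> e}) \<longleftrightarrow> v = s \<or> v = t" if "v \<in> S" for v
      unfolding deg[OF that] by simp
    then have "{v \<in> S. odd (card {e \<in> A. v \<in> e})} = {s, t} \<inter> S" by auto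
    then have "odd (\<Sum>v\<in>S. card {e \<in> A. v \<in> e}) \<longleftrightarrow> odd (card ({s, t} \<inter> S))"
      using finS by (simp add: even_sum_iff)
    then show ?thesis using st by (cases "s \<in> S"; cases "t \<in> S") auto
  qed
  ultimately show ?thesis using eq by simp
qed

text \<open>Two terms cannot both be 0, so at most one is; every other term is even and
  positive.\<close>

lemma even_sequence_sum:
  fixes b :: "nat \<Rightarrow> nat"
  assumes ev: "\<And>i. i < L \<Longrightarrow> even (b i)" and two: "\<And>i j. i < j \<Longrightarrow> j < L \<Longrightarrow> 2 \<le> b i + b j"
  shows "2 * (L - 1) \<le> (\<Sum>i<L. b i)"
proof (cases "\<exists>i<L. b i = 0")
  case True
  then obtain k where k: "k < L" "b k = 0" by blast
  have "2 \<le> b i" if "i \<in> {..<L} - {k}" for i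
  proof -
    have "i < k \<or> k < i" "i < L" using that by auto
    then show ?thesis using two[of i k] two[of k i] k by auto
  qed
  then have "(\<Sum>i\<in>{..<L} - {k}. 2) \<le> (\<Sum>i\<in>{..<L} - {k}. b i)" by (rule sum_mono)
  also have "\<dots> \<le> (\<Sum>i<L. b i)" by (rule sum_mono2) auto
  finally show ?thesis using k by simp
next
  case False
  have "2 \<le> b i" if "i \<in> {..<L}" for i
  proof -
    have "b i \<noteq> 0" "even (b i)" using that False ev by auto
    then show ?thesis by (elim evenE) simp
  qed
  then have "(\<Sum>i<L. 2) \<le> (\<Sum>i<L. b i)" by (rule sum_mono)
  then show ?thesis by simp
qed

lemma sum_pairs: "(\<Sum>k\<in>{1..2 * L}. y k) = (\<Sum>i<L. y (2 * i + 1) + y (2 * i + 2))" for y :: "nat \<Rightarrow> nat"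
proof (induction L)
  case (Suc L)
  have "{1..2 * Suc L} = insert (2 * L + 2) (insert (2 * L + 1) {1..2 * L})" by auto
  then show ?case using Suc by simp
qed simp

text \<open>\<open>a i\<close> and \<open>b i\<close> count the uses of the two edges in column
  \<open>i\<close>. By \<open>odd0\<close> and \<open>ea\<close> all \<open>a i\<close> are odd,
  hence at least 1; the column condition then makes all \<open>b i\<close> even. The bound is
  \<open>L + 2 * (L - 1)\<close>.\<close>

lemma two_chains_sum:
  fixes a b :: "nat \<Rightarrow> nat"
  assumes L: "1 \<le> L" and col: "\<And>i. i < L \<Longrightarrow> odd (a i + b i)"
    and ea: "\<And>i j. i < j \<Longrightarrow> j < L \<Longrightarrow> even (a i + a j)"
    and b2: "\<And>i j. i < j \<Longrightarrow> j < L \<Longrightarrow> 2 \<le> b i + b j"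
    and odd0: "odd (a 0)"
  shows "3 * L - 2 \<le> (\<Sum>i<L. a i + b i)"
proof -
  have oa: "odd (a i)" if "i < L" for i
    using ea[of 0 i] odd0 that by (cases "i = 0") auto
  then have eb: "even (b i)" if "i < L" for i using col[OF that] that by simp
  have "1 \<le> a i" if "i \<in> {..<L}" for i
  proof -
    have "odd (a i)" using oa that by simp
    then show ?thesis by (elim oddE) simp
  qed
  then have "(\<Sum>i<L. 1) \<le> (\<Sum>i<L. a i)" by (rule sum_mono)
  moreover have "2 * (L - 1) \<le> (\<Sum>i<L. b i)" using eb b2 by (rule even_sequence_sum)
  ultimately show ?thesis using L by (simp add: sum.distrib)
qed

context instance_data
begin

text \<open>The virtual edge between \<open>0\<close> and \<open>T\<close> is left out, and these
  two vertices lie in different cliques.\<close>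

definition "inst_graph = {e \<in> complete_edges V. e \<subseteq> side_ends False \<or> e \<subseteq> side_ends True} \<union> {{x, x + 2} |x. 1 \<le> x \<and> x \<le> 2 * L}"

abbreviation "edges \<equiv> complete_edges V"
abbreviation "metric \<equiv> path_metric V inst_graph"

lemma fin_V: "finite V" by (simp add: V_def)

lemma fin_edges: "finite edges"
  by (rule finite_subset[of _ "Pow V"]) (auto simp: complete_edges_def fin_V)

lemma ends_V: "0 \<in> V" "T \<in> V" "0 \<noteq> T"
  using small_in by (simp_all add: V_def T_def)

lemma inst_graph_edges: "inst_graph \<subseteq> edges"
proof
  fix e assume "e \<in> inst_graph"
  then consider "e \<in> edges" | x where "e = {x, x + 2}" "1 \<le> x" "x \<le> 2 * L" unfolding inst_graph_def by blast
  then show "e \<in> edges"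
  proof cases
    case 2
    then show ?thesis using subsetD[OF fixed_edges_edges fixed_edges_intros(2)] by simp
  qed
qed

lemma inst_graph_clique: "a \<in> side_ends g \<Longrightarrow> b \<in> side_ends g \<Longrightarrow> a \<noteq> b \<Longrightarrow> {a, b} \<in> inst_graph"
proof -
  assume ab: "a \<in> side_ends g" "b \<in> side_ends g" "a \<noteq> b"
  then have "{a, b} \<in> edges" using side_ends_V[of g] by (auto simp: doubleton_complete)
  then show ?thesis using ab by (cases g) (simp_all add: inst_graph_def)
qed

lemma inst_graph_chain: "1 \<le> x \<Longrightarrow> x \<le> 2 * L \<Longrightarrow> {x, x + 2} \<in> inst_graph"
  unfolding inst_graph_def by blast

lemma inst_graph_connected: "graph_connected V inst_graph"
proof (rule graph_connectedI)
  let ?R = "{(a, b). a \<in> V \<and> b \<in> V \<and> {a, b} \<in> inst_graph}"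
  have edge: "(a, b) \<in> ?R" if "{a, b} \<in> inst_graph" for a b
    using subsetD[OF inst_graph_edges that] that by (simp add: doubleton_complete)
  have clique: "(a, b) \<in> ?R\<^sup>*" if "a \<in> side_ends g" "b \<in> side_ends g" for a b g
    using edge[OF inst_graph_clique[OF that]] by (cases "a = b") (simp_all add: r_into_rtrancl)
  have chain: "(0, v) \<in> ?R\<^sup>*" if "1 \<le> v" "v \<le> 2 * L + 2" for v
    using that
  proof (induction v rule: less_induct)
    case (less v)
    show ?case
    proof (cases "v \<le> 2")
      case True
      then have "v = 1 \<or> v = 2" using less.prems by linarith
      then have "v \<in> side_ends False" using side_ends_small(2,3) by blast
      then show ?thesis using clique[OF side_ends_small(1)] by blast
    next
      case False
      then have w: "v - 2 < v" "1 \<le> v - 2" "v - 2 \<le> 2 * L" "v - 2 \<le> 2 * L + 2" "v - 2 + 2 = v" using less.prems by linarith+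
      have "{v - 2, v - 2 + 2} \<in> inst_graph" using w by (intro inst_graph_chain)
      then have "{v - 2, v} \<in> inst_graph" unfolding w(5) .
      then have "(v - 2, v) \<in> ?R" by (rule edge)
      with less.IH[OF w(1,2,4)] show ?thesis by (rule rtrancl.rtrancl_into_rtrancl)
    qed
  qed
  fix v assume v: "v \<in> V"
  show "(0, v) \<in> ?R\<^sup>*"
  proof (cases "v \<in> side_ends True \<union> side_ends False")
    case True
    then show ?thesis
    proof
      assume "v \<in> side_ends True"
      then have "(2 * L + 1, v) \<in> ?R\<^sup>*" using clique[OF side_ends_small(11)] by blast
      moreover have "(0, 2 * L + 1) \<in> ?R\<^sup>*" by (rule chain) simp_all
      ultimately show ?thesis by (rule rtrancl_trans[rotated])
    next
      assume "v \<in> side_ends False"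
      then show ?thesis using clique[OF side_ends_small(1)] by blast
    qed
  next
    case False
    then have "3 \<le> v" "v \<le> 2 * L" using v by (auto simp: side_ends_def V_def bds)
    then show ?thesis by (intro chain) simp_all
  qed
qed

abbreviation "gap_point \<equiv> restrict (state_vector 0 T fixed_edges side_ends (\<lambda>_. partner) (\<lambda>_ _. 0)) edges"

text \<open>Positive value occurs only at distance 1, so the cost of the fractional point is just
  its total weight.\<close>

lemma state_vector_support:
  assumes nz: "state_vector 0 T fixed_edges side_ends (\<lambda>_. partner) (\<lambda>_ _. 0) e \<noteq> 0"
  shows "e \<in> inst_graph"
proof (cases "e \<in> fixed_edges \<and> e \<noteq> {0, T}")
  case True
  then consider x where "e = {x, x + 2}" "1 \<le> x" "x \<le> 2 * L" | x where "e = {x, x + 1}" "even x" "bl \<le> x" "x < n"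
    unfolding fixed_edges_def by blast
  then show ?thesis
  proof cases
    case 1
    then show ?thesis using inst_graph_chain by simp
  next
    case 2
    have ne: "x + 1 \<noteq> br" "x + 1 \<noteq> n"
      using even_bl(2,3) 2(2) by (metis even_plus_one_iff)+
    show ?thesis
    proof (cases "x < br")
      case True
      then have "x \<in> side_ends False" "x + 1 \<in> side_ends False" using 2 ne(1) by (simp_all add: side_ends_def)
      then show ?thesis unfolding 2(1) by (rule inst_graph_clique) simp
    next
      case False
      then have "x \<in> side_ends True" "x + 1 \<in> side_ends True" using 2 ne(2) by (simp_all add: side_ends_def)
      then show ?thesis unfolding 2(1) by (rule inst_graph_clique) simp
    qed
  qed
next
  case False
  have "(\<Sum>g\<in>UNIV. edge_value (side_ends g) partner (\<lambda>_. 0) e) \<noteq> 0" using nz unfolding state_vector_def if_not_P[OF False] add_0_left .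
  then obtain g where "edge_value (side_ends g) partner (\<lambda>_. 0) e \<noteq> 0" by (rule sum.not_neutral_contains_not_neutral)
  then have "e \<in> allowed (side_ends g) partner" unfolding edge_value_def by presburger
  then obtain a b where "e = {a, b}" "a \<in> side_ends g" "b \<in> side_ends g" "a \<noteq> b" unfolding allowed_def by blast
  then show ?thesis using inst_graph_clique by simp
qed

lemma card_V: "card V = n" by (simp add: V_def)

lemma edges_ne: "edges \<noteq> {}"
  using fixed_edges_edges fixed_edges_intros(1) by blast

text \<open>Every point of the relaxation has total weight \<open>n - 1\<close> and all distances
  are at least 1, so \<open>n - 1\<close> bounds the cost from below; the point attains this
  bound.\<close>

lemma gap_point_arg_min:
  assumes r: "400 * (r + 3) + r \<le> m" "1000000 + r \<le> m"
  shows "is_arg_min (dot edges metric) (\<lambda>z. z \<in> (N_plus edges ^^ r) (SP V edges 0 T)) gap_point"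
    and "dot edges metric gap_point = real n - 1"
proof -
  have mem: "gap_point \<in> (N_plus edges ^^ r) (SP V edges 0 T)"
    using r by (intro state_vector_in_N_plus_power[OF instance_state]) (simp_all add: card_reps_side_ends)
  have sum: "sum z edges = real n - 1" if "z \<in> (N_plus edges ^^ r) (SP V edges 0 T)" for z
    using sum_N_plus_power[OF sum_SP[OF fin_V ends_V] edges_ne that] by (simp add: card_V)
  have "metric e * gap_point e = gap_point e" if "e \<in> edges" for e
  proof (cases "e \<in> inst_graph")
    case True
    then show ?thesis using path_metric_edge[OF inst_graph_connected inst_graph_edges] by simp
  next
    case False
    then have "state_vector 0 T fixed_edges side_ends (\<lambda>_. partner) (\<lambda>_ _. 0) e = 0" using state_vector_support by blast
    then show ?thesis using that by simp
  qed
  then have "dot edges metric gap_point = sum gap_point edges" unfolding dot_def by (rule sum.cong[OF refl])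
  then show val: "dot edges metric gap_point = real n - 1" using sum[OF mem] by simp
  have low: "real n - 1 \<le> dot edges metric z" if z: "z \<in> (N_plus edges ^^ r) (SP V edges 0 T)" for z
  proof -
    have "SP V edges 0 T \<subseteq> edges \<rightarrow>\<^sub>E {0..1}" unfolding SP_def by blast
    then have z01: "z \<in> edges \<rightarrow>\<^sub>E {0..1}" using z by (rule N_plus_power_nonneg)
    have "sum z edges \<le> dot edges metric z"
      unfolding dot_def
    proof (rule sum_mono)
      fix e assume e: "e \<in> edges"
      have "0 \<le> z e" using PiE_mem[OF z01 e] by simp
      then show "z e \<le> metric e * z e"
        using mult_right_mono[OF path_metric_ge_1[OF inst_graph_connected e]] by fastforce
    qed
    then show ?thesis using sum[OF z] by simp
  qed
  show "is_arg_min (dot edges metric) (\<lambda>z. z \<in> (N_plus edges ^^ r) (SP V edges 0 T)) gap_point"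
    unfolding is_arg_min_def val using mem low by (simp add: not_less)
qed

section \<open>Cuts of the instance graph and the integral lower bound\<close>

lemma cut_inst_graph:
  assumes S: "\<And>g. side_ends g \<subseteq> S \<or> side_ends g \<inter> S = {}"
  shows "edge_cut inst_graph S = {{x, x + 2} |x. 1 \<le> x \<and> x \<le> 2 * L \<and> (x \<in> S) \<noteq> (x + 2 \<in> S)}"
proof (intro set_eqI iffI)
  fix e assume e: "e \<in> edge_cut inst_graph S"
  then have c: "card (e \<inter> S) = 1" "e \<in> inst_graph" by (simp_all add: edge_cut_def)
  have "\<not> e \<subseteq> side_ends g" for g
  proof
    assume "e \<subseteq> side_ends g"
    then have "e \<inter> S = e \<or> e \<inter> S = {}" using S[of g] by blast
    moreover have "card e = 2" using c(2) inst_graph_edges by (auto simp: complete_edges_def)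
    ultimately show False using c(1) by auto
  qed
  then obtain x where x: "e = {x, x + 2}" "1 \<le> x" "x \<le> 2 * L" using c(2) unfolding inst_graph_def by blast
  then have "(x \<in> S) \<noteq> (x + 2 \<in> S)" using c(1) card_inter_doubleton[of x "x + 2" S] by simp
  then show "e \<in> {{x, x + 2} |x. 1 \<le> x \<and> x \<le> 2 * L \<and> (x \<in> S) \<noteq> (x + 2 \<in> S)}" using x by blast
next
  fix e assume "e \<in> {{x, x + 2} |x. 1 \<le> x \<and> x \<le> 2 * L \<and> (x \<in> S) \<noteq> (x + 2 \<in> S)}"
  then obtain x where x: "e = {x, x + 2}" "1 \<le> x" "x \<le> 2 * L" "(x \<in> S) \<noteq> (x + 2 \<in> S)" by blast
  then have "card (e \<inter> S) = 1" using card_inter_doubleton[of x "x + 2" S] by simp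
  then show "e \<in> edge_cut inst_graph S" using inst_graph_chain[OF x(2,3)] x(1) by (simp add: edge_cut_def)
qed

text \<open>Relates two edges of the same chain, the one entering the segment and the one leaving
  it. Neither \<open>0\<close> nor \<open>T\<close> is inside, so a Hamiltonian path crosses the cut
  an even, nonzero number of times.\<close>

lemma cut_segment:
  assumes ab: "1 \<le> a" "a < b" "b \<le> 2 * L" "even a = even b"
  defines "S \<equiv> {k. a < k \<and> k \<le> b \<and> even k = even a}"
  shows "edge_cut inst_graph S = {{a, a + 2}, {b, b + 2}}" "S \<noteq> {}" "S \<subset> V" "0 \<notin> S" "T \<notin> S"
proof -
  have up: "x + 2 \<le> c" if "even x = even c" "x < c" for x c :: nat
    using that by presburger
  have "side_ends g \<inter> S = {}" for g
  proof (rule equals0I)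
    fix k assume "k \<in> side_ends g \<inter> S"
    then have k: "k \<in> side_ends g" "a < k" "k \<le> b" "even k = even a" by (simp_all add: S_def)
    have "a + 2 \<le> k" using up[of a k] k by simp
    then have "3 \<le> k" "k \<le> 2 * L" using k(3) ab by linarith+
    moreover have "k \<le> 2 \<or> 2 * L + 1 \<le> k"
    proof (cases g)
      case True
      then have "k = 2 * L + 1 \<or> k = 2 * L + 2 \<or> k = T \<or> br \<le> k" using k(1) by (auto simp: side_ends_def)
      then show ?thesis using small_in(2,5) T_def by linarith
    next
      case False
      then have "k \<le> 2 \<or> bl \<le> k" using k(1) by (auto simp: side_ends_def)
      then show ?thesis using small_in(2) by linarith
    qed
    ultimately show False by linarith
  qed
  then have "edge_cut inst_graph S = {{x, x + 2} |x. 1 \<le> x \<and> x \<le> 2 * L \<and> (x \<in> S) \<noteq> (x + 2 \<in> S)}"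
    by (intro cut_inst_graph disjI2)
  moreover have "1 \<le> x \<and> x \<le> 2 * L \<and> (x \<in> S) \<noteq> (x + 2 \<in> S) \<longleftrightarrow> x = a \<or> x = b" for x
  proof (cases "even x = even a")
    case True
    have "x < a \<longrightarrow> x + 2 \<le> a" "x < b \<longrightarrow> x + 2 \<le> b" using up[of x a] up[of x b] True ab by simp_all
    moreover have "x \<in> S \<longleftrightarrow> a < x \<and> x \<le> b" "x + 2 \<in> S \<longleftrightarrow> a < x + 2 \<and> x + 2 \<le> b"
      using True by (simp_all add: S_def)
    moreover have "x < a \<or> x = a \<or> a < x \<and> x < b \<or> x = b \<or> b < x" by linarith
    ultimately show ?thesis using ab(1-3) by (elim disjE) auto
  next
    case False
    then have "x \<notin> S" "x + 2 \<notin> S" "x \<noteq> a" "x \<noteq> b" using ab by (auto simp: S_def)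
    then show ?thesis by simp
  qed
  ultimately show "edge_cut inst_graph S = {{a, a + 2}, {b, b + 2}}" by auto
  have "b \<in> S" using ab by (simp add: S_def)
  then show "S \<noteq> {}" by blast
  show z: "0 \<notin> S" "T \<notin> S" using ab by (auto simp: S_def T_def)
  have "k \<in> V" if "k \<in> S" for k
    using that ab small_in(2,5,6) by (simp add: S_def V_def)
  then show "S \<subset> V" using z(1) ends_V(1) by blast
qed

text \<open>The clique of \<open>0\<close> together with the beginnings of both chains separates
  \<open>0\<close> from \<open>T\<close> and cuts one edge of each chain, those of column
  \<open>i\<close>.\<close>

lemma cut_column:
  assumes i: "i < L"
  defines "S \<equiv> side_ends False \<union> {k. 1 \<le> k \<and> k \<le> 2 * i + 2}"
  shows "edge_cut inst_graph S = {{2 * i + 1, 2 * i + 1 + 2}, {2 * i + 2, 2 * i + 2 + 2}}" "S \<subseteq> V" "0 \<in> S" "T \<notin> S"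
proof -
  have "side_ends True \<inter> S = {}"
  proof (rule equals0I)
    fix k assume "k \<in> side_ends True \<inter> S"
    then have k: "k \<in> side_ends True" "k \<notin> side_ends False" "k \<in> S" using side_ends_disj by auto
    then have "k = 2 * L + 1 \<or> k = 2 * L + 2 \<or> k = T \<or> br \<le> k" "k \<le> 2 * i + 2" by (auto simp: side_ends_def S_def)
    then show False using small_in(2,5) T_def i by linarith
  qed
  moreover have "side_ends False \<subseteq> S" by (simp add: S_def)
  ultimately have "side_ends g \<subseteq> S \<or> side_ends g \<inter> S = {}" for g by (cases g) simp_all
  then have "edge_cut inst_graph S = {{x, x + 2} |x. 1 \<le> x \<and> x \<le> 2 * L \<and> (x \<in> S) \<noteq> (x + 2 \<in> S)}"
    by (rule cut_inst_graph)
  moreover have "1 \<le> x \<and> x \<le> 2 * L \<and> (x \<in> S) \<noteq> (x + 2 \<in> S) \<longleftrightarrow> x = 2 * i + 1 \<or> x = 2 * i + 2" for x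
  proof -
    have low: "z \<in> S \<longleftrightarrow> z \<le> 2 * i + 2" if "1 \<le> z" "z \<le> 2 * L + 2" for z
    proof -
      have "z \<le> 2" if "z \<in> side_ends False" using that \<open>z \<le> 2 * L + 2\<close> small_in(3) by (auto simp: side_ends_def)
      then show ?thesis using that by (auto simp: S_def)
    qed
    show ?thesis
    proof (cases "1 \<le> x \<and> x \<le> 2 * L")
      case True
      then show ?thesis using low[of x] low[of "x + 2"] by auto
    next
      case False
      then show ?thesis using i by auto
    qed
  qed
  ultimately show "edge_cut inst_graph S = {{2 * i + 1, 2 * i + 1 + 2}, {2 * i + 2, 2 * i + 2 + 2}}" by auto
  have "k \<in> V" if "1 \<le> k \<and> k \<le> 2 * i + 2" for k using that i small_in(3,5,6) by (simp add: V_def)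
  then show "S \<subseteq> V" unfolding S_def using side_ends_V by blast
  show "0 \<in> S" using side_ends_small(1) by (simp add: S_def)
  show "T \<notin> S" using side_ends_small(4) i by (simp add: S_def T_def)
qed

text \<open>Replacing each edge of a Hamiltonian path by a shortest path of the graph yields a walk
  whose crossing numbers of the cuts above are controlled in parity and in size.\<close>

lemma SP_int_lower:
  assumes x: "x \<in> SP_int V edges 0 T"
  shows "real (3 * L - 2) \<le> dot edges metric x"
proof -
  define A where "A = {e \<in> edges. x e = 1}"
  have finA: "finite A" using fin_edges by (simp add: A_def)
  have AE: "e \<in> edges" if "e \<in> A" for e using that by (simp add: A_def)
  have "\<forall>e\<in>edges. \<exists>p. is_path V inst_graph p \<and> {hd p, last p} = e \<and> metric e = real (length p - 1)"
    by (blast elim: path_metric_path[OF inst_graph_connected])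
  then obtain P where P: "\<And>e. e \<in> edges \<Longrightarrow> is_path V inst_graph (P e)" "\<And>e. e \<in> edges \<Longrightarrow> {hd (P e), last (P e)} = e"
    "\<And>e. e \<in> edges \<Longrightarrow> metric e = real (length (P e) - 1)"
    by metis
  \<comment> \<open>The number of times that the shortest paths replacing the edges of the
    Hamiltonian path use the chain edge with smaller end \<open>k\<close>.\<close>
  define y where "y k = (\<Sum>e\<in>A. uses {{k, k + 2}} (P e))" for k :: nat
  have pair_inj: "{j, j + 2} = {k, k + 2} \<longleftrightarrow> j = k" for j k :: nat
    by (auto simp: doubleton_eq_iff)
  \<comment> \<open>An edge of the Hamiltonian path crosses \<open>S\<close> exactly if its shortest
    path uses the cut of the graph an odd number of times. Hence the total has the parity of the
    number of crossing edges and is at least that number.\<close>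
  have cut: "(odd (y j + y k) \<longleftrightarrow> (0 \<in> S) \<noteq> (T \<in> S)) \<and> card {e \<in> edge_cut edges S. x e = 1} \<le> y j + y k"
    if S: "S \<subseteq> V" and H: "edge_cut inst_graph S = {{j, j + 2}, {k, k + 2}}" and jk: "j \<noteq> k" for S j k
  proof -
    let ?C = "{e \<in> edge_cut edges S. x e = 1}"
    have total: "y j + y k = (\<Sum>e\<in>A. uses (edge_cut inst_graph S) (P e))"
    proof -
      have "uses (edge_cut inst_graph S) p = uses {{j, j + 2}} p + uses {{k, k + 2}} p" for p
        unfolding H insert_is_Un[of _ "{{k, k + 2}}"] using pair_inj[of j k] jk by (intro uses_Un) simp
      then show ?thesis by (simp add: y_def sum.distrib)
    qed
    have odd: "odd (uses (edge_cut inst_graph S) (P e)) \<longleftrightarrow> e \<in> ?C" if e: "e \<in> A" for e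
    proof -
      have p: "P e \<noteq> []" "successively (\<lambda>u v. {u, v} \<in> inst_graph) (P e)" using P(1)[OF AE[OF e]] by (simp_all add: is_path_def)
      have "hd (P e) \<noteq> last (P e)"
      proof
        assume "hd (P e) = last (P e)"
        then have "e = {hd (P e)}" using P(2)[OF AE[OF e]] by simp
        then have "card e = 1" by (metis card_1_singleton_iff One_nat_def)
        then show False using AE[OF e] by (simp add: complete_edges_def)
      qed
      then have "card (e \<inter> S) = 1 \<longleftrightarrow> (hd (P e) \<in> S) \<noteq> (last (P e) \<in> S)"
        using card_inter_doubleton[of "hd (P e)" "last (P e)" S] P(2)[OF AE[OF e]] by simp
      then show ?thesis using uses_cut_parity[OF inst_graph_edges p, of S] e by (simp add: A_def edge_cut_def)
    qed
    have CA: "?C \<subseteq> A" by (auto simp: A_def edge_cut_def)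
    have "{e \<in> A. odd (uses (edge_cut inst_graph S) (P e))} = ?C" using odd CA by blast
    then have "odd (y j + y k) \<longleftrightarrow> odd (card ?C)" unfolding total using finA by (simp add: even_sum_iff)
    moreover have "card ?C \<le> y j + y k"
    proof -
      have "card ?C = (\<Sum>e\<in>?C. 1)" by simp
      also have "\<dots> \<le> (\<Sum>e\<in>?C. uses (edge_cut inst_graph S) (P e))"
      proof (rule sum_mono)
        fix e assume "e \<in> ?C"
        then have "odd (uses (edge_cut inst_graph S) (P e))" using odd CA by blast
        then show "1 \<le> uses (edge_cut inst_graph S) (P e)" by (elim oddE) simp
      qed
      also have "\<dots> \<le> (\<Sum>e\<in>A. uses (edge_cut inst_graph S) (P e))" using finA CA by (intro sum_mono2) simp_all
      finally show ?thesis unfolding total .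
    qed
    ultimately show ?thesis using SP_int_cut_parity[OF fin_V ends_V(3) x S] by simp
  qed
  have seg: "even (y j + y k) \<and> 2 \<le> y j + y k" if jk: "1 \<le> j" "j < k" "k \<le> 2 * L" "even j = even k" for j k
  proof -
    define S where "S = {l. j < l \<and> l \<le> k \<and> even l = even j}"
    note s = cut_segment[OF jk, folded S_def]
    have "card (S \<inter> {0, T}) \<noteq> 1" using s(4,5) by simp
    moreover have "x \<in> SP V edges 0 T" using x by (simp add: SP_int_def)
    ultimately have "2 \<le> sum x (edge_cut edges S)" using s(2,3) unfolding SP_def by blast
    also have "\<dots> = real (card {e \<in> edge_cut edges S. x e = 1})"
      using fin_edges by (intro SP_int_sum[OF x]) (auto simp: edge_cut_def)
    finally have "2 \<le> card {e \<in> edge_cut edges S. x e = 1}" by simp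
    moreover have "S \<subseteq> V" "j \<noteq> k" using s(3) jk by simp_all
    ultimately show ?thesis using cut[OF _ s(1)] s(4,5) by fastforce
  qed
  have col: "odd (y (2 * i + 1) + y (2 * i + 2))" if i: "i < L" for i
    using cut[OF cut_column(2)[OF i] cut_column(1)[OF i]] cut_column(3,4)[OF i] by simp
  have seg1: "even (y (2 * i + 1) + y (2 * j + 1)) \<and> 2 \<le> y (2 * i + 1) + y (2 * j + 1)" if "i < j" "j < L" for i j
    using that by (intro seg) simp_all
  have seg2: "even (y (2 * i + 2) + y (2 * j + 2)) \<and> 2 \<le> y (2 * i + 2) + y (2 * j + 2)" if "i < j" "j < L" for i j
    using that by (intro seg) simp_all
  \<comment> \<open>The edges of the first column decide which chain is used an odd number of times;
    that chain takes the role of \<open>a\<close> in \<open>two_chains_sum\<close>.\<close>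
  have "3 * L - 2 \<le> (\<Sum>i<L. y (2 * i + 1) + y (2 * i + 2))"
  proof (cases "odd (y (2 * 0 + 1))")
    case True
    then show ?thesis
      by (intro two_chains_sum[where a = "\<lambda>i. y (2 * i + 1)" and b = "\<lambda>i. y (2 * i + 2)"] L1 col)
        (simp_all only: seg1 seg2 not_False_eq_True)
  next
    case False
    have col': "odd (y (2 * i + 2) + y (2 * i + 1))" if "i < L" for i using col[OF that] by simp
    from False have "odd (y (2 * 0 + 2))" using col[of 0] L1 by simp
    then have "3 * L - 2 \<le> (\<Sum>i<L. y (2 * i + 2) + y (2 * i + 1))"
      by (intro two_chains_sum[where b = "\<lambda>i. y (2 * i + 1)" and a = "\<lambda>i. y (2 * i + 2)"] L1 col')
        (simp_all only: seg1 seg2 not_False_eq_True)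
    then show ?thesis by (simp only: add.commute)
  qed
  also have "\<dots> = (\<Sum>k\<in>{1..2 * L}. y k)" by (rule sum_pairs[symmetric])
  \<comment> \<open>Exchanging the sums counts, for each edge of the Hamiltonian path, the chain
    steps of its shortest path; their number is at most the length of that path.\<close>
  also have "\<dots> = (\<Sum>e\<in>A. \<Sum>k\<in>{1..2 * L}. uses {{k, k + 2}} (P e))"
    unfolding y_def by (rule sum.swap)
  also have "\<dots> \<le> (\<Sum>e\<in>A. length (P e) - 1)"
  proof (rule sum_mono)
    fix e
    have inj: "inj_on (\<lambda>k. {k, k + 2}) {1..2 * L}" by (rule inj_onI) (simp only: pair_inj)
    have "(\<Sum>k\<in>{1..2 * L}. uses {{k, k + 2}} (P e)) = (\<Sum>h\<in>(\<lambda>k. {k, k + 2}) ` {1..2 * L}. uses {h} (P e))"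
      by (simp only: sum.reindex[OF inj] o_def)
    also have "\<dots> = uses ((\<lambda>k. {k, k + 2}) ` {1..2 * L}) (P e)" by (rule sum_uses) simp
    finally show "(\<Sum>k\<in>{1..2 * L}. uses {{k, k + 2}} (P e)) \<le> length (P e) - 1" using uses_le by simp
  qed
  finally have "real (3 * L - 2) \<le> real (\<Sum>e\<in>A. length (P e) - 1)" by (simp only: of_nat_le_iff)
  also have "\<dots> = (\<Sum>e\<in>A. metric e)" using P(3) AE by simp
  also have "\<dots> = (\<Sum>e\<in>A. metric e * x e)" by (intro sum.cong) (simp_all add: A_def)
  also have "\<dots> = (\<Sum>e\<in>edges. metric e * x e)"
  proof (rule sum.mono_neutral_left[OF fin_edges])
    show "A \<subseteq> edges" by (auto simp: A_def)
    show "\<forall>e\<in>edges - A. metric e * x e = 0"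
    proof
      fix e assume e: "e \<in> edges - A"
      have "x \<in> edges \<rightarrow>\<^sub>E {0, 1}" using x by (simp add: SP_int_def)
      then have "x e \<in> {0, 1}" by (rule PiE_mem) (use e in simp)
      then show "metric e * x e = 0" using e by (auto simp: A_def)
    qed
  qed
  finally show ?thesis by (simp add: dot_def)
qed

end

theorem theorem2:
  fixes \<epsilon> :: real
  assumes "\<epsilon> > 0"
  shows "\<exists>\<gamma>::real. \<gamma> > 0 \<and>
    (\<forall>N::nat. \<exists>n\<ge>N. \<exists>(V :: nat set) H s t.
       finite V \<and> card V = n \<and>
       H \<subseteq> complete_edges V \<and> graph_connected V H \<and>
       s \<in> V \<and> t \<in> V \<and> s \<noteq> t \<and>
       (let E = complete_edges V; d = path_metric V H; r = nat \<lfloor>\<gamma> * real n\<rfloor> in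
        \<exists>x y.
          is_arg_min (dot E d) (\<lambda>z. z \<in> SP_int V E s t) x \<and>
          is_arg_min (dot E d) (\<lambda>z. z \<in> (N_plus E ^^ r) (SP V E s t)) y \<and>
          dot E d x / dot E d y \<ge> 3 / 2 - \<epsilon>))"
proof -
  \<comment> \<open>\<open>K\<close> is the ratio of the chain length parameter \<open>L\<close> to
    \<open>m\<close>. The cliques spoil the ratio by a term \<open>6 * m\<close>, which has to be
    outweighed by \<open>2 * \<epsilon> * L\<close>; this is at least \<open>8 * m\<close> once
    \<open>K * \<epsilon> \<ge> 4\<close>.\<close>
  define K where "K = nat \<lceil>4 / \<epsilon>\<rceil> + 1"
  have K1: "1 \<le> K" by (simp add: K_def)
  have "4 / \<epsilon> \<le> real K" unfolding K_def by linarith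
  then have K4: "4 \<le> real K * \<epsilon>" using assms by (simp add: pos_divide_le_eq)
  \<comment> \<open>As \<open>n \<le> (2 * K + 8) * m\<close>, this choice gives
    \<open>r \<le> m / 1000\<close>, comfortably within the limit of about \<open>m / 401\<close>
    for the number of rounds.\<close>
  define \<gamma> where "\<gamma> = 1 / (1000 * (2 * real K + 8))"
  have \<gamma>: "0 < \<gamma>" by (simp add: \<gamma>_def add_nonneg_pos)
  have main: "\<exists>n\<ge>N. \<exists>(V :: nat set) H s t.
       finite V \<and> card V = n \<and>
       H \<subseteq> complete_edges V \<and> graph_connected V H \<and>
       s \<in> V \<and> t \<in> V \<and> s \<noteq> t \<and>
       (let E = complete_edges V; d = path_metric V H; r = nat \<lfloor>\<gamma> * real n\<rfloor> in
        \<exists>x y.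
          is_arg_min (dot E d) (\<lambda>z. z \<in> SP_int V E s t) x \<and>
          is_arg_min (dot E d) (\<lambda>z. z \<in> (N_plus E ^^ r) (SP V E s t)) y \<and>
          dot E d x / dot E d y \<ge> 3 / 2 - \<epsilon>)" for N
  proof -
    \<comment> \<open>The large constant absorbs the additive terms 1200 and 1000000 in the size
      conditions of \<open>gap_point_arg_min\<close>; the maximum with \<open>N\<close> makes the
      instances arbitrarily large.\<close>
    define m where "m = max N 2000000"
    define L where "L = K * m"
    have m: "2000000 \<le> m" "N \<le> m" by (simp_all add: m_def)
    have "1 * 1 \<le> K * m" using K1 m by (intro mult_le_mono) simp_all
    then have L1: "1 \<le> L" by (simp add: L_def)
    interpret I: instance_data L m using L1 m by unfold_locales simp_all
    have n: "I.n = 2 * L + 4 + 4 * m" by (simp add: I.bds)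
    define r where "r = nat \<lfloor>\<gamma> * real I.n\<rfloor>"
    have "real I.n = 2 * (real K * real m) + 4 + 4 * real m" unfolding n by (simp add: L_def)
    also have "\<dots> \<le> (2 * real K + 8) * real m" using m by (simp add: algebra_simps)
    finally have "\<gamma> * real I.n \<le> \<gamma> * ((2 * real K + 8) * real m)" using \<gamma> by (intro mult_left_mono) simp_all
    also have "\<dots> = real m / 1000" by (simp add: \<gamma>_def field_simps)
    finally have "\<gamma> * real I.n \<le> real m / 1000" .
    moreover have "0 \<le> \<gamma> * real I.n" using \<gamma> by simp
    ultimately have "real r \<le> real m / 1000" unfolding r_def by linarith
    moreover have "2000000 \<le> real m" using m(1) by simp
    ultimately have "real (400 * (r + 3) + r) \<le> real m" "real (1000000 + r) \<le> real m" by simp_all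
    then have r: "400 * (r + 3) + r \<le> m" "1000000 + r \<le> m" by (simp_all only: of_nat_le_iff)
    obtain x where x: "is_arg_min (dot I.edges I.metric) (\<lambda>z. z \<in> SP_int I.V I.edges 0 I.T) x"
      using SP_int_arg_min[OF I.fin_V I.ends_V] by blast
    have "3 * real L - 2 \<le> dot I.edges I.metric x"
      using I.SP_int_lower[of x] x L1 by (simp add: is_arg_min_def of_nat_diff)
    moreover have "(3 / 2 - \<epsilon>) * (real I.n - 1) \<le> 3 * real L - 2"
    proof -
      \<comment> \<open>Of the \<open>8 * m\<close> gained from \<open>K\<close>,
        \<open>6 * m\<close> pays for the cliques; the rest covers the constants
        \<open>9 / 2\<close> and 2.\<close>
      have "4 * real m \<le> (real K * \<epsilon>) * real m" using K4 by (intro mult_right_mono) simp_all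
      moreover have "0 \<le> \<epsilon> * real m" using assms by simp
      moreover have "(3 / 2 - \<epsilon>) * (real I.n - 1)
          = 3 * real L + 6 * real m + 9 / 2 - 2 * ((real K * \<epsilon>) * real m) - 4 * (\<epsilon> * real m) - 3 * \<epsilon>"
        unfolding n by (simp add: L_def algebra_simps)
      moreover have "2000000 \<le> real m" using m(1) by simp
      ultimately show ?thesis using assms by linarith
    qed
    moreover have "0 < real I.n - 1" using m by (simp add: n)
    ultimately have ratio: "3 / 2 - \<epsilon> \<le> dot I.edges I.metric x / (real I.n - 1)"
      by (simp add: pos_le_divide_eq)
    have opt: "\<exists>x y. is_arg_min (dot I.edges I.metric) (\<lambda>z. z \<in> SP_int I.V I.edges 0 I.T) x \<and>
        is_arg_min (dot I.edges I.metric) (\<lambda>z. z \<in> (N_plus I.edges ^^ r) (SP I.V I.edges 0 I.T)) y \<and>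
        dot I.edges I.metric x / dot I.edges I.metric y \<ge> 3 / 2 - \<epsilon>"
      by (rule exI[of _ x], rule exI[of _ I.gap_point], intro conjI x I.gap_point_arg_min(1)[OF r])
        (unfold I.gap_point_arg_min(2)[OF r], rule ratio)
    have Nn: "N \<le> I.n" using m by (simp add: n)
    show ?thesis
      unfolding Let_def
      by (rule exI[of _ I.n], rule conjI, rule Nn, rule exI[of _ I.V], rule exI[of _ I.inst_graph],
          rule exI[of _ 0], rule exI[of _ I.T])
        (intro conjI I.fin_V I.card_V I.inst_graph_edges I.inst_graph_connected I.ends_V, rule opt[unfolded r_def])
  qed
  show ?thesis by (rule exI[of _ \<gamma>], rule conjI, rule \<gamma>, rule allI, rule main)
qed

end
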